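(* Let $G$ and $H$ be two groups with $G$ non-trivial, and let $X$ be a set on which $H$ acts. Suppose that $H$ acts on $X$ without fixed points. Then $G\wr_X H$ has property FA (respectively property FR) if and only if all of the following hold: $H$ has property FA (respectively property FR); $H$ acts on $X$ with finitely many orbits; $G$ has no quotient isomorphic to $\mathbf{Z}$; and $G$ cannot be written as a countable increasing union of proper subgroups.
   Context: Wreath product: $\bigoplus_X G$ is the group (with componentwise multiplication) of functions $\varphi\colon X\to G$ with $\varphi(x)=1$ for all but finitely many $x$. The group $H$ acts on it by $(h.\varphi)(x)=\varphi(h^{-1}.x)$, and $G\wr_X H:=(\bigoplus_X G)\rtimes H$. "Without fixed points" means that no point of $X$ is fixed by all of $H$. A group has property FA if any action by graph isomorphisms on a tree (with the shortest-path metric) has bounded orbits. A group has property FR if any action by isometries on a real tree has bounded orbits.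
   Formalization: X is assumed non-empty: for X empty "without fixed points" holds vacuously and the wreath product is just H, so with H trivial and G = Z it has FA and FR although G has a quotient isomorphic to Z, and the stated equivalence fails. *)

theory Defs
  imports
    "HOL-Algebra.Group_Action"
    "HOL-Algebra.Elementary_Groups"
    "HOL-Algebra.Product_Groups"
    "HOL-Analysis.Analysis"
begin

section \<open>Permutational wreath products\<close>

definition semidirect_product ::
    "('n, 'c) monoid_scheme \<Rightarrow> ('h, 'd) monoid_scheme \<Rightarrow> ('h \<Rightarrow> 'n \<Rightarrow> 'n) \<Rightarrow> ('n \<times> 'h) monoid"
  where "semidirect_product N H \<alpha> =
    \<lparr>carrier = carrier N \<times> carrier H,
     monoid.mult = (\<lambda>(f, h) (f', h'). (f \<otimes>\<^bsub>N\<^esub> \<alpha> h f', h \<otimes>\<^bsub>H\<^esub> h')),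
     one = (\<one>\<^bsub>N\<^esub>, \<one>\<^bsub>H\<^esub>)\<rparr>"

text \<open>
  The elements of \<open>sum_group X (\<lambda>_. G)\<close> are the functions from \<open>X\<close> to \<open>G\<close> of finite support,
  extended by \<open>undefined\<close> outside \<open>X\<close>.
\<close>

definition shift_action ::
    "('h, 'd) monoid_scheme \<Rightarrow> 'x set \<Rightarrow> ('h \<Rightarrow> 'x \<Rightarrow> 'x) \<Rightarrow> 'h \<Rightarrow> ('x \<Rightarrow> 'g) \<Rightarrow> 'x \<Rightarrow> 'g"
  where "shift_action H X \<phi> h f = (\<lambda>x\<in>X. f (\<phi> (inv\<^bsub>H\<^esub> h) x))"

definition wreath_product ::
    "('g, 'c) monoid_scheme \<Rightarrow> ('h, 'd) monoid_scheme \<Rightarrow> 'x set \<Rightarrow> ('h \<Rightarrow> 'x \<Rightarrow> 'x)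
      \<Rightarrow> (('x \<Rightarrow> 'g) \<times> 'h) monoid"
  where "wreath_product G H X \<phi> =
    semidirect_product (sum_group X (\<lambda>_. G)) H (shift_action H X \<phi>)"


section \<open>Trees and property FA\<close>

text \<open>Simple graphs are given by a vertex set and a symmetric irreflexive adjacency relation.\<close>

definition simple_graph :: "'v set \<Rightarrow> 'v rel \<Rightarrow> bool"
  where "simple_graph V E \<longleftrightarrow> E \<subseteq> V \<times> V \<and> sym E \<and> irrefl E"

definition graph_cycle :: "'v rel \<Rightarrow> 'v list \<Rightarrow> bool"
  where "graph_cycle E p \<longleftrightarrow> 3 \<le> length p \<and> distinct p \<and>
    (\<forall>i<length p. (p ! i, p ! (Suc i mod length p)) \<in> E)"

definition graph_tree :: "'v set \<Rightarrow> 'v rel \<Rightarrow> bool"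
  where "graph_tree V E \<longleftrightarrow> simple_graph V E \<and> V \<noteq> {} \<and>
    (\<forall>u\<in>V. \<forall>v\<in>V. (u, v) \<in> E\<^sup>*) \<and> (\<nexists>p. graph_cycle E p)"

text \<open>\<open>(u, v) \<in> E ^^ n\<close> says that there is a walk of length \<open>n\<close> from \<open>u\<close> to \<open>v\<close>.\<close>

definition graph_dist :: "'v rel \<Rightarrow> 'v \<Rightarrow> 'v \<Rightarrow> nat"
  where "graph_dist E u v = (LEAST n. (u, v) \<in> E ^^ n)"

definition graph_action ::
    "('a, 'c) monoid_scheme \<Rightarrow> 'v set \<Rightarrow> 'v rel \<Rightarrow> ('a \<Rightarrow> 'v \<Rightarrow> 'v) \<Rightarrow> bool"
  where "graph_action G V E \<phi> \<longleftrightarrow> group_action G V \<phi> \<and>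
    (\<forall>g\<in>carrier G. \<forall>u\<in>V. \<forall>v\<in>V. (\<phi> g u, \<phi> g v) \<in> E \<longleftrightarrow> (u, v) \<in> E)"

text \<open>
  A definition in HOL cannot quantify over all types of vertices, so the vertices are taken in
  \<open>'a \<times> 'a \<times> nat\<close>. This loses nothing: by \<open>property_FA_all_types\<close> below, the property implies
  that the orbits are bounded for trees with vertices in an arbitrary type.
\<close>

definition property_FA :: "('a, 'c) monoid_scheme \<Rightarrow> bool"
  where "property_FA G \<longleftrightarrow>
    (\<forall>(V :: ('a \<times> 'a \<times> nat) set) E \<phi>. graph_tree V E \<and> graph_action G V E \<phi> \<longrightarrow>
      (\<forall>v\<in>V. Metric_space.mbounded V (\<lambda>x y. real (graph_dist E x y)) (orbit G \<phi> v)))"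


section \<open>Real trees and property FR\<close>

definition geodesic_segment :: "'m set \<Rightarrow> ('m \<Rightarrow> 'm \<Rightarrow> real) \<Rightarrow> 'm \<Rightarrow> 'm \<Rightarrow> 'm set \<Rightarrow> bool"
  where "geodesic_segment T d x y S \<longleftrightarrow>
    (\<exists>c. c \<in> {0..d x y} \<rightarrow> T \<and> c 0 = x \<and> c (d x y) = y \<and>
      (\<forall>s\<in>{0..d x y}. \<forall>t\<in>{0..d x y}. d (c s) (c t) = \<bar>s - t\<bar>) \<and> S = c ` {0..d x y})"

text \<open>
  Any two points are the end points of exactly one arc, and this arc is a geodesic segment.
  Metric spaces being Hausdorff, an injective path is a topological embedding of \<open>[0, 1]\<close>.
  For \<open>x = y\<close> there is no injective path and the segment is \<open>{x}\<close>.
\<close>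

definition real_tree :: "'m set \<Rightarrow> ('m \<Rightarrow> 'm \<Rightarrow> real) \<Rightarrow> bool"
  where "real_tree T d \<longleftrightarrow> Metric_space T d \<and> T \<noteq> {} \<and>
    (\<forall>x\<in>T. \<forall>y\<in>T. \<exists>S. geodesic_segment T d x y S \<and>
      (\<forall>\<gamma>. pathin (Metric_space.mtopology T d) \<gamma> \<and> inj_on \<gamma> {0..1} \<and> \<gamma> 0 = x \<and> \<gamma> 1 = y
        \<longrightarrow> \<gamma> ` {0..1} = S))"

definition isometric_action ::
    "('a, 'c) monoid_scheme \<Rightarrow> 'm set \<Rightarrow> ('m \<Rightarrow> 'm \<Rightarrow> real) \<Rightarrow> ('a \<Rightarrow> 'm \<Rightarrow> 'm) \<Rightarrow> bool"
  where "isometric_action G T d \<phi> \<longleftrightarrow> group_action G T \<phi> \<and>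
    (\<forall>g\<in>carrier G. \<forall>x\<in>T. \<forall>y\<in>T. d (\<phi> g x) (\<phi> g y) = d x y)"

text \<open>
  As above, points in \<open>'a \<times> 'a \<times> real\<close> suffice, see \<open>property_FR_all_types\<close>.
\<close>

definition property_FR :: "('a, 'c) monoid_scheme \<Rightarrow> bool"
  where "property_FR G \<longleftrightarrow>
    (\<forall>(T :: ('a \<times> 'a \<times> real) set) d \<phi>. real_tree T d \<and> isometric_action G T d \<phi> \<longrightarrow>
      (\<forall>x\<in>T. Metric_space.mbounded T d (orbit G \<phi> x)))"


definition no_fixed_points :: "('h, 'd) monoid_scheme \<Rightarrow> 'x set \<Rightarrow> ('h \<Rightarrow> 'x \<Rightarrow> 'x) \<Rightarrow> bool"
  where "no_fixed_points H X \<phi> \<longleftrightarrow> \<not> (\<exists>x\<in>X. \<forall>h\<in>carrier H. \<phi> h x = x)"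

definition has_quotient_Z :: "('g, 'c) monoid_scheme \<Rightarrow> bool"
  where "has_quotient_Z G \<longleftrightarrow> (\<exists>N. N \<lhd> G \<and> (G Mod N) \<cong> integer_group)"

definition countable_increasing_union :: "('g, 'c) monoid_scheme \<Rightarrow> bool"
  where "countable_increasing_union G \<longleftrightarrow>
    (\<exists>K :: nat \<Rightarrow> 'g set. (\<forall>n. subgroup (K n) G \<and> K n \<noteq> carrier G) \<and>
      (\<forall>n. K n \<subseteq> K (Suc n)) \<and> carrier G = (\<Union>n. K n))"


section \<open>The wreath product is a group\<close>

lemma shift_action_sum_group:
  assumes "group G" "group_action H X \<phi>" "h \<in> carrier H" "f \<in> carrier (sum_group X (\<lambda>_. G))"
  shows "shift_action H X \<phi> h f \<in> carrier (sum_group X (\<lambda>_. G))"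
proof -
  interpret G: group G by fact
  interpret A: group_action H X \<phi> by fact
  have H: "group H" using A.group_hom group_hom.axioms(1) by blast
  let ?k = "inv\<^bsub>H\<^esub> h"
  have k: "?k \<in> carrier H" using H assms(3) by (simp add: group.inv_closed)
  have f: "f \<in> X \<rightarrow>\<^sub>E carrier G" "finite {i \<in> X. f i \<noteq> \<one>\<^bsub>G\<^esub>}"
    using assms(1,4) by (auto simp: carrier_sum_group)
  have "\<phi> ?k ` {i \<in> X. f (\<phi> ?k i) \<noteq> \<one>\<^bsub>G\<^esub>} \<subseteq> {i \<in> X. f i \<noteq> \<one>\<^bsub>G\<^esub>}"
    using A.element_image[OF k] by auto
  moreover have "inj_on (\<phi> ?k) {i \<in> X. f (\<phi> ?k i) \<noteq> \<one>\<^bsub>G\<^esub>}"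
    by (rule inj_on_subset[OF A.inj_prop[OF k]]) auto
  ultimately have "finite {i \<in> X. f (\<phi> ?k i) \<noteq> \<one>\<^bsub>G\<^esub>}"
    using f(2) inj_on_finite by blast
  moreover have "{i \<in> X. (\<lambda>x\<in>X. f (\<phi> ?k x)) i \<noteq> \<one>\<^bsub>G\<^esub>} = {i \<in> X. f (\<phi> ?k i) \<noteq> \<one>\<^bsub>G\<^esub>}"
    by auto
  ultimately show ?thesis
    using f(1) A.element_image[OF k] assms(1)
    by (auto simp: carrier_sum_group shift_action_def PiE_iff)
qed

lemma group_wreath_product:
  fixes G :: "('g, 'c) monoid_scheme" and H :: "('h, 'd) monoid_scheme"
    and X :: "'x set" and \<phi> :: "'h \<Rightarrow> 'x \<Rightarrow> 'x"
  assumes "group G" "group_action H X \<phi>"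
  shows "group (wreath_product G H X \<phi>)"
proof -
  interpret G: group G by fact
  interpret A: group_action H X \<phi> by fact
  interpret H: group H using A.group_hom group_hom.axioms(1) by blast
  let ?N = "sum_group X (\<lambda>_. G)"
  let ?a = "shift_action H X \<phi> :: _ \<Rightarrow> ('x \<Rightarrow> 'g) \<Rightarrow> _"
  note cl = shift_action_sum_group[OF assms]
  have val: "f x \<in> carrier G" if "f \<in> carrier ?N" "x \<in> X" for f x
    using that assms(1) by (auto simp: carrier_sum_group)
  have ext: "f \<in> extensional X" if "f \<in> carrier ?N" for f
    using that assms(1) by (auto simp: carrier_sum_group PiE_iff)
  have mul: "?a h (f \<otimes>\<^bsub>?N\<^esub> f') = ?a h f \<otimes>\<^bsub>?N\<^esub> ?a h f'"
    if "h \<in> carrier H" for h f f'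
    using A.element_image[of "inv\<^bsub>H\<^esub> h"] that
    by (auto simp: shift_action_def fun_eq_iff)
  have act: "?a (h \<otimes>\<^bsub>H\<^esub> h') f = ?a h (?a h' f)"
    if "h \<in> carrier H" "h' \<in> carrier H" for h h' f
    using A.element_image[of "inv\<^bsub>H\<^esub> h"] that A.composition_rule
    by (auto simp: shift_action_def fun_eq_iff H.inv_mult_group)
  have one: "?a \<one>\<^bsub>H\<^esub> f = f" if "f \<in> carrier ?N" for f
    using ext[OF that] A.id_eq_one
    by (auto simp: shift_action_def fun_eq_iff extensional_def restrict_def dest: fun_cong)
      (metis restrict_apply)
  have aone: "?a h \<one>\<^bsub>?N\<^esub> = \<one>\<^bsub>?N\<^esub>" if "h \<in> carrier H" for h
    using A.element_image[of "inv\<^bsub>H\<^esub> h"] that by (auto simp: shift_action_def fun_eq_iff)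
  define N where "N = ?N"
  define a where "a = ?a"
  interpret N: group N unfolding N_def using assms(1) by simp
  have cl': "a h f \<in> carrier N" if "h \<in> carrier H" "f \<in> carrier N" for h f
    using cl that by (simp add: a_def N_def)
  have mul': "a h (f \<otimes>\<^bsub>N\<^esub> f') = a h f \<otimes>\<^bsub>N\<^esub> a h f'" if "h \<in> carrier H" for h f f'
    using mul that unfolding a_def N_def .
  have act': "a (h \<otimes>\<^bsub>H\<^esub> h') f = a h (a h' f)" if "h \<in> carrier H" "h' \<in> carrier H" for h h' f
    using act that unfolding a_def .
  have one': "a \<one>\<^bsub>H\<^esub> f = f" if "f \<in> carrier N" for f
    using one that unfolding a_def N_def .
  have aone': "a h \<one>\<^bsub>N\<^esub> = \<one>\<^bsub>N\<^esub>" if "h \<in> carrier H" for h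
    using aone that unfolding a_def N_def .
  have "group (semidirect_product N H a)"
  proof (rule groupI)
    fix x assume x: "x \<in> carrier (semidirect_product N H a)"
    then obtain f h where [simp]: "x = (f, h)" and f: "f \<in> carrier N" and h: "h \<in> carrier H"
      by (auto simp: semidirect_product_def)
    let ?y = "(a (inv\<^bsub>H\<^esub> h) (inv\<^bsub>N\<^esub> f), inv\<^bsub>H\<^esub> h)"
    have "a (inv\<^bsub>H\<^esub> h) (inv\<^bsub>N\<^esub> f) \<otimes>\<^bsub>N\<^esub> a (inv\<^bsub>H\<^esub> h) f = \<one>\<^bsub>N\<^esub>"
      using f h by (simp add: mul'[symmetric] aone')
    then show "\<exists>y\<in>carrier (semidirect_product N H a).
        y \<otimes>\<^bsub>semidirect_product N H a\<^esub> x = \<one>\<^bsub>semidirect_product N H a\<^esub>"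
      using f h cl' by (intro bexI[of _ ?y]) (simp_all add: semidirect_product_def)
  qed (auto simp: semidirect_product_def act' mul' cl' N.m_assoc H.m_assoc one')
  then show ?thesis by (simp add: wreath_product_def N_def a_def)
qed


section \<open>Independence of the type of vertices\<close>

text \<open>
  An orbit lies in an invariant subtree which is the image of a subset of \<open>'a \<times> 'a \<times> nat\<close>: the
  triple \<open>(g, h, n)\<close> stands for the \<open>g\<close>-translate of the \<open>n\<close>-th vertex on a path from the base
  point to its \<open>h\<close>-translate. For real trees the triple \<open>(g, h, t)\<close> stands for the point at
  distance \<open>t\<close> on the segment between the \<open>g\<close>-translate and the \<open>h\<close>-translate of the base point.
\<close>

lemma group_action_transport:
  assumes A: "group_action G V \<phi>" and S: "S \<subseteq> V" "\<And>g. g \<in> carrier G \<Longrightarrow> \<phi> g ` S \<subseteq> S"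
    and r: "inj_on r S"
  shows "group_action G (r ` S) (\<lambda>g. \<lambda>u\<in>r ` S. r (\<phi> g (inv_into S r u)))"
proof -
  interpret A: group_action G V \<phi> by fact
  interpret G: group G using A.group_hom group_hom.axioms(1) by blast
  define W where "W = r ` S"
  define \<psi> where "\<psi> = (\<lambda>g. \<lambda>u\<in>r ` S. r (\<phi> g (inv_into S r u)))"
  have \<psi>: "\<psi> g (r s) = r (\<phi> g s)" if "s \<in> S" for g s
    using that r by (simp add: \<psi>_def)
  have ext: "\<psi> g \<in> extensional W" for g by (simp add: \<psi>_def W_def)
  have cl: "\<psi> g u \<in> W" if "g \<in> carrier G" "u \<in> W" for g u
    using that S(2)[OF that(1)] \<psi> by (auto simp: W_def)
  have comp: "\<psi> (g \<otimes>\<^bsub>G\<^esub> h) u = \<psi> g (\<psi> h u)"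
    if gh: "g \<in> carrier G" "h \<in> carrier G" and u: "u \<in> W" for g h u
  proof -
    obtain s where s: "s \<in> S" "u = r s" using u unfolding W_def by blast
    have "\<phi> h s \<in> S" "s \<in> V" using S s gh by blast+
    then show ?thesis by (simp add: s \<psi> A.composition_rule gh)
  qed
  have one: "\<psi> \<one>\<^bsub>G\<^esub> u = u" if u: "u \<in> W" for u
  proof -
    obtain s where s: "s \<in> S" "u = r s" using u unfolding W_def by blast
    have "\<phi> \<one>\<^bsub>G\<^esub> s = s" using S(1) s(1) A.id_eq_one by (metis restrict_apply' subsetD)
    then show ?thesis by (simp add: s \<psi>)
  qed
  have inv: "\<psi> (inv\<^bsub>G\<^esub> g) (\<psi> g u) = u" "\<psi> g (\<psi> (inv\<^bsub>G\<^esub> g) u) = u"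
    if "g \<in> carrier G" "u \<in> W" for g u
    using that by (simp_all add: comp[symmetric] one)
  have bij: "\<psi> g \<in> Bij W" if g: "g \<in> carrier G" for g
  proof -
    have "bij_betw (\<psi> g) W W"
      by (rule bij_betw_byWitness[where f' = "\<psi> (inv\<^bsub>G\<^esub> g)"]) (use inv[OF g] cl g in auto)
    then show ?thesis using ext by (simp add: Bij_def)
  qed
  have "\<psi> \<in> hom G (BijGroup W)"
  proof (rule homI)
    fix g h assume gh: "g \<in> carrier G" "h \<in> carrier G"
    have "\<psi> (g \<otimes>\<^bsub>G\<^esub> h) = compose W (\<psi> g) (\<psi> h)"
      by (rule extensionalityI[of _ W]) (use ext comp[OF gh] in \<open>auto simp: compose_eq\<close>)
    then show "\<psi> (g \<otimes>\<^bsub>G\<^esub> h) = \<psi> g \<otimes>\<^bsub>BijGroup W\<^esub> \<psi> h"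
      using bij[OF gh(1)] bij[OF gh(2)] by (simp add: BijGroup_def)
  qed (use bij in \<open>simp add: BijGroup_def\<close>)
  then show ?thesis
    by (simp add: group_action_def group_hom_def group_hom_axioms_def group_BijGroup
        G.is_group W_def \<psi>_def)
qed

lemma graph_dist_walk:
  assumes "(u, v) \<in> E\<^sup>*"
  shows "(u, v) \<in> E ^^ graph_dist E u v"
  using assms unfolding graph_dist_def by (metis LeastI rtrancl_imp_relpow)

lemma graph_dist_le: "(u, v) \<in> E ^^ n \<Longrightarrow> graph_dist E u v \<le> n"
  unfolding graph_dist_def by (rule Least_le)

lemma Metric_space_graph_dist:
  assumes "graph_tree V E"
  shows "Metric_space V (\<lambda>x y. real (graph_dist E x y))"
proof
  have E: "sym E" "\<And>u v. u \<in> V \<Longrightarrow> v \<in> V \<Longrightarrow> (u, v) \<in> E\<^sup>*"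
    using assms by (auto simp: graph_tree_def simple_graph_def)
  have "(v, u) \<in> E ^^ n" if "(u, v) \<in> E ^^ n" for u v n
    using that E(1)
  proof (induction n arbitrary: v)
    case (Suc n)
    then obtain w where "(u, w) \<in> E ^^ n" "(w, v) \<in> E" by auto
    then show ?case using Suc by (metis relpow_Suc_I2 symD)
  qed auto
  then have "(u, v) \<in> E ^^ n \<longleftrightarrow> (v, u) \<in> E ^^ n" for u v n by blast
  then show "real (graph_dist E x y) = real (graph_dist E y x)" for x y
    by (simp add: graph_dist_def)
  show "real (graph_dist E x y) = 0 \<longleftrightarrow> x = y" if "x \<in> V" "y \<in> V" for x y
    using graph_dist_walk[OF E(2)[OF that]] graph_dist_le[of x y 0 E] by auto
  show "real (graph_dist E x z) \<le> real (graph_dist E x y) + real (graph_dist E y z)"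
    if "x \<in> V" "y \<in> V" "z \<in> V" for x y z
  proof -
    have "(x, z) \<in> E ^^ (graph_dist E x y + graph_dist E y z)"
      using graph_dist_walk[OF E(2)[OF that(1,2)]] graph_dist_walk[OF E(2)[OF that(2,3)]]
      by (auto simp: relpow_add)
    then show ?thesis using graph_dist_le by fastforce
  qed
qed auto

lemma property_FA_all_types:
  fixes G :: "('a, 'c) monoid_scheme" and V :: "'v set"
  assumes FA: "property_FA G" and tree: "graph_tree V E" and act: "graph_action G V E \<phi>"
    and o: "v0 \<in> V"
  shows "Metric_space.mbounded V (\<lambda>x y. real (graph_dist E x y)) (orbit G \<phi> v0)"
proof -
  have conn: "\<And>u v. u \<in> V \<Longrightarrow> v \<in> V \<Longrightarrow> (u, v) \<in> E\<^sup>*" and EV: "E \<subseteq> V \<times> V"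
    and symE: "sym E" and irrE: "irrefl E" and nocyc: "\<And>p. \<not> graph_cycle E p"
    using tree by (auto simp: graph_tree_def simple_graph_def)
  interpret A: group_action G V \<phi> using act by (simp add: graph_action_def)
  interpret G: group G using A.group_hom group_hom.axioms(1) by blast
  have autE: "(\<phi> g u, \<phi> g v) \<in> E" if "g \<in> carrier G" "(u, v) \<in> E" for g u v
    using that act EV by (auto simp: graph_action_def)
  have autE': "(\<phi> g u, \<phi> g v) \<in> E \<longleftrightarrow> (u, v) \<in> E"
    if "g \<in> carrier G" "u \<in> V" "v \<in> V" for g u v
    using that act by (auto simp: graph_action_def)
  have cl: "\<phi> g v \<in> V" if "g \<in> carrier G" "v \<in> V" for g v
    using A.element_image that by blast
  have one: "\<phi> \<one>\<^bsub>G\<^esub> v = v" if "v \<in> V" for v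
    using A.id_eq_one that by (metis restrict_apply')
  have "\<exists>P. P 0 = v0 \<and> (\<exists>n. P n = \<phi> h v0) \<and> (\<forall>k. P k \<in> V \<and> (P k, P (Suc k)) \<in> E\<^sup>=)"
    if h: "h \<in> carrier G" for h
  proof -
    obtain n where "(v0, \<phi> h v0) \<in> E ^^ n"
      using conn[OF o cl[OF h o]] rtrancl_imp_relpow by blast
    then obtain f where f: "f 0 = v0" "f n = \<phi> h v0" "\<forall>i<n. (f i, f (Suc i)) \<in> E"
      by (auto simp: relpow_fun_conv)
    have fV: "f i \<in> V" if "i \<le> n" for i
    proof (cases i)
      case (Suc j)
      then have "(f j, f i) \<in> E" using f(3) that by auto
      then show ?thesis using EV by blast
    qed (use f o in auto)
    show ?thesis
    proof (intro exI[of _ "\<lambda>k. f (min k n)"] conjI allI exI[of _ n])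
      fix k show "(f (min k n), f (min (Suc k) n)) \<in> E\<^sup>="
        using f(3) by (cases "k < n") (auto simp: min_def)
    qed (use f fV in auto)
  qed
  then obtain P where P0: "\<And>h. h \<in> carrier G \<Longrightarrow> P h 0 = v0"
    and Pn: "\<And>h. h \<in> carrier G \<Longrightarrow> \<exists>n. P h n = \<phi> h v0"
    and PV: "\<And>h k. h \<in> carrier G \<Longrightarrow> P h k \<in> V"
    and PE: "\<And>h k. h \<in> carrier G \<Longrightarrow> (P h k, P h (Suc k)) \<in> E\<^sup>="
    by metis
  define I :: "('a \<times> 'a \<times> nat) set" where "I = carrier G \<times> carrier G \<times> UNIV"
  define p where "p = (\<lambda>(g, h, k). \<phi> g (P h k))"
  define S where "S = p ` I"
  define r where "r = inv_into I p"
  have r: "inj_on r S" unfolding r_def S_def by (rule inj_on_inv_into) auto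
  have SI: "\<phi> g (P h k) \<in> S" if "g \<in> carrier G" "h \<in> carrier G" for g h k
    unfolding S_def by (rule image_eqI[of _ _ "(g, h, k)"]) (use that in \<open>auto simp: p_def I_def\<close>)
  have SE: "\<exists>g h k. g \<in> carrier G \<and> h \<in> carrier G \<and> s = \<phi> g (P h k)" if "s \<in> S" for s
    using that unfolding S_def p_def I_def by auto
  have SV: "S \<subseteq> V" using SE cl PV by blast
  have Sinv: "\<phi> g ` S \<subseteq> S" if g: "g \<in> carrier G" for g
  proof (rule image_subsetI)
    fix s assume "s \<in> S"
    then obtain g' h k where *: "g' \<in> carrier G" "h \<in> carrier G" "s = \<phi> g' (P h k)"
      using SE by blast
    then show "\<phi> g s \<in> S"
      using SI[of "g \<otimes>\<^bsub>G\<^esub> g'" h k] g by (simp add: A.composition_rule PV)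
  qed
  have orbS: "\<phi> g v0 \<in> S" if "g \<in> carrier G" for g
    using SI[OF that G.one_closed, of 0] P0 by simp
  define R where "R = E \<inter> S \<times> S"
  have symR: "sym R" using symE by (auto simp: R_def sym_def)
  then have symRs: "sym (R\<^sup>*)" by (rule sym_rtrancl)
  have path: "(\<phi> g v0, \<phi> g (P h k)) \<in> R\<^sup>*" if gh: "g \<in> carrier G" "h \<in> carrier G" for g h k
  proof (induction k)
    case 0 show ?case using P0 gh by simp
  next
    case (Suc k)
    have "(\<phi> g (P h k), \<phi> g (P h (Suc k))) \<in> R\<^sup>="
      using PE[OF gh(2), of k] autE[OF gh(1)] SI[OF gh] by (auto simp: R_def)
    then show ?case using Suc by auto
  qed
  have from_o: "(v0, s) \<in> R\<^sup>*" if "s \<in> S" for s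
  proof -
    obtain g h k where *: "g \<in> carrier G" "h \<in> carrier G" "s = \<phi> g (P h k)"
      using SE[OF \<open>s \<in> S\<close>] by blast
    obtain n where "P g n = \<phi> g v0" using Pn *(1) by blast
    then have "(v0, \<phi> g v0) \<in> R\<^sup>*"
      using path[OF G.one_closed *(1), of n] one PV o cl *(1) by auto
    then show ?thesis using path[OF *(1,2), of k] *(3) by (auto intro: rtrancl_trans)
  qed
  have connR: "(s, t) \<in> R\<^sup>*" if "s \<in> S" "t \<in> S" for s t
    using from_o[OF that(1)] from_o[OF that(2)] symRs by (meson rtrancl_trans symD)
  define E' where "E' = map_prod r r ` R"
  have E'R: "\<exists>s\<in>S. \<exists>t\<in>S. x = r s \<and> y = r t \<and> (s, t) \<in> R" if "(x, y) \<in> E'" for x y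
    using that by (auto simp: E'_def R_def)
  have RE': "(r s, r t) \<in> E' \<longleftrightarrow> (s, t) \<in> E" if st: "s \<in> S" "t \<in> S" for s t
  proof
    assume "(r s, r t) \<in> E'"
    then obtain s' t' where "s' \<in> S" "t' \<in> S" "r s = r s'" "r t = r t'" "(s', t') \<in> R"
      using E'R by blast
    then show "(s, t) \<in> E" using st inj_onD[OF r] by (metis IntD1 R_def)
  next
    assume "(s, t) \<in> E"
    then show "(r s, r t) \<in> E'" using st by (force simp: E'_def R_def)
  qed
  have tree': "graph_tree (r ` S) E'"
    unfolding graph_tree_def simple_graph_def
  proof (intro conjI ballI)
    show "E' \<subseteq> r ` S \<times> r ` S" by (auto simp: E'_def R_def)
    show "sym E'"
    proof (rule symI)
      fix x y assume "(x, y) \<in> E'"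
      then obtain s t where "s \<in> S" "t \<in> S" "x = r s" "y = r t" "(s, t) \<in> R" using E'R by blast
      then show "(y, x) \<in> E'" using RE' symD[OF symE] by (simp add: R_def)
    qed
    show "irrefl E'"
      using irrE E'R inj_onD[OF r] unfolding irrefl_def by (metis IntD1 R_def)
    show "r ` S \<noteq> {}" using orbS G.one_closed by blast
    show "(x, y) \<in> E'\<^sup>*" if xy: "x \<in> r ` S" "y \<in> r ` S" for x y
    proof -
      have "(r s, r t) \<in> E'\<^sup>*" if "(s, t) \<in> R\<^sup>*" for s t
        using that
      proof induction
        case (step t u)
        then have "(r t, r u) \<in> E'" by (force simp: E'_def)
        with step show ?case by auto
      qed auto
      then show ?thesis using xy connR by blast
    qed
    show "\<nexists>p. graph_cycle E' p"
    proof
      assume "\<exists>q. graph_cycle E' q"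
      then obtain q where q: "3 \<le> length q" "distinct q"
        "\<And>i. i < length q \<Longrightarrow> (q ! i, q ! (Suc i mod length q)) \<in> E'"
        by (auto simp: graph_cycle_def)
      have qS: "q ! i \<in> r ` S" if "i < length q" for i
        using q(3)[OF that] E'R by blast
      then have sub: "set q \<subseteq> r ` S" using qS by (metis in_set_conv_nth subsetI)
      let ?i = "inv_into S r"
      have "graph_cycle E (map ?i q)"
        unfolding graph_cycle_def
      proof (intro conjI allI impI)
        show "distinct (map ?i q)"
          using q(2) sub by (simp add: distinct_map inj_on_inv_into)
        fix i assume i: "i < length (map ?i q)"
        then have i': "i < length q" "Suc i mod length q < length q"
          using q(1) by (auto intro: mod_less_divisor)
        obtain s t where "s \<in> S" "t \<in> S" "q ! i = r s" "q ! (Suc i mod length q) = r t" "(s, t) \<in> R"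
          using E'R[OF q(3)[OF i'(1)]] by blast
        then show "(map ?i q ! i, map ?i q ! (Suc i mod length (map ?i q))) \<in> E"
          using i' r by (auto simp: R_def)
      qed (use q in auto)
      then show False using nocyc by blast
    qed
  qed
  define \<psi> where "\<psi> = (\<lambda>g. \<lambda>u\<in>r ` S. r (\<phi> g (inv_into S r u)))"
  have \<psi>: "\<psi> g (r s) = r (\<phi> g s)" if "s \<in> S" for g s
    using that r by (auto simp: \<psi>_def)
  have act': "graph_action G (r ` S) E' \<psi>"
    unfolding graph_action_def
  proof (intro conjI ballI)
    show "group_action G (r ` S) \<psi>"
      unfolding \<psi>_def by (rule group_action_transport[OF A.group_action_axioms SV Sinv r])
    fix g u v assume g: "g \<in> carrier G" and "u \<in> r ` S" "v \<in> r ` S"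
    then obtain s t where "s \<in> S" "t \<in> S" "u = r s" "v = r t" by blast
    then show "(\<psi> g u, \<psi> g v) \<in> E' \<longleftrightarrow> (u, v) \<in> E'"
      using Sinv[OF g] SV autE'[OF g] by (auto simp: \<psi> RE' image_subset_iff subset_iff)
  qed
  interpret M': Metric_space "r ` S" "\<lambda>x y. real (graph_dist E' x y)"
    by (rule Metric_space_graph_dist[OF tree'])
  interpret M: Metric_space V "\<lambda>x y. real (graph_dist E x y)"
    by (rule Metric_space_graph_dist[OF tree])
  have oS: "v0 \<in> S" using orbS[OF G.one_closed] one o by simp
  have "M'.mbounded (orbit G \<psi> (r v0))"
    using FA tree' act' oS unfolding property_FA_def by blast
  then obtain B where B: "\<And>x y. x \<in> orbit G \<psi> (r v0) \<Longrightarrow> y \<in> orbit G \<psi> (r v0)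
      \<Longrightarrow> real (graph_dist E' x y) \<le> B"
    unfolding M'.mbounded_alt by blast
  have le: "graph_dist E s t \<le> graph_dist E' (r s) (r t)" if st: "s \<in> S" "t \<in> S" for s t
  proof -
    have "\<exists>t\<in>S. y = r t \<and> (s, t) \<in> E ^^ n" if "(r s, y) \<in> E' ^^ n" for n y
      using that
    proof (induction n arbitrary: y)
      case 0 then show ?case using st by auto
    next
      case (Suc n)
      then obtain z where z: "(r s, z) \<in> E' ^^ n" "(z, y) \<in> E'" by auto
      obtain t where t: "t \<in> S" "z = r t" "(s, t) \<in> E ^^ n" using Suc.IH[OF z(1)] by blast
      obtain t' u where u: "t' \<in> S" "u \<in> S" "z = r t'" "y = r u" "(t', u) \<in> R"
        using E'R[OF z(2)] by blast
      have "t' = t" using t u inj_onD[OF r] by metis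
      then show ?case using t u by (auto simp: R_def)
    qed
    moreover have "(r s, r t) \<in> E'\<^sup>*" using tree' st by (auto simp: graph_tree_def)
    ultimately have "\<exists>t'\<in>S. r t = r t' \<and> (s, t') \<in> E ^^ graph_dist E' (r s) (r t)"
      using graph_dist_walk by metis
    then show ?thesis using inj_onD[OF r] st graph_dist_le by metis
  qed
  have orb: "r s \<in> orbit G \<psi> (r v0)" if "s \<in> orbit G \<phi> v0" for s
    using that \<psi>[OF oS] by (auto simp: orbit_def)
  show ?thesis
    unfolding M.mbounded_alt
  proof (intro conjI exI[of _ B] ballI)
    show "orbit G \<phi> v0 \<subseteq> V" using cl o by (auto simp: orbit_def)
    fix x y assume xy: "x \<in> orbit G \<phi> v0" "y \<in> orbit G \<phi> v0"
    then have "x \<in> S" "y \<in> S" using orbS by (auto simp: orbit_def)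
    then show "real (graph_dist E x y) \<le> B"
      using le B[OF orb[OF xy(1)] orb[OF xy(2)]] by force
  qed
qed


section \<open>Independence of the type of points of a real tree\<close>

lemma (in Metric_space) pathin_Lipschitz:
  assumes "\<gamma> \<in> {0..1} \<rightarrow> M" "\<And>s t. s \<in> {0..1} \<Longrightarrow> t \<in> {0..1} \<Longrightarrow> d (\<gamma> s) (\<gamma> t) \<le> K * \<bar>s - t\<bar>"
    and K: "0 < K"
  shows "pathin mtopology \<gamma>"
  unfolding pathin_def continuous_map_to_metric
proof (intro ballI allI impI)
  fix x \<epsilon> :: real
  assume "x \<in> topspace (subtopology euclideanreal {0..1})" and \<epsilon>: "0 < \<epsilon>"
  then have x: "x \<in> {0..1}" by simp
  show "\<exists>U. openin (subtopology euclideanreal {0..1}) U \<and> x \<in> U \<and> (\<forall>y\<in>U. \<gamma> y \<in> mball (\<gamma> x) \<epsilon>)"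
  proof (intro exI[of _ "{0..1} \<inter> ball x (\<epsilon> / K)"] conjI ballI)
    fix y assume y: "y \<in> {0..1} \<inter> ball x (\<epsilon> / K)"
    then have "K * \<bar>x - y\<bar> < \<epsilon>" using K by (simp add: dist_real_def field_simps)
    then show "\<gamma> y \<in> mball (\<gamma> x) \<epsilon>"
      using assms(1) assms(2)[of x y] x y by (auto simp: in_mball)
  qed (use x \<epsilon> K in \<open>auto simp: openin_open\<close>)
qed

definition geodesic_interval :: "'m set \<Rightarrow> ('m \<Rightarrow> 'm \<Rightarrow> real) \<Rightarrow> 'm \<Rightarrow> 'm \<Rightarrow> 'm set"
  where "geodesic_interval T d x y = {w \<in> T. d x w + d w y = d x y}"

context
  fixes T :: "'m set" and d
  assumes tree: "real_tree T d"
begin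

interpretation Metric_space T d using tree by (simp add: real_tree_def)

lemma geodesic_segment_subset_interval:
  assumes "geodesic_segment T d x y S"
  shows "S \<subseteq> geodesic_interval T d x y"
proof
  fix w assume "w \<in> S"
  then obtain c t where c: "c \<in> {0..d x y} \<rightarrow> T" "c 0 = x" "c (d x y) = y"
      "\<And>s t. s \<in> {0..d x y} \<Longrightarrow> t \<in> {0..d x y} \<Longrightarrow> d (c s) (c t) = \<bar>s - t\<bar>"
    and t: "t \<in> {0..d x y}" "w = c t"
    using assms unfolding geodesic_segment_def by blast
  have "d (c 0) (c t) = t" "d (c t) (c (d x y)) = d x y - t"
    using c(4)[of 0 t] c(4)[of t "d x y"] t(1) by auto
  then show "w \<in> geodesic_interval T d x y" using c t by (auto simp: geodesic_interval_def)
qed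

lemma arc_of_two_geodesics:
  assumes S1: "geodesic_segment T d x p S1" and S2: "geodesic_segment T d p y S2"
    and pT: "x \<in> T" "p \<in> T" "y \<in> T" and meet: "S1 \<inter> S2 \<subseteq> {p}" and neq: "x \<noteq> y"
    and arc: "\<And>\<gamma>. pathin mtopology \<gamma> \<Longrightarrow> inj_on \<gamma> {0..1} \<Longrightarrow> \<gamma> 0 = x \<Longrightarrow> \<gamma> 1 = y \<Longrightarrow> \<gamma> ` {0..1} = S"
  shows "S1 \<union> S2 = S"
proof -
  define a where "a = d x p"
  define b where "b = d p y"
  obtain c1 where c1: "c1 \<in> {0..a} \<rightarrow> T" "c1 0 = x" "c1 a = p"
      "\<And>s t. s \<in> {0..a} \<Longrightarrow> t \<in> {0..a} \<Longrightarrow> d (c1 s) (c1 t) = \<bar>s - t\<bar>" "S1 = c1 ` {0..a}"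
    using S1 unfolding geodesic_segment_def a_def by blast
  obtain c2 where c2: "c2 \<in> {0..b} \<rightarrow> T" "c2 0 = p" "c2 b = y"
      "\<And>s t. s \<in> {0..b} \<Longrightarrow> t \<in> {0..b} \<Longrightarrow> d (c2 s) (c2 t) = \<bar>s - t\<bar>" "S2 = c2 ` {0..b}"
    using S2 unfolding geodesic_segment_def b_def by blast
  have ab: "0 \<le> a" "0 \<le> b" by (auto simp: a_def b_def)
  define L where "L = a + b"
  have "0 < d x y" using neq pT by simp
  then have L: "0 < L" using triangle[of x p y] pT unfolding L_def a_def b_def by linarith
  define c where "c t = (if t \<le> a then c1 t else c2 (t - a))" for t
  have c_right: "c t = c2 (t - a)" if "a \<le> t" for t
    using that c1(3) c2(2) by (auto simp: c_def)
  have cT: "c t \<in> T" if "t \<in> {0..L}" for t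
    using that c1(1) c2(1) by (auto simp: c_def L_def Pi_iff)
  have lip: "d (c s) (c t) \<le> t - s" if "0 \<le> s" "s \<le> t" "t \<le> L" for s t
  proof -
    consider "t \<le> a" | "a \<le> s" | "s \<le> a" "a \<le> t" by linarith
    then show ?thesis
    proof cases
      case 1
      then show ?thesis using that c1(4)[of s t] by (simp add: c_def)
    next
      case 2
      then show ?thesis using that c2(4)[of "s - a" "t - a"] by (simp add: c_right L_def)
    next
      case 3
      have "d (c s) (c t) \<le> d (c s) (c a) + d (c a) (c t)"
        using that ab by (intro triangle cT) (auto simp: L_def)
      moreover have "d (c s) (c a) = a - s"
        using that 3 c1(4)[of s a] by (simp add: c_def)
      moreover have "d (c a) (c t) = t - a"
        using that 3 c2(4)[of 0 "t - a"] ab by (simp add: c_right L_def)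
      ultimately show ?thesis by linarith
    qed
  qed
  have lip': "d (c s) (c t) \<le> \<bar>s - t\<bar>" if "s \<in> {0..L}" "t \<in> {0..L}" for s t
    using lip[of s t] lip[of t s] that commute[of "c s" "c t"] by (cases "s \<le> t") auto
  have inj': "s = t" if "c s = c t" "0 \<le> s" "s \<le> t" "t \<le> L" for s t
  proof -
    consider "t \<le> a" | "a \<le> s" | "s \<le> a" "a < t" by linarith
    then show ?thesis
    proof cases
      case 1
      then have "d (c s) (c t) = t - s" using that c1(4)[of s t] by (simp add: c_def)
      then show ?thesis using that cT[of t] by simp
    next
      case 2
      then have "d (c s) (c t) = t - s"
        using that c2(4)[of "s - a" "t - a"] by (simp add: c_right L_def)
      then show ?thesis using that cT[of t] by simp
    next
      case 3
      have "s \<in> {0..a}" "t - a \<in> {0..b}" using 3 that by (auto simp: L_def)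
      then have "c1 s \<in> S1" "c2 (t - a) \<in> S2" unfolding c1(5) c2(5) by blast+
      then have "c s \<in> S1" and "c t \<in> S2" using 3 by (auto simp: c_def)
      then have "c2 (t - a) = c2 0" using meet that(1) 3 c2(2) by (auto simp: c_def)
      then have "d (c2 (t - a)) (c2 0) = 0" using pT c2(2) by simp
      then show ?thesis using c2(4)[of "t - a" 0] 3 that ab by (simp add: L_def)
    qed
  qed
  have inj: "inj_on c {0..L}"
  proof (rule inj_onI)
    fix s t assume "s \<in> {0..L}" "t \<in> {0..L}" "c s = c t"
    then show "s = t" using inj'[of s t] inj'[of t s] by (cases "s \<le> t") auto
  qed
  have scale: "(\<lambda>t. L * t) ` {0..1} = {0..L}"
    using L by (simp add: image_mult_atLeastAtMost)
  have memL: "L * t \<in> {0..L}" if "t \<in> {0..1}" for t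
    using that L scale by blast
  have "(\<lambda>t. c (L * t)) ` {0..1} = S"
  proof (rule arc)
    show "pathin mtopology (\<lambda>t. c (L * t))"
    proof (rule pathin_Lipschitz[OF _ _ L])
      fix s t :: real assume "s \<in> {0..1}" "t \<in> {0..1}"
      then have "d (c (L * s)) (c (L * t)) \<le> \<bar>L * s - L * t\<bar>" using lip' memL by blast
      also have "\<dots> = L * \<bar>s - t\<bar>" using L by (simp add: right_diff_distrib[symmetric] abs_mult)
      finally show "d (c (L * s)) (c (L * t)) \<le> L * \<bar>s - t\<bar>" .
    qed (use cT memL in blast)
    show "inj_on (\<lambda>t. c (L * t)) {0..1}"
    proof (rule inj_onI)
      fix s t :: real assume st: "s \<in> {0..1}" "t \<in> {0..1}" "c (L * s) = c (L * t)"
      then have "L * s = L * t" using inj_onD[OF inj] memL by blast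
      then show "s = t" using L by simp
    qed
    show "c (L * 0) = x" using c1(2) ab by (simp add: c_def)
    show "c (L * 1) = y" using c2(3) ab by (simp add: c_right L_def)
  qed
  moreover have "(\<lambda>t. c (L * t)) ` {0..1} = c ` {0..L}"
    using scale by (simp add: image_image[symmetric])
  moreover have "c ` {0..L} = c ` {0..a} \<union> c ` {a..L}"
    using ab by (simp add: image_Un[symmetric] ivl_disj_un L_def)
  moreover have "c ` {0..a} = S1" unfolding c1(5) by (rule image_cong) (auto simp: c_def)
  moreover have "c ` {a..L} = S2"
  proof -
    have "c ` {a..L} = (\<lambda>t. c2 (t - a)) ` {a..L}" by (rule image_cong) (auto simp: c_right)
    also have "\<dots> = c2 ` ((\<lambda>t. t - a) ` {a..L})" by (simp only: image_image)
    also have "(\<lambda>t. t - a) ` {a..L} = {0..b}"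
      using image_add_atLeastAtMost[of "- a" a L] by (simp add: L_def)
    finally show ?thesis using c2(5) by simp
  qed
  ultimately show ?thesis by simp
qed

lemma geodesic_segment_refl: "x \<in> T \<Longrightarrow> geodesic_segment T d x x {x}"
  unfolding geodesic_segment_def by (rule exI[of _ "\<lambda>_. x"]) auto

lemma geodesic_interval_refl: "x \<in> T \<Longrightarrow> geodesic_interval T d x x = {x}"
proof -
  assume x: "x \<in> T"
  have "w = x" if "w \<in> T" "d x w + d w x = d x x" for w
    using that x nonneg[of x w] commute[of x w] by simp
  then show ?thesis using x by (auto simp: geodesic_interval_def)
qed

lemma geodesic_segment_interval:
  assumes "x \<in> T" "y \<in> T"
  shows "geodesic_segment T d x y (geodesic_interval T d x y)"
    and "pathin mtopology \<gamma> \<Longrightarrow> inj_on \<gamma> {0..1} \<Longrightarrow> \<gamma> 0 = x \<Longrightarrow> \<gamma> 1 = y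
      \<Longrightarrow> \<gamma> ` {0..1} = geodesic_interval T d x y"
proof -
  obtain S where S: "geodesic_segment T d x y S"
    and arc: "\<And>\<gamma>. pathin mtopology \<gamma> \<Longrightarrow> inj_on \<gamma> {0..1} \<Longrightarrow> \<gamma> 0 = x \<Longrightarrow> \<gamma> 1 = y
      \<Longrightarrow> \<gamma> ` {0..1} = S"
  proof -
    have "\<exists>S. geodesic_segment T d x y S \<and> (\<forall>\<gamma>. pathin mtopology \<gamma> \<and> inj_on \<gamma> {0..1} \<and>
        \<gamma> 0 = x \<and> \<gamma> 1 = y \<longrightarrow> \<gamma> ` {0..1} = S)"
      using tree assms unfolding real_tree_def by simp
    then show ?thesis using that by auto
  qed
  have ex: "\<exists>S. geodesic_segment T d u v S" if "u \<in> T" "v \<in> T" for u v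
    using tree that unfolding real_tree_def by fast
  have "geodesic_interval T d x y \<subseteq> S"
  proof
    fix w assume w: "w \<in> geodesic_interval T d x y"
    show "w \<in> S"
    proof (cases "x = y")
      case True
      then have "w = x" using w geodesic_interval_refl[OF assms(1)] by blast
      moreover have "x \<in> S" using S nonneg[of x y]
        unfolding geodesic_segment_def by (metis atLeastAtMost_iff image_eqI order_refl)
      ultimately show ?thesis by simp
    next
      case False
      have wT: "w \<in> T" using w by (simp add: geodesic_interval_def)
      obtain S1 S2 where S12: "geodesic_segment T d x w S1" "geodesic_segment T d w y S2"
        using ex assms wT by blast
      have "q = w" if "q \<in> S1" "q \<in> S2" for q
      proof -
        have q: "q \<in> geodesic_interval T d x w" "q \<in> geodesic_interval T d w y"
          using that S12 geodesic_segment_subset_interval by blast+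
        then have "d x y \<le> d x q + d q y" using assms by (intro triangle) (auto simp: geodesic_interval_def)
        then have "d q w \<le> 0"
          using q w commute[of w q] by (auto simp: geodesic_interval_def)
        then show ?thesis using q wT nonneg[of q w] by (auto simp: geodesic_interval_def)
      qed
      then have "S1 \<union> S2 = S"
        using arc_of_two_geodesics[OF S12 assms(1) wT assms(2) _ False arc] by blast
      moreover have "w \<in> S1"
        using S12(1) unfolding geodesic_segment_def by (metis atLeastAtMost_iff image_eqI nonneg order_refl)
      ultimately show ?thesis by blast
    qed
  qed
  then have "S = geodesic_interval T d x y" using geodesic_segment_subset_interval[OF S] by blast
  then show "geodesic_segment T d x y (geodesic_interval T d x y)"
    and "pathin mtopology \<gamma> \<Longrightarrow> inj_on \<gamma> {0..1} \<Longrightarrow> \<gamma> 0 = x \<Longrightarrow> \<gamma> 1 = y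
      \<Longrightarrow> \<gamma> ` {0..1} = geodesic_interval T d x y"
    using S arc by auto
qed

lemma geodesic_interval_left:
  assumes "p \<in> geodesic_interval T d x z" "w \<in> geodesic_interval T d x p" "x \<in> T" "z \<in> T"
  shows "w \<in> geodesic_interval T d x z"
  using assms triangle[of w p z] triangle[of x w z] by (auto simp: geodesic_interval_def)

lemma geodesic_interval_commute: "geodesic_interval T d x y = geodesic_interval T d y x"
  using commute by (auto simp: geodesic_interval_def add.commute)

lemma real_tree_thin_triangles:
  assumes T: "x \<in> T" "y \<in> T" "z \<in> T"
  shows "geodesic_interval T d x y \<subseteq> geodesic_interval T d x z \<union> geodesic_interval T d z y"
proof -
  define a where "a = d x z"
  obtain c where c: "c \<in> {0..a} \<rightarrow> T" "c 0 = x" "c a = z"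
      "\<And>s t. s \<in> {0..a} \<Longrightarrow> t \<in> {0..a} \<Longrightarrow> d (c s) (c t) = \<bar>s - t\<bar>"
      "geodesic_interval T d x z = c ` {0..a}"
    using geodesic_segment_interval(1)[OF T(1,3)] unfolding geodesic_segment_def a_def by metis
  have a: "0 \<le> a" by (simp add: a_def)
  define f where "f t = d z (c t) + d (c t) y" for t
  have "1-lipschitz_on {0..a} (\<lambda>t. d u (c t))" if "u \<in> T" for u
  proof (rule lipschitz_onI)
    fix s t assume st: "s \<in> {0..a}" "t \<in> {0..a}"
    have "d u (c s) \<le> d u (c t) + d (c t) (c s)" "d u (c t) \<le> d u (c s) + d (c s) (c t)"
      using st c(1) that by (auto intro!: triangle)
    then show "dist (d u (c s)) (d u (c t)) \<le> 1 * dist s t"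
      using c(4)[OF st] commute[of "c s" "c t"] by (simp add: dist_real_def)
  qed simp
  then have "continuous_on {0..a} (\<lambda>t. d u (c t))" if "u \<in> T" for u
    using that lipschitz_on_continuous_on by blast
  then have "continuous_on {0..a} f"
    unfolding f_def commute[of "c _" y] using T by (intro continuous_on_add) auto
  moreover define A where "A = {t \<in> {0..a}. f t = d z y}"
  ultimately have "closed A"
    by (simp only: continuous_closed_preimage_constant[OF _ closed_real_atLeastAtMost])
  then have "compact A"
    using compact_Int_closed[OF compact_Icc, of A 0 a] by (simp add: A_def Int_absorb1 Collect_mono_iff subset_iff)
  moreover have "A \<noteq> {}"
    using a c(3) T by (auto simp: A_def f_def)
  ultimately obtain t0 where "t0 \<in> A" "\<And>t. t \<in> A \<Longrightarrow> t0 \<le> t"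
    using compact_attains_inf[of A] by blast
  then have t0: "t0 \<in> {0..a}" "f t0 = d z y"
    and min: "\<And>t. t \<in> {0..a} \<Longrightarrow> f t = d z y \<Longrightarrow> t0 \<le> t"
    by (auto simp: A_def)
  define p where "p = c t0"
  have p: "p \<in> T" "p \<in> geodesic_interval T d x z" "p \<in> geodesic_interval T d z y"
    using t0 c(1,5) by (auto simp: p_def geodesic_interval_def f_def)
  have xp: "d x p = t0" using c(4)[of 0 t0] c(2) t0(1) by (simp add: p_def)
  have meet: "geodesic_interval T d x p \<inter> geodesic_interval T d p y \<subseteq> {p}"
  proof
    fix w assume w: "w \<in> geodesic_interval T d x p \<inter> geodesic_interval T d p y"
    then have "w \<in> geodesic_interval T d x z" using geodesic_interval_left p T by blast
    then obtain t where t: "t \<in> {0..a}" "w = c t" using c(5) by blast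
    have "w \<in> geodesic_interval T d y z"
      using geodesic_interval_left[of p y z w] w p T geodesic_interval_commute by blast
    then have "w \<in> geodesic_interval T d z y" using geodesic_interval_commute by blast
    then have "f t = d z y" using t(2) by (simp add: f_def geodesic_interval_def)
    then have "t0 \<le> t" using min t(1) by blast
    moreover have "d x w = t" using c(4)[of 0 t] c(2) t by simp
    moreover have "d x w \<le> d x p" using w nonneg[of w p] unfolding geodesic_interval_def by clarify linarith
    ultimately show "w \<in> {p}" using t(2) xp by (simp add: p_def)
  qed
  have sub: "geodesic_interval T d x p \<subseteq> geodesic_interval T d x z" "geodesic_interval T d p y \<subseteq> geodesic_interval T d z y"
    using geodesic_interval_left[of p x z] geodesic_interval_left[of p y z] p T geodesic_interval_commute by blast+
  show ?thesis
  proof (cases "x = y")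
    case True
    then show ?thesis using geodesic_interval_refl T by (auto simp: geodesic_interval_def)
  next
    case False
    have "geodesic_interval T d x p \<union> geodesic_interval T d p y = geodesic_interval T d x y"
      by (rule arc_of_two_geodesics[OF geodesic_segment_interval(1)[OF T(1) p(1)]
            geodesic_segment_interval(1)[OF p(1) T(2)] T(1) p(1) T(2) meet False])
        (use geodesic_segment_interval(2)[OF T(1,2)] in blast)
    then show ?thesis using sub by blast
  qed
qed

lemma real_tree_pullback:
  fixes h :: "'n \<Rightarrow> 'm"
  assumes ne: "M \<noteq> {}" and h: "inj_on h M" "h ` M \<subseteq> T"
    and convex: "\<And>x y. x \<in> h ` M \<Longrightarrow> y \<in> h ` M \<Longrightarrow> geodesic_interval T d x y \<subseteq> h ` M"
  shows "real_tree M (\<lambda>x y. d (h x) (h y))"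
proof -
  let ?d = "\<lambda>x y. d (h x) (h y)"
  let ?i = "inv_into M h"
  have hT: "h x \<in> T" if "x \<in> M" for x using that h(2) by blast
  interpret N: Metric_space M ?d
  proof
    show "?d x y = ?d y x" for x y by (rule commute)
    show "?d x y = 0 \<longleftrightarrow> x = y" if "x \<in> M" "y \<in> M" for x y
      using that hT inj_onD[OF h(1)] by auto
    show "?d x z \<le> ?d x y + ?d y z" if "x \<in> M" "y \<in> M" "z \<in> M" for x y z
      using that hT by (intro triangle)
  qed simp
  have cont: "continuous_map N.mtopology mtopology h"
    unfolding N.metric_continuous_map[OF Metric_space_axioms] using hT by auto
  show ?thesis
    unfolding real_tree_def
  proof (intro conjI ballI exI allI impI)
    fix x y assume xy: "x \<in> M" "y \<in> M"
    let ?S = "?i ` geodesic_interval T d (h x) (h y)"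
    have sub: "geodesic_interval T d (h x) (h y) \<subseteq> h ` M" using convex xy by blast
    obtain c where c: "c \<in> {0..?d x y} \<rightarrow> T" "c 0 = h x" "c (?d x y) = h y"
        "\<And>s t. s \<in> {0..?d x y} \<Longrightarrow> t \<in> {0..?d x y} \<Longrightarrow> d (c s) (c t) = \<bar>s - t\<bar>"
        "geodesic_interval T d (h x) (h y) = c ` {0..?d x y}"
      using geodesic_segment_interval(1)[OF hT[OF xy(1)] hT[OF xy(2)]]
      unfolding geodesic_segment_def by metis
    have cM: "c t \<in> h ` M" if "t \<in> {0..?d x y}" for t using that sub c(5) by blast
    show "geodesic_segment M ?d x y ?S"
      unfolding geodesic_segment_def
    proof (intro exI[of _ "\<lambda>t. ?i (c t)"] conjI ballI)
      show "(\<lambda>t. ?i (c t)) \<in> {0..?d x y} \<rightarrow> M" using cM by (auto intro: inv_into_into)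
      show "?i (c 0) = x" "?i (c (?d x y)) = y" using c(2,3) xy h(1) by auto
      show "?S = (\<lambda>t. ?i (c t)) ` {0..?d x y}" unfolding c(5) by (simp add: image_image)
      fix s t assume "s \<in> {0..?d x y}" "t \<in> {0..?d x y}"
      then show "d (h (?i (c s))) (h (?i (c t))) = \<bar>s - t\<bar>"
        using c(4) cM by (simp add: f_inv_into_f)
    qed
    fix \<gamma>
    assume "pathin N.mtopology \<gamma> \<and> inj_on \<gamma> {0..1} \<and> \<gamma> 0 = x \<and> \<gamma> 1 = y"
    then have \<gamma>: "pathin N.mtopology \<gamma>" "inj_on \<gamma> {0..1}" "\<gamma> 0 = x" "\<gamma> 1 = y" by auto
    have \<gamma>M: "\<gamma> ` {0..1} \<subseteq> M"
      using \<gamma>(1) by (auto simp: pathin_def continuous_map_def)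
    have "(h \<circ> \<gamma>) ` {0..1} = geodesic_interval T d (h x) (h y)"
    proof (rule geodesic_segment_interval(2)[OF hT[OF xy(1)] hT[OF xy(2)]])
      show "pathin mtopology (h \<circ> \<gamma>)" using pathin_compose[OF \<gamma>(1) cont] .
      show "inj_on (h \<circ> \<gamma>) {0..1}" using comp_inj_on[OF \<gamma>(2)] inj_on_subset[OF h(1) \<gamma>M] by blast
    qed (use \<gamma> in auto)
    then have "?S = ?i ` h ` \<gamma> ` {0..1}" by (simp add: image_comp)
    also have "\<dots> = \<gamma> ` {0..1}" using inv_into_image_cancel[OF h(1) \<gamma>M] .
    finally show "\<gamma> ` {0..1} = ?S" by simp
  qed (use ne N.Metric_space_axioms in auto)
qed

end

lemma property_FR_all_types:
  fixes G :: "('a, 'c) monoid_scheme" and T :: "'m set"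
  assumes FR: "property_FR G" and tree: "real_tree T d" and act: "isometric_action G T d \<phi>"
    and o: "x0 \<in> T"
  shows "Metric_space.mbounded T d (orbit G \<phi> x0)"
proof -
  interpret M: Metric_space T d using tree by (simp add: real_tree_def)
  interpret A: group_action G T \<phi> using act by (simp add: isometric_action_def)
  interpret G: group G using A.group_hom group_hom.axioms(1) by blast
  have iso: "d (\<phi> g x) (\<phi> g y) = d x y" if "g \<in> carrier G" "x \<in> T" "y \<in> T" for g x y
    using that act by (auto simp: isometric_action_def)
  have cl: "\<phi> g x \<in> T" if "g \<in> carrier G" "x \<in> T" for g x
    using A.element_image that by blast
  have one: "\<phi> \<one>\<^bsub>G\<^esub> x = x" if "x \<in> T" for x
    using A.id_eq_one that by (metis restrict_apply')
  let ?b = "\<lambda>g h. geodesic_interval T d (\<phi> g x0) (\<phi> h x0)"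
  have "\<exists>c :: real \<Rightarrow> 'm. ?b g h \<subseteq> range c" if gh: "g \<in> carrier G" "h \<in> carrier G" for g h
  proof -
    obtain c :: "real \<Rightarrow> 'm" and J where "?b g h = c ` J"
      using geodesic_segment_interval(1)[OF tree cl[OF gh(1) o] cl[OF gh(2) o]]
      unfolding geodesic_segment_def by (elim exE conjE) (rule that)
    then have "?b g h \<subseteq> range c" by auto
    then show ?thesis by (intro exI[of _ c])
  qed
  then obtain c :: "'a \<Rightarrow> 'a \<Rightarrow> real \<Rightarrow> 'm"
    where c: "\<And>g h. g \<in> carrier G \<Longrightarrow> h \<in> carrier G \<Longrightarrow> ?b g h \<subseteq> range (c g h)"
    by metis
  define p where "p = (\<lambda>(g, h, t). c g h t)"
  define S where "S = (\<Union>g\<in>carrier G. \<Union>h\<in>carrier G. ?b g h)"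
  define r where "r = inv_into UNIV p"
  have "S \<subseteq> range p"
  proof
    fix s assume "s \<in> S"
    then obtain g h where "g \<in> carrier G" "h \<in> carrier G" "s \<in> ?b g h" by (auto simp: S_def)
    then obtain t where "s = c g h t" using c by blast
    then have "s = p (g, h, t)" by (simp add: p_def)
    then show "s \<in> range p" by blast
  qed
  then have r: "inj_on r S" unfolding r_def by (rule inj_on_inv_into)
  have ST: "S \<subseteq> T" by (auto simp: S_def geodesic_interval_def)
  have mem: "\<phi> g x0 \<in> ?b g h" "\<phi> h x0 \<in> ?b g h" if "g \<in> carrier G" "h \<in> carrier G" for g h
    using that cl o by (auto simp: geodesic_interval_def)
  have orbS: "\<phi> g x0 \<in> S" if "g \<in> carrier G" for g
    using mem(1)[OF that that] that by (auto simp: S_def)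
  have Sinv: "\<phi> k ` S \<subseteq> S" if k: "k \<in> carrier G" for k
  proof (rule image_subsetI)
    fix s assume "s \<in> S"
    then obtain g h where gh: "g \<in> carrier G" "h \<in> carrier G" "s \<in> ?b g h" by (auto simp: S_def)
    have "\<phi> k s \<in> geodesic_interval T d (\<phi> k (\<phi> g x0)) (\<phi> k (\<phi> h x0))"
      using gh k cl o by (auto simp: geodesic_interval_def iso)
    then have "\<phi> k s \<in> ?b (k \<otimes>\<^bsub>G\<^esub> g) (k \<otimes>\<^bsub>G\<^esub> h)"
      using gh k o by (simp add: A.composition_rule)
    then show "\<phi> k s \<in> S" using gh k by (auto simp: S_def)
  qed
  have convex: "geodesic_interval T d x y \<subseteq> S" if xy: "x \<in> S" "y \<in> S" for x y
  proof -
    obtain g h g' h' where gh: "g \<in> carrier G" "h \<in> carrier G" "x \<in> ?b g h"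
      "g' \<in> carrier G" "h' \<in> carrier G" "y \<in> ?b g' h'"
      using xy by (auto simp: S_def)
    let ?u = "\<phi> g x0" and ?v = "\<phi> g' x0"
    have T: "x \<in> T" "y \<in> T" "?u \<in> T" "?v \<in> T" using gh xy ST cl o by auto
    have "geodesic_interval T d x y \<subseteq> geodesic_interval T d x ?u \<union> geodesic_interval T d ?u y"
      using real_tree_thin_triangles[OF tree T(1,2,3)] .
    moreover have "geodesic_interval T d ?u y \<subseteq> ?b g g' \<union> geodesic_interval T d ?v y"
      using real_tree_thin_triangles[OF tree T(3,2,4)] .
    moreover have "geodesic_interval T d x ?u \<subseteq> ?b g h"
      using geodesic_interval_left[OF tree gh(3)] geodesic_interval_commute[OF tree, of x ?u] T cl o gh by blast
    moreover have "geodesic_interval T d ?v y \<subseteq> ?b g' h'"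
      using geodesic_interval_left[OF tree gh(6)] T cl o gh by blast
    moreover have "?b g h \<subseteq> S" "?b g g' \<subseteq> S" "?b g' h' \<subseteq> S" using gh by (auto simp: S_def)
    ultimately show ?thesis by blast
  qed
  let ?i = "inv_into S r"
  have i: "inj_on ?i (r ` S)" "?i ` r ` S = S"
    using r by (auto simp: inj_on_inv_into image_image)
  define d' where "d' = (\<lambda>x y. d (?i x) (?i y))"
  have oS: "x0 \<in> S" using orbS[OF G.one_closed] one o by simp
  have tree': "real_tree (r ` S) d'"
    unfolding d'_def using real_tree_pullback[OF tree, of "r ` S" ?i] i oS ST convex by auto
  define \<psi> where "\<psi> = (\<lambda>g. \<lambda>u\<in>r ` S. r (\<phi> g (?i u)))"
  have \<psi>: "\<psi> g (r s) = r (\<phi> g s)" if "s \<in> S" for g s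
    using that r by (auto simp: \<psi>_def)
  have d': "d' (r s) (r t) = d s t" if "s \<in> S" "t \<in> S" for s t
    using that r by (simp add: d'_def)
  have act': "isometric_action G (r ` S) d' \<psi>"
    unfolding isometric_action_def
  proof (intro conjI ballI)
    show "group_action G (r ` S) \<psi>"
      unfolding \<psi>_def by (rule group_action_transport[OF A.group_action_axioms ST Sinv r])
    fix g u v assume g: "g \<in> carrier G" and "u \<in> r ` S" "v \<in> r ` S"
    then obtain s t where st: "s \<in> S" "t \<in> S" "u = r s" "v = r t" by blast
    have "\<phi> g s \<in> S" "\<phi> g t \<in> S" "s \<in> T" "t \<in> T" using Sinv[OF g] st ST by auto
    then show "d' (\<psi> g u) (\<psi> g v) = d' u v" using st g by (simp add: \<psi> d' iso)
  qed
  interpret M': Metric_space "r ` S" d' using tree' by (simp add: real_tree_def)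
  have "M'.mbounded (orbit G \<psi> (r x0))"
    using FR tree' act' oS unfolding property_FR_def by blast
  then obtain B where B: "\<And>x y. x \<in> orbit G \<psi> (r x0) \<Longrightarrow> y \<in> orbit G \<psi> (r x0) \<Longrightarrow> d' x y \<le> B"
    unfolding M'.mbounded_alt by blast
  have orb: "r s \<in> orbit G \<psi> (r x0)" if "s \<in> orbit G \<phi> x0" for s
    using that \<psi>[OF oS] by (auto simp: orbit_def)
  show ?thesis
    unfolding M.mbounded_alt
  proof (intro conjI exI[of _ B] ballI)
    show "orbit G \<phi> x0 \<subseteq> T" using cl o by (auto simp: orbit_def)
    fix x y assume xy: "x \<in> orbit G \<phi> x0" "y \<in> orbit G \<phi> x0"
    then have "x \<in> S" "y \<in> S" using orbS by (auto simp: orbit_def)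
    then show "d x y \<le> B" using d' B[OF orb[OF xy(1)] orb[OF xy(2)]] by simp
  qed
qed

end

theory Submission
  imports Defs
begin

text \<open>
  Both properties are studied through the displacement \<open>L g = d b (g b)\<close> of a base point \<open>b\<close>. The
  distance of a tree, discrete or real, satisfies the four point inequality, and this inequality
  alone already makes \<open>L\<close> behave as in a tree (locale \<open>length_function\<close>). This is why the sufficiency
  of the conditions has one proof for FA and FR. The axes and fixed points mentioned below are the
  picture behind it; the argument itself only uses the inequality.

  Sufficiency. Let the wreath product \<open>W\<close> act on a tree; \<open>L\<close> is bounded on \<open>H\<close>. Suppose that some
  element \<open>s\<close> of the copy \<open>G\<^sub>x\<close> of \<open>G\<close> acts like a translation. As \<open>x\<close> is not a fixed point, \<open>H\<close>
  conjugates \<open>G\<^sub>x\<close> to another copy \<open>G\<^sub>y\<close>, which commutes with \<open>s\<close>. So \<open>G\<^sub>y\<close> acts on the axis of \<open>s\<close> by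
  translations, and the translation length is a homomorphism \<open>G \<rightarrow> \<real>\<close>
  (\<open>translation_length_on_centralizer\<close>). The hypotheses on \<open>G\<close> make it trivial
  (\<open>real_hom_trivial\<close>), so \<open>L\<close> is bounded on \<open>G\<^sub>y\<close>, hence on its conjugate \<open>G\<^sub>x\<close>, and \<open>s\<close> cannot
  translate. So every copy consists of elliptic elements. On such a group \<open>L (g h)\<close> is at most the
  maximum of \<open>L g\<close> and \<open>L h\<close> (\<open>L_mult_le_max\<close>), so the sets \<open>{L \<le> n}\<close> are subgroups that
  exhaust it, and one of them is everything: \<open>L\<close> is bounded on each copy. As there are finitely many
  orbits, one bound serves all copies. The elements of the direct sum then have bounded powers,
  so they are elliptic too, and the ultrametric inequality extends the bound from the copies to the
  direct sum (\<open>length_function_bounded\<close>).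

  Necessity. Both properties pass to the quotient \<open>H\<close>. A nonzero homomorphism to the integers gives an
  unbounded action on a line, and an exhaustion by an increasing sequence of proper subgroups gives
  an unbounded action on a tree whose vertices are cosets. In both trees each vertex has a parent, and the group
  respects parents; the locale \<open>parent_tree\<close> treats them together, as a graph and, after the edges
  are filled in, as a real tree. So \<open>W\<close> has neither a quotient \<open>\<int>\<close> nor such an exhaustion. A
  quotient \<open>\<int>\<close> of \<open>G\<close> would give one of \<open>W\<close> by summation over \<open>X\<close>, and an exhaustion of \<open>G\<close> or an
  infinite set of orbits would give an exhaustion of \<open>W\<close>
  (\<open>countable_increasing_union_by_fibres\<close>).
\<close>

section \<open>Length functions of isometric actions on trees\<close>

text \<open>
  The function \<open>L\<close> stands for the displacement \<open>g \<mapsto> d b (g b)\<close> of a base point \<open>b\<close>, so that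
  \<open>L (inv g \<otimes> h)\<close> is the distance of \<open>g b\<close> and \<open>h b\<close>. The last axiom is the four point inequality for
  the orbit of \<open>b\<close>: among the three ways to split four points into two pairs, the two largest
  sums of distances agree.
\<close>

locale length_function = group G for G (structure) +
  fixes L :: "'a \<Rightarrow> real"
  assumes L_one: "L \<one> = 0"
    and L_inv: "g \<in> carrier G \<Longrightarrow> L (inv g) = L g"
    and four_point: "\<lbrakk>a \<in> carrier G; b \<in> carrier G; c \<in> carrier G; e \<in> carrier G\<rbrakk> \<Longrightarrow>
      L (inv a \<otimes> b) + L (inv c \<otimes> e)
        \<le> max (L (inv a \<otimes> c) + L (inv b \<otimes> e)) (L (inv a \<otimes> e) + L (inv b \<otimes> c))"
begin

lemma L_diff_commute:
  assumes "g \<in> carrier G" "h \<in> carrier G"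
  shows "L (inv g \<otimes> h) = L (inv h \<otimes> g)"
  using L_inv[of "inv g \<otimes> h"] assms by (simp add: inv_mult_group)

lemma L_mult_le:
  assumes "g \<in> carrier G" "h \<in> carrier G"
  shows "L (g \<otimes> h) \<le> L g + L h"
  using four_point[of "inv g" h \<one> \<one>] assms by (simp add: L_one L_inv)

lemma L_nonneg: "g \<in> carrier G \<Longrightarrow> 0 \<le> L g"
  using L_mult_le[of g "inv g"] by (simp add: L_one L_inv)

text \<open>
  On a tree an isometry either has bounded orbits, and then its square moves no point farther than
  it does itself, or it translates an axis by some \<open>\<ell> > 0\<close>, and then its square moves every point
  by \<open>\<ell>\<close> more. One base point is therefore enough to tell the two cases apart.
\<close>

definition elliptic :: "'a \<Rightarrow> bool"
  where "elliptic g \<longleftrightarrow> L (g \<otimes> g) \<le> L g"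

text \<open>
  For the four points \<open>b\<close>, \<open>g b\<close>, \<open>g\<^sup>n b\<close>, \<open>g\<^sup>n\<^sup>+\<^sup>1 b\<close> the three sums of distances are twice \<open>L (g\<^sup>n)\<close>,
  twice \<open>L g\<close>, and \<open>L (g\<^sup>n\<^sup>+\<^sup>1) + L (g\<^sup>n\<^sup>-\<^sup>1)\<close>. Once \<open>L (g\<^sup>n) > L g\<close>, the first and the
  last must agree, which is the recursion of an arithmetic progression.
\<close>

lemma L_pow_Suc:
  assumes g: "g \<in> carrier G" and hyp: "\<not> elliptic g"
  shows "L (g [^] Suc n) = L g + real n * (L (g \<otimes> g) - L g)"
proof -
  define \<delta> where "\<delta> = L (g \<otimes> g) - L g"
  have \<delta>: "0 < \<delta>" using hyp by (simp add: \<delta>_def elliptic_def)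
  have "L (g [^] Suc n) = L g + real n * \<delta> \<and> L (g [^] Suc (Suc n)) = L g + real (Suc n) * \<delta>"
  proof (induction n)
    case 0
    then show ?case using g by (simp add: \<delta>_def)
  next
    case (Suc n)
    let ?p = "g [^] Suc n"
    let ?q = "g [^] Suc (Suc n)"
    let ?r = "g [^] Suc (Suc (Suc n))"
    have cl: "?p \<in> carrier G" "?q \<in> carrier G" "?r \<in> carrier G" using g by auto
    have sh: "inv g \<otimes> g [^] Suc k = g [^] k" for k :: nat
      unfolding nat_pow_Suc2[OF g] using g by (simp add: m_assoc[symmetric])
    have adj: "inv (g [^] k) \<otimes> g [^] Suc k = g" for k :: nat
      using g by (simp add: m_assoc[symmetric])
    have "inv g \<otimes> ?r = ?q" "inv g \<otimes> ?q = ?p" "inv ?q \<otimes> ?r = g"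
      by (simp_all only: sh adj)
    then have sums: "2 * L ?q \<le> max (L ?r + L ?p) (2 * L g)"
        "L ?r + L ?p \<le> max (2 * L ?q) (2 * L g)"
      using four_point[of \<one> ?q g ?r] four_point[of \<one> ?r g ?q] L_diff_commute[of ?q ?r]
        L_diff_commute[of ?q g] L_diff_commute[of ?r g] g cl
      by (auto simp del: nat_pow_Suc)
    have "L g < L ?q" using Suc.IH \<delta> by (simp add: add_pos_pos del: nat_pow_Suc) 
    then have "L ?r = 2 * L ?q - L ?p" using sums by linarith
    then show ?case using Suc.IH by (simp add: algebra_simps del: nat_pow_Suc)
  qed
  then show ?thesis by (simp add: \<delta>_def del: nat_pow_Suc)
qed

lemma elliptic_if_bounded_powers:
  assumes g: "g \<in> carrier G" and bound: "\<And>n::nat. L (g [^] n) \<le> B"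
  shows "elliptic g"
proof (rule ccontr)
  assume hyp: "\<not> elliptic g"
  then have "0 < L (g \<otimes> g) - L g" by (simp add: elliptic_def)
  then obtain n :: nat where "B < real n * (L (g \<otimes> g) - L g)"
    using reals_Archimedean3 by blast
  then have "B < L (g [^] Suc n)" using L_pow_Suc[OF g hyp, of n] L_nonneg[OF g] by linarith
  then show False using bound[of "Suc n"] by linarith
qed

text \<open>
  The Gromov product: in a tree, the length of the common part of the segments from the base point
  to its images under \<open>g\<close> and \<open>h\<close>.
\<close>

definition gromov :: "'a \<Rightarrow> 'a \<Rightarrow> real"
  where "gromov g h = (L g + L h - L (inv g \<otimes> h)) / 2"

lemma gromov_commute: "g \<in> carrier G \<Longrightarrow> h \<in> carrier G \<Longrightarrow> gromov g h = gromov h g"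
  by (simp add: gromov_def L_diff_commute)

lemma gromov_min:
  assumes "g \<in> carrier G" "h \<in> carrier G" "k \<in> carrier G"
  shows "min (gromov g h) (gromov h k) \<le> gromov g k"
  using four_point[of g k \<one> h] assms
  by (auto simp: gromov_def L_inv L_diff_commute[of k h] min_def max_def field_simps
      split: if_splits)

lemma gromov_isosceles:
  assumes "g \<in> carrier G" "h \<in> carrier G" "k \<in> carrier G" and "gromov g h < gromov h k"
  shows "gromov g k = gromov g h"
  using gromov_min[of g h k] gromov_min[of g k h] gromov_commute[of h k] assms by linarith

text \<open>
  In a tree, two elliptic isometries with disjoint fixed sets have a product that translates. So if
  the product is elliptic as well, there is a common fixed point, and the displacement of \<open>b\<close> is governed by
  the distance to it. In terms of Gromov products: if \<open>L (g \<otimes> h)\<close> were too large, then the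
  segment to \<open>g b\<close> or \<open>g\<^sup>-\<^sup>1 b\<close> and the segment to \<open>h b\<close> or \<open>h\<^sup>-\<^sup>1 b\<close> would always separate at the same
  distance \<open>c\<close> from \<open>b\<close>, before the midpoint of either. The segments to \<open>(g \<otimes> h) b\<close> and \<open>(g \<otimes> h)\<^sup>-\<^sup>1 b\<close> then
  separate at \<open>c\<close> too, before their midpoints, so \<open>g \<otimes> h\<close> would not be elliptic.
\<close>

lemma L_mult_le_max:
  assumes gh: "g \<in> carrier G" "h \<in> carrier G"
    and ell: "elliptic g" "elliptic h" "elliptic (g \<otimes> h)"
  shows "L (g \<otimes> h) \<le> max (L g) (L h)"
proof (rule ccontr)
  assume "\<not> ?thesis"
  then have big: "L g < L (g \<otimes> h)" "L h < L (g \<otimes> h)" by auto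
  \<comment> \<open>The Gromov products of \<open>g\<close> or its inverse with \<open>h\<close> or its inverse all equal \<open>c\<close>.\<close>
  define c where "c = gromov (inv g) h"
  have c: "2 * c = L g + L h - L (g \<otimes> h)" using gh by (simp add: c_def gromov_def L_inv)
  have gg: "c < gromov (inv g) g"
    using ell(1) c big gh by (simp add: gromov_def L_inv elliptic_def)
  have hh: "c < gromov h (inv h)"
    using ell(2) c big gh L_inv[of "h \<otimes> h"]
    by (simp add: gromov_def L_inv elliptic_def inv_mult_group)
  have "gromov h g = c"
    using gromov_isosceles[of h "inv g" g] gg gh gromov_commute[of h "inv g"] by (simp add: c_def)
  then have gih: "gromov g (inv h) = c"
    using gromov_isosceles[of g h "inv h"] hh gh gromov_commute[of g h] by simp
  have m: "g \<otimes> h \<in> carrier G" using gh by simp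
  have e1: "inv g \<otimes> (g \<otimes> h) = h" using gh by (simp add: m_assoc[symmetric])
  have e2: "inv (inv h) \<otimes> inv (g \<otimes> h) = inv g" using gh by (simp add: inv_mult_group m_assoc[symmetric])
  have "c < gromov g (g \<otimes> h)" using c big gh by (simp add: gromov_def e1)
  then have 1: "gromov (inv h) (g \<otimes> h) = c"
    using gromov_isosceles[of "inv h" g "g \<otimes> h"] gih gromov_commute[of g "inv h"] gh by simp
  have "c < gromov (inv h) (inv (g \<otimes> h))"
    using c big gh by (simp only: gromov_def e2) (simp add: L_inv)
  then have "gromov (g \<otimes> h) (inv (g \<otimes> h)) = c"
    using gromov_isosceles[of "g \<otimes> h" "inv h" "inv (g \<otimes> h)"] 1 gromov_commute[of "inv h" "g \<otimes> h"] gh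
    by simp
  moreover have "L (inv (g \<otimes> h) \<otimes> inv (g \<otimes> h)) = L ((g \<otimes> h) \<otimes> (g \<otimes> h))"
    using L_inv[of "(g \<otimes> h) \<otimes> (g \<otimes> h)"] m inv_mult_group[OF m m] by simp
  ultimately have "L ((g \<otimes> h) \<otimes> (g \<otimes> h)) = 2 * L (g \<otimes> h) - 2 * c"
    using m L_inv[OF m] by (simp add: gromov_def)
  then show False using ell(3) big c unfolding elliptic_def by linarith
qed

text \<open>
  The centralizer of a translation \<open>b\<close> preserves its axis and acts on it by translations. The signed
  translation length is the change of the Busemann function of the end that \<open>b\<close> points to, here the
  limit of \<open>L (g \<otimes> b\<^sup>n) - L (b\<^sup>n)\<close>, and the distance of the base point
  to the axis controls the rest of \<open>L g\<close>. The proof calls the base point \<open>o\<close>.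
\<close>

lemma translation_length_on_centralizer:
  assumes b: "b \<in> carrier G" and hyp: "\<not> elliptic b"
  defines "C \<equiv> {g \<in> carrier G. g \<otimes> b = b \<otimes> g}"
  shows "\<exists>\<tau> c. (\<forall>g\<in>C. \<forall>h\<in>C. \<tau> (g \<otimes> h) = \<tau> g + \<tau> h) \<and> (\<forall>g\<in>C. L g \<le> \<bar>\<tau> g\<bar> + c)"
proof -
  define \<delta> where "\<delta> = L (b \<otimes> b) - L b"
  have \<delta>: "0 < \<delta>" using hyp by (simp add: \<delta>_def elliptic_def)
  have powS: "L (b [^] Suc n) = L b + real n * \<delta>" for n
    using L_pow_Suc[OF b hyp] by (simp add: \<delta>_def del: nat_pow_Suc)
  have pow: "L (b [^] n) = L b - \<delta> + real n * \<delta>" if "0 < n" for n :: nat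
    using powS[of "n - 1"] that by (simp add: of_nat_diff algebra_simps del: nat_pow_Suc)
  have bn: "b [^] n \<in> carrier G" for n :: nat using b by simp
  have large: "\<exists>N :: nat. \<forall>n\<ge>N. B < L (b [^] n)" for B
  proof -
    obtain N :: nat where N: "B + \<delta> < real N * \<delta>"
      using reals_Archimedean3[OF \<delta>] by blast
    have "B < L (b [^] n)" if "n \<ge> Suc N" for n :: nat
    proof -
      have "real N * \<delta> \<le> real n * \<delta>" using that \<delta> by simp
      then show ?thesis using pow[of n] N that L_nonneg[OF b] by linarith
    qed
    then show ?thesis by blast
  qed
  have C: "C \<subseteq> carrier G" by (auto simp: C_def)
  have C_pow: "g \<otimes> b [^] n = b [^] n \<otimes> g" if "g \<in> C" for g and n :: nat
    using group_commutes_pow[of b g n] that b by (simp add: C_def)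
  \<comment> \<open>The points \<open>b\<^sup>n o\<close> and \<open>b\<^sup>n h o\<close> stay at distance \<open>L h\<close> while both escape to infinity,
    so they define the same Busemann function.\<close>
  have drift: "\<exists>N :: nat. \<forall>n\<ge>N. L (x \<otimes> b [^] n \<otimes> h) - L (b [^] n \<otimes> h) = L (x \<otimes> b [^] n) - L (b [^] n)"
    if x: "x \<in> carrier G" and h: "h \<in> carrier G" for x h
  proof -
    obtain N :: nat where N: "\<And>n. n \<ge> N \<Longrightarrow> 2 * L x + 2 * L h < L (b [^] n)" using large by blast
    have "L (x \<otimes> b [^] n \<otimes> h) - L (b [^] n \<otimes> h) = L (x \<otimes> b [^] n) - L (b [^] n)"
      if n: "n \<ge> N" for n :: nat
    proof -
      let ?y = "b [^] n" and ?z = "b [^] n \<otimes> h"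
      have yz: "?y \<in> carrier G" "?z \<in> carrier G" using b h by auto
      have e: "inv ?y \<otimes> ?z = h" using bn h by (simp add: m_assoc[symmetric])
      have e': "x \<otimes> ?z = x \<otimes> ?y \<otimes> h" using x bn h by (simp add: m_assoc)
      have "L ?y \<le> L x + L (x \<otimes> ?y)"
        using L_mult_le[of "inv x" "x \<otimes> ?y"] x bn by (simp add: L_inv m_assoc[symmetric])
      moreover have "L ?z \<ge> L ?y - L h"
        using L_mult_le[of ?z "inv h"] yz h by (simp add: L_inv m_assoc)
      moreover have "L (x \<otimes> ?z) \<ge> 0" using x yz L_nonneg by simp
      moreover have "0 \<le> L x" "0 \<le> L h" using x h L_nonneg by auto
      moreover have "L ?y + L (x \<otimes> ?z) \<le> max (L ?z + L (x \<otimes> ?y)) (L x + L h)"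
        using four_point[of \<one> ?y "inv x" ?z] x yz e
          L_diff_commute[of ?y "inv x"]
        by (simp add: L_inv add.commute max.commute)
      moreover have "L ?z + L (x \<otimes> ?y) \<le> max (L ?y + L (x \<otimes> ?z)) (L x + L h)"
        using four_point[of \<one> ?z "inv x" ?y] x yz e
          L_diff_commute[of ?z "inv x"] L_diff_commute[of ?z ?y]
        by (simp add: L_inv add.commute max.commute)
      ultimately show ?thesis using N[OF n] unfolding e' by linarith
    qed
    then show ?thesis by blast
  qed
  have "\<exists>t (N :: nat). \<forall>n\<ge>N. L (g \<otimes> b [^] n) - L (b [^] n) = t" if g: "g \<in> carrier G" for g
  proof -
    obtain N :: nat where N: "\<And>n. n \<ge> N \<Longrightarrow>
        L (g \<otimes> b [^] Suc n) - L (b [^] Suc n) = L (g \<otimes> b [^] n) - L (b [^] n)"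
      using drift[OF g b] g b by (auto simp: m_assoc)
    have "L (g \<otimes> b [^] n) - L (b [^] n) = L (g \<otimes> b [^] N) - L (b [^] N)" if "n \<ge> N" for n
      using that by (induction n rule: dec_induct) (use N in \<open>auto simp del: nat_pow_Suc\<close>)
    then show ?thesis by blast
  qed
  then obtain \<tau> where \<tau>: "\<And>g. g \<in> carrier G \<Longrightarrow>
      \<exists>N :: nat. \<forall>n\<ge>N. L (g \<otimes> b [^] n) - L (b [^] n) = \<tau> g"
    by metis
  have add: "\<tau> (g \<otimes> h) = \<tau> g + \<tau> h" if gh: "g \<in> C" "h \<in> C" for g h
  proof -
    have cl: "g \<in> carrier G" "h \<in> carrier G" using gh C by auto
    obtain N1 N2 N3 N4 :: nat where
      "\<And>n. n \<ge> N1 \<Longrightarrow> L (g \<otimes> b [^] n) - L (b [^] n) = \<tau> g"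
      "\<And>n. n \<ge> N2 \<Longrightarrow> L (h \<otimes> b [^] n) - L (b [^] n) = \<tau> h"
      "\<And>n. n \<ge> N3 \<Longrightarrow> L (g \<otimes> h \<otimes> b [^] n) - L (b [^] n) = \<tau> (g \<otimes> h)"
      "\<And>n. n \<ge> N4 \<Longrightarrow>
        L (g \<otimes> b [^] n \<otimes> h) - L (b [^] n \<otimes> h) = L (g \<otimes> b [^] n) - L (b [^] n)"
      using \<tau>[of g] \<tau>[of h] \<tau>[of "g \<otimes> h"] drift[of g h] cl by (metis m_closed)
    note N = this
    define n where "n = N1 + N2 + N3 + N4"
    have "g \<otimes> b [^] n \<otimes> h = g \<otimes> h \<otimes> b [^] n" "b [^] n \<otimes> h = h \<otimes> b [^] n"
      using C_pow[OF gh(2)] cl bn by (simp_all add: m_assoc)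
    then show ?thesis using N(1)[of n] N(2)[of n] N(3)[of n] N(4)[of n] by (simp add: n_def)
  qed
  have inC: "inv g \<in> C" "\<one> \<in> C" if "g \<in> C" for g
  proof -
    have g: "g \<in> carrier G" "g \<otimes> b = b \<otimes> g" using that by (auto simp: C_def)
    have "inv g \<otimes> b = inv g \<otimes> (b \<otimes> g) \<otimes> inv g" using g(1) b by (simp add: m_assoc)
    also have "\<dots> = b \<otimes> inv g" using g(1) b by (simp add: g(2)[symmetric] m_assoc[symmetric])
    finally show "inv g \<in> C" using g(1) by (simp add: C_def)
    show "\<one> \<in> C" using b by (simp add: C_def)
  qed
  have bound: "L g \<le> \<bar>\<tau> g\<bar> + (L b - \<delta>)" if g: "g \<in> C" for g
  proof -
    have cl: "g \<in> carrier G" using g C by auto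
    have "\<tau> \<one> = 0" using add[of \<one> \<one>] inC[OF g] by simp
    then have neg: "\<tau> (inv g) = - \<tau> g" using add[OF inC(1)[OF g] g] cl by simp
    obtain N1 N2 :: nat where
      "\<And>n. n \<ge> N1 \<Longrightarrow> L (g \<otimes> b [^] n) - L (b [^] n) = \<tau> g"
      "\<And>n. n \<ge> N2 \<Longrightarrow> L (inv g \<otimes> b [^] n) - L (b [^] n) = \<tau> (inv g)"
      using \<tau>[of g] \<tau>[of "inv g"] cl by auto
    note N = this
    define n where "n = Suc (N1 + N2)"
    let ?y = "b [^] n"
    have y: "?y \<in> carrier G" by (rule bn)
    have yy: "?y \<otimes> ?y = b [^] (n + n)" using b by (simp add: nat_pow_mult)
    have e1: "L (inv g \<otimes> inv ?y) = L (g \<otimes> ?y)"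
      using L_inv[of "g \<otimes> ?y"] C_pow[OF g, of n] y cl by (simp add: inv_mult_group)
    have e2: "L (inv ?y \<otimes> inv ?y) = L (?y \<otimes> ?y)"
      using L_inv[of "?y \<otimes> ?y"] y by (simp add: inv_mult_group)
    \<comment> \<open>The four points are \<open>o\<close>, \<open>g o\<close>, \<open>b\<^sup>n o\<close> and \<open>b\<^sup>-\<^sup>n o\<close>, the last two far out at both ends of
      the axis.\<close>
    have "L g + L (?y \<otimes> ?y) \<le> max (L ?y + L (g \<otimes> ?y)) (L ?y + L (inv g \<otimes> ?y))"
      using four_point[of \<one> g ?y "inv ?y"] y cl by (simp add: e1 e2 L_inv)
    moreover have "L (?y \<otimes> ?y) = L b - \<delta> + 2 * (real n * \<delta>)" "L ?y = L b - \<delta> + real n * \<delta>"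
      unfolding yy using pow[of "n + n"] pow[of n] by (simp_all add: n_def algebra_simps)
    ultimately show ?thesis using N(1)[of n] N(2)[of n] neg by (simp add: n_def)
  qed
  show ?thesis using add bound by blast
qed

end

section \<open>Homomorphisms to the integers and to the reals\<close>

context group
begin

text \<open>
  The image of a nonzero homomorphism to \<open>\<int>\<close> consists of the multiples of its least positive
  element \<open>d\<close>, so division by \<open>d\<close> makes the homomorphism surjective.
\<close>

lemma has_quotient_Z_iff_int_hom:
  "has_quotient_Z G \<longleftrightarrow> (\<exists>t. t \<in> hom G integer_group \<and> (\<exists>g\<in>carrier G. t g \<noteq> 0))"
proof
  assume "has_quotient_Z G"
  then obtain N f where N: "N \<lhd> G" and f: "f \<in> iso (G Mod N) integer_group"
    by (auto simp: has_quotient_Z_def is_iso_def)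
  interpret N: normal N G by fact
  let ?t = "f \<circ> (\<lambda>a. N #> a)"
  have "?t \<in> hom G integer_group"
    using N.r_coset_hom_Mod f by (auto simp: iso_def intro: Group.hom_compose)
  moreover obtain C where C: "C \<in> carrier (G Mod N)" "f C = 1"
    using f unfolding iso_def bij_betw_def by (metis (mono_tags, lifting) UNIV_I carrier_integer_group imageE mem_Collect_eq)
  then obtain g where "g \<in> carrier G" "C = N #> g"
    by (auto simp: FactGroup_def RCOSETS_def)
  ultimately show "\<exists>t. t \<in> hom G integer_group \<and> (\<exists>g\<in>carrier G. t g \<noteq> 0)"
    using C by (intro exI[of _ ?t]) force
next
  assume "\<exists>t. t \<in> hom G integer_group \<and> (\<exists>g\<in>carrier G. t g \<noteq> 0)"
  then obtain t g where t: "t \<in> hom G integer_group" and g: "g \<in> carrier G" "t g \<noteq> 0" by blast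
  interpret t: group_hom G integer_group t
    using t by (simp add: group_hom_def group_hom_axioms_def group_axioms)
  have add: "t (x \<otimes> y) = t x + t y" if "x \<in> carrier G" "y \<in> carrier G" for x y
    using t.hom_mult that by simp
  have pow: "t (x [^] k) = k * t x" if "x \<in> carrier G" for x and k :: int
    using t.hom_int_pow[OF that] by simp
  define P where "P n \<longleftrightarrow> 0 < n \<and> (\<exists>g\<in>carrier G. t g = int n)" for n
  have "P (nat \<bar>t g\<bar>)"
  proof -
    have "t (g [^] sgn (t g)) = \<bar>t g\<bar>" using pow[OF g(1)] by (simp add: abs_sgn mult.commute)
    then show ?thesis
      using g unfolding P_def by (intro conjI bexI[of _ "g [^] sgn (t g)"]) auto
  qed
  define d where "d = (LEAST n. P n)"
  have "P d" unfolding d_def using \<open>P (nat \<bar>t g\<bar>)\<close> by (rule LeastI)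
  then obtain g0 where d: "0 < d" and g0: "g0 \<in> carrier G" "t g0 = int d" by (auto simp: P_def)
  have dvd: "int d dvd t x" if x: "x \<in> carrier G" for x
  proof -
    define r where "r = t x mod int d"
    have r: "0 \<le> r" "r < int d" using d by (simp_all add: r_def)
    have "t (x \<otimes> g0 [^] (- (t x div int d))) = r"
      using x g0 pow[OF g0(1)] by (simp add: add r_def minus_div_mult_eq_mod)
    then have "P (nat r)" if "r \<noteq> 0"
      using that r x g0 by (auto simp: P_def intro!: bexI[of _ "x \<otimes> g0 [^] (- (t x div int d))"])
    then have "r = 0" using not_less_Least[of "nat r" P] r unfolding d_def[symmetric] by fastforce
    then show ?thesis by (simp add: r_def dvd_eq_mod_eq_0)
  qed
  define s where "s x = t x div int d" for x
  have "s \<in> hom G integer_group"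
    using dvd by (auto simp: hom_def s_def add)
  then interpret s: group_hom G integer_group s
    by (simp add: group_hom_def group_hom_axioms_def group_axioms)
  have "s ` carrier G = carrier integer_group"
  proof -
    have "k \<in> s ` carrier G" for k
      using g0 d pow[OF g0(1), of k] by (intro image_eqI[of _ _ "g0 [^] k"]) (auto simp: s_def)
    then show ?thesis by auto
  qed
  then have "G Mod kernel G integer_group s \<cong> integer_group" by (rule s.FactGroup_iso)
  then show "has_quotient_Z G" using s.normal_kernel by (auto simp: has_quotient_Z_def)
qed

end

text \<open>
  The real numbers are a vector space over the rational numbers, and \<open>{a}\<close> extends to a basis.
\<close>

lemma rational_functional:
  fixes a :: real
  assumes "a \<noteq> 0"
  shows "\<exists>f :: real \<Rightarrow> rat. (\<forall>x y. f (x + y) = f x + f y) \<and> f a = 1"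
proof -
  interpret vector_space_pair "\<lambda>(q :: rat) (x :: real). of_rat q * x" "(*) :: rat \<Rightarrow> rat \<Rightarrow> rat"
    by unfold_locales (auto simp: algebra_simps of_rat_add of_rat_mult)
  have ind: "vs1.independent {a}" using assms by (simp add: vs1.dependent_single)
  let ?f = "construct {a} (\<lambda>_. 1)"
  interpret f: Vector_Spaces.linear "\<lambda>(q :: rat) (x :: real). of_rat q * x" "(*) :: rat \<Rightarrow> rat \<Rightarrow> rat" ?f
    by (rule linear_construct[OF ind])
  show ?thesis using f.add construct_basis[OF ind, of a "\<lambda>_. 1"] by (intro exI[of _ ?f]) auto
qed

text \<open>
  A rational functional turns a nonzero \<open>\<tau>\<close> into a nonzero homomorphism \<open>q\<close> to the rational
  numbers. The subgroups \<open>{x. n! q x \<in> \<int>}\<close> increase to the whole group, so one of them is the whole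
  group, and \<open>n! q\<close> is a nonzero homomorphism to the integers.
\<close>

lemma (in group) real_hom_trivial:
  assumes Z: "\<not> has_quotient_Z G" and U: "\<not> countable_increasing_union G"
    and \<tau>: "\<And>g h. g \<in> carrier G \<Longrightarrow> h \<in> carrier G \<Longrightarrow> \<tau> (g \<otimes> h) = \<tau> g + (\<tau> h :: real)"
    and g: "g \<in> carrier G"
  shows "\<tau> g = 0"
proof (rule ccontr)
  assume "\<tau> g \<noteq> 0"
  then obtain f :: "real \<Rightarrow> rat" where f: "\<And>x y. f (x + y) = f x + f y" "f (\<tau> g) = 1"
    using rational_functional by metis
  define q where "q x = f (\<tau> x)" for x
  have q: "q (x \<otimes> y) = q x + q y" if "x \<in> carrier G" "y \<in> carrier G" for x y
    using that by (simp add: q_def \<tau> f)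
  have q1: "q \<one> = 0" using q[of \<one> \<one>] by simp
  have q_inv: "q (inv x) = - q x" if "x \<in> carrier G" for x
    using q[of x "inv x"] that q1 by (simp add: eq_neg_iff_add_eq_0 add.commute)
  define K where "K n = {x \<in> carrier G. fact n * q x \<in> \<int>}" for n
  have sub: "subgroup (K n) G" for n
    by (rule subgroupI) (auto simp: K_def q q_inv q1 distrib_left intro!: exI[of _ \<one>])
  have mono: "K n \<subseteq> K (Suc n)" for n
  proof
    fix x assume "x \<in> K n"
    then have x: "x \<in> carrier G" "fact n * q x \<in> \<int>" by (auto simp: K_def)
    have "fact (Suc n) * q x = of_nat (Suc n) * (fact n * q x)" by (simp add: algebra_simps)
    then have "fact (Suc n) * q x \<in> \<int>" using Ints_mult[OF Ints_of_nat x(2)] by metis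
    then show "x \<in> K (Suc n)" using x(1) by (simp add: K_def)
  qed
  have all: "carrier G = (\<Union>n. K n)"
  proof -
    have "\<exists>n. x \<in> K n" if x: "x \<in> carrier G" for x
    proof -
      obtain a b :: int where ab: "q x = of_int a / of_int b" "0 < b"
        using quotient_of_div[of "q x"] quotient_of_denom_pos[of "q x"]
        by (cases "quotient_of (q x)") auto
      define n where "n = nat b"
      have n: "0 < n" "b = int n" using ab(2) by (auto simp: n_def)
      have "(fact n :: rat) = of_nat n * fact (n - 1)" using n(1) by (rule fact_reduce)
      then have "fact n * q x = of_int a * fact (n - 1)" using ab n by simp
      then have "fact n * q x \<in> \<int>"
        by (simp only:) (intro Ints_mult Ints_of_int fact_in_Ints)
      then show ?thesis using x by (auto simp: K_def)
    qed
    then show ?thesis by (auto simp: K_def)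
  qed
  obtain n where n: "K n = carrier G"
    using U sub mono all unfolding countable_increasing_union_def by metis
  define t where "t x = \<lfloor>fact n * q x\<rfloor>" for x
  have t: "of_int (t x) = fact n * q x" if "x \<in> carrier G" for x
  proof -
    have "fact n * q x \<in> \<int>" using that n by (auto simp: K_def)
    then show ?thesis by (simp add: t_def)
  qed
  have "t (x \<otimes> y) = t x + t y" if "x \<in> carrier G" "y \<in> carrier G" for x y
  proof -
    have "of_int (t (x \<otimes> y)) = (of_int (t x + t y) :: rat)"
      using that by (simp add: t q distrib_left)
    then show ?thesis by (simp only: of_int_eq_iff)
  qed
  then have "t \<in> hom G integer_group" by (auto simp: hom_def)
  moreover have "t g \<noteq> 0"
  proof
    assume "t g = 0"
    then show False using t[OF g] f(2) by (simp add: q_def)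
  qed
  ultimately show False using Z g has_quotient_Z_iff_int_hom by blast
qed

section \<open>Trees and the four point inequality\<close>

definition four_point_metric :: "'m set \<Rightarrow> ('m \<Rightarrow> 'm \<Rightarrow> real) \<Rightarrow> bool"
  where "four_point_metric T d \<longleftrightarrow> (\<forall>x\<in>T. \<forall>y\<in>T. \<forall>z\<in>T. \<forall>w\<in>T.
    d x y + d z w \<le> max (d x z + d y w) (d x w + d y z))"

text \<open>
  The point \<open>p\<close> of the segment from \<open>w\<close> to \<open>z\<close> at distance \<open>t\<close> from \<open>w\<close>, where \<open>t\<close> is the smaller
  of the Gromov products of \<open>z\<close> with \<open>x\<close> and \<open>y\<close>, lies also on the segments from \<open>w\<close> to \<open>x\<close> and
  to \<open>y\<close>, because triangles are thin. A detour through \<open>p\<close> bounds the distance of \<open>x\<close> and \<open>y\<close>.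
\<close>

lemma real_tree_four_point:
  assumes tree: "real_tree T d"
  shows "four_point_metric T d"
  unfolding four_point_metric_def
proof (intro ballI)
  interpret Metric_space T d using tree by (simp add: real_tree_def)
  fix x y z w assume T: "x \<in> T" "y \<in> T" "z \<in> T" "w \<in> T"
  define t where "t = min ((d w x + d w z - d x z) / 2) ((d w y + d w z - d y z) / 2)"
  have t_cases: "2 * t = d w x + d w z - d x z \<or> 2 * t = d w y + d w z - d y z"
    by (simp add: t_def min_def)
  have t: "0 \<le> t" "t \<le> d w z" "2 * t \<le> d w x + d w z - d x z" "2 * t \<le> d w y + d w z - d y z"
    using triangle[of x w z] triangle[of y w z] triangle[of w x z] triangle[of w z x] T
      commute[of x w] commute[of y w] commute[of z x]
    by (auto simp: t_def min_def)
  obtain c where c: "c \<in> {0..d w z} \<rightarrow> T" "c 0 = w" "c (d w z) = z"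
      "\<And>s t. s \<in> {0..d w z} \<Longrightarrow> t \<in> {0..d w z} \<Longrightarrow> d (c s) (c t) = \<bar>s - t\<bar>"
      "geodesic_interval T d w z = c ` {0..d w z}"
    using geodesic_segment_interval(1)[OF tree T(4,3)] unfolding geodesic_segment_def by metis
  define p where "p = c t"
  have p: "p \<in> T" "d w p = t" "d p z = d w z - t" "p \<in> geodesic_interval T d w z"
    using c(1,2,3,5) c(4)[of 0 t] c(4)[of t "d w z"] t(1,2) by (auto simp: p_def)
  have near: "d p u \<le> d w u - t" if u: "u \<in> T" "2 * t \<le> d w u + d w z - d u z" for u
  proof -
    have "p \<in> geodesic_interval T d w u \<union> geodesic_interval T d u z"
      using real_tree_thin_triangles[OF tree T(4,3) u(1)] p(4) by blast
    then show ?thesis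
      using p u(2) commute[of u p] by (auto simp: geodesic_interval_def)
  qed
  have "d x y \<le> d p x + d p y" using triangle[of x p y] T p(1) commute[of x p] by simp
  then have "d x y \<le> d w x + d w y - 2 * t" using near[of x] near[of y] T t by linarith
  then show "d x y + d z w \<le> max (d x z + d y w) (d x w + d y z)"
    using commute[of x w] commute[of y w] commute[of z w] t_cases by linarith
qed

lemma path_in_graph:
  assumes "(u, v) \<in> R\<^sup>*"
  shows "\<exists>p. p \<noteq> [] \<and> hd p = u \<and> last p = v \<and> distinct p \<and> successively (\<lambda>x y. (x, y) \<in> R) p"
  using assms
proof (induction rule: converse_rtrancl_induct)
  case base
  show ?case by (rule exI[of _ "[v]"]) auto
next
  case (step u w)
  then obtain p where p: "p \<noteq> []" "hd p = w" "last p = v" "distinct p"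
    "successively (\<lambda>x y. (x, y) \<in> R) p" by blast
  show ?case
  proof (cases "u \<in> set p")
    case True
    then obtain p1 p2 where "p = p1 @ u # p2" by (meson split_list)
    then show ?thesis using p by (intro exI[of _ "u # p2"]) (auto simp: successively_append_iff)
  next
    case False
    then show ?thesis using p step(1) by (intro exI[of _ "u # p"]) (cases p; auto)
  qed
qed

text \<open>
  A path from \<open>a\<close> to \<open>b\<close> that avoids \<open>v\<close> would close up to a cycle through \<open>v\<close>.
\<close>

lemma tree_neighbours_separated:
  assumes tree: "graph_tree V E" and E: "(v, a) \<in> E" "(v, b) \<in> E"
    and path: "(a, b) \<in> (E \<inter> (- {v}) \<times> (- {v}))\<^sup>*" and a: "a \<noteq> v"
  shows "a = b"
proof (rule ccontr)
  assume ab: "a \<noteq> b"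
  let ?R = "E \<inter> (- {v}) \<times> (- {v})"
  obtain p where p: "p \<noteq> []" "hd p = a" "last p = b" "distinct p"
    "successively (\<lambda>x y. (x, y) \<in> ?R) p"
    using path_in_graph[OF path] by blast
  have symE: "sym E" using tree by (auto simp: graph_tree_def simple_graph_def)
  obtain a' q where q: "p = a # a' # q"
    using p ab by (cases p; cases "tl p") auto
  have nth: "(p ! i, p ! Suc i) \<in> ?R" if "Suc i < length p" for i
    using p(5) that by (simp add: successively_conv_nth)
  have "v \<notin> set p"
  proof
    assume "v \<in> set p"
    then obtain i where i: "i < length p" "p ! i = v" by (auto simp: in_set_conv_nth)
    show False
    proof (cases i)
      case 0
      then show ?thesis using i a q by simp
    next
      case (Suc j)
      then show ?thesis using nth[of j] i by auto
    qed
  qed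
  moreover have "((v # p) ! i, (v # p) ! (Suc i mod length (v # p))) \<in> E"
    if i: "i < length (v # p)" for i
  proof (cases i)
    case 0
    then show ?thesis using E q by simp
  next
    case (Suc j)
    show ?thesis
    proof (cases "Suc j < length p")
      case True
      then show ?thesis using nth[of j] Suc by simp
    next
      case False
      then have j: "j = length p - 1" "Suc i = length (v # p)" using i Suc p(1) by auto
      then have "p ! j = b" using p(1,3) by (simp add: last_conv_nth)
      then have "(v # p) ! i = b" using Suc by simp
      then show ?thesis unfolding j(2) using E(2) symE by (simp add: symD)
    qed
  qed
  ultimately have "graph_cycle E (v # p)"
    using p(4) q by (auto simp: graph_cycle_def)
  then show False using tree by (auto simp: graph_tree_def)
qed

context
  fixes V :: "'v set" and E and w
  assumes tree: "graph_tree V E" and w: "w \<in> V"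
begin

private abbreviation h :: "'v \<Rightarrow> nat" where "h v \<equiv> graph_dist E v w"

interpretation D: Metric_space V "\<lambda>x y. real (graph_dist E x y)"
  by (rule Metric_space_graph_dist[OF tree])

lemma E_in_V: "(u, v) \<in> E \<Longrightarrow> u \<in> V \<and> v \<in> V"
  using tree by (auto simp: graph_tree_def simple_graph_def)

lemma E_sym: "(u, v) \<in> E \<Longrightarrow> (v, u) \<in> E"
  using tree by (auto simp: graph_tree_def simple_graph_def dest: symD)

lemma height_edge: "(u, v) \<in> E \<Longrightarrow> h u \<le> Suc (h v)"
proof -
  assume E: "(u, v) \<in> E"
  have "(v, w) \<in> E ^^ h v"
    using tree E w by (intro graph_dist_walk) (auto simp: graph_tree_def dest: E_in_V)
  then have "(u, w) \<in> E ^^ Suc (h v)" using E by (rule relpow_Suc_I2[rotated])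
  then show ?thesis by (rule graph_dist_le)
qed

lemma height_descend:
  assumes v: "v \<in> V" "v \<noteq> w"
  shows "\<exists>u. (v, u) \<in> E \<and> h v = Suc (h u)"
proof -
  have "(v, w) \<in> E ^^ h v"
    using tree v w by (intro graph_dist_walk) (auto simp: graph_tree_def)
  moreover have "h v \<noteq> 0" using D.zero[OF v(1) w] v(2) by simp
  ultimately obtain n u where n: "h v = Suc n" "(v, u) \<in> E" "(u, w) \<in> E ^^ n"
    by (metis not0_implies_Suc relpow_Suc_D2)
  then have "h u \<le> n" using graph_dist_le by metis
  then show ?thesis using n height_edge[OF n(2)] by (intro exI[of _ u]) auto
qed

lemma height_path:
  assumes "v \<in> V" "h v < n"
  shows "(v, w) \<in> (E \<inter> {u. h u < n} \<times> {u. h u < n})\<^sup>*"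
  using assms
proof (induction "h v" arbitrary: v rule: less_induct)
  case less
  show ?case
  proof (cases "v = w")
    case False
    then obtain u where u: "(v, u) \<in> E" "h v = Suc (h u)" using height_descend less by blast
    then have "(u, w) \<in> (E \<inter> {u. h u < n} \<times> {u. h u < n})\<^sup>*"
      using less E_in_V by (intro less.hyps) auto
    then show ?thesis using u less.prems by (intro converse_rtrancl_into_rtrancl[of v u]) auto
  qed auto
qed

text \<open>
  Two such neighbours would be joined through the root \<open>w\<close> by a walk that avoids \<open>v\<close>, since a shortest
  walk from a neighbour to the root continues with vertices that are closer to the root than \<open>v\<close>.
\<close>

lemma lower_neighbour_unique:
  assumes E: "(v, a) \<in> E" "(v, b) \<in> E" and le: "h a \<le> h v" "h b \<le> h v"
  shows "a = b"
proof -
  let ?R = "E \<inter> (- {v}) \<times> (- {v})"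
  have irr: "(x, x) \<notin> E" for x
    using tree by (auto simp: graph_tree_def simple_graph_def irrefl_def)
  have "sym ?R" using E_sym by (auto simp: sym_def)
  then have symR: "sym (?R\<^sup>*)" by (rule sym_rtrancl)
  have vV: "v \<in> V" using E E_in_V by blast
  have toroot: "(a, w) \<in> ?R\<^sup>*" if a: "(v, a) \<in> E" "h a \<le> h v" and vw: "v \<noteq> w" for a
  proof -
    have aV: "a \<in> V" using a E_in_V by blast
    have low: "(u, w) \<in> ?R\<^sup>*" if "u \<in> V" "h u < h v" for u
      by (rule rtrancl_mono[THEN subsetD, OF _ height_path[OF that]]) auto
    show ?thesis
    proof (cases "a = w \<or> h a < h v")
      case True
      then show ?thesis using low aV by auto
    next
      case False
      then obtain u where u: "(a, u) \<in> E" "h a = Suc (h u)" using height_descend aV by blast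
      then have "(u, w) \<in> ?R\<^sup>*" using low[of u] E_in_V a False by auto
      moreover have "(a, u) \<in> ?R" using u a False irr by auto
      ultimately show ?thesis by (intro converse_rtrancl_into_rtrancl[of a u])
    qed
  qed
  show ?thesis
  proof (cases "v = w")
    case True
    then have "h a = 0" "h b = 0" using le D.zero[OF w w] by auto
    then show ?thesis using D.zero[of a w] D.zero[of b w] E E_in_V w by auto
  next
    case False
    have "(a, b) \<in> ?R\<^sup>*"
      using toroot[OF E(1) le(1) False] toroot[OF E(2) le(2) False] symR
      by (meson rtrancl_trans symD)
    then show ?thesis using tree_neighbours_separated[OF tree E] irr E by metis
  qed
qed

text \<open>
  The neighbour of \<open>v\<close> on the path to the root; the root itself is sent to itself.
\<close>

definition toward :: "'v \<Rightarrow> 'v"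
  where "toward v = (if v = w then w else SOME u. (v, u) \<in> E \<and> h v = Suc (h u))"

lemma toward_neighbour:
  assumes "v \<in> V" "v \<noteq> w"
  shows "(v, toward v) \<in> E" "h v = Suc (h (toward v))"
  using someI_ex[OF height_descend[OF assms]] assms by (simp_all add: toward_def)

lemma toward_edge:
  assumes "(u, v) \<in> E"
  shows "(v = toward u \<and> h u = Suc (h v)) \<or> (u = toward v \<and> h v = Suc (h u))"
proof -
  have *: "v = toward u \<and> h u = Suc (h v)" if uv: "(u, v) \<in> E" "h v \<le> h u" for u v
  proof -
    have u: "u \<in> V" "v \<in> V" using uv E_in_V by blast+
    have "u \<noteq> w"
    proof
      assume "u = w"
      then have "v = w" using uv(2) D.zero[OF w w] D.zero[OF u(2) w] by auto
      then show False
        using uv \<open>u = w\<close> tree by (auto simp: graph_tree_def simple_graph_def irrefl_def)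
    qed
    note t = toward_neighbour[OF u(1) this]
    then have "v = toward u" using lower_neighbour_unique[OF uv(1) t(1) uv(2)] by simp
    then show ?thesis using t(2) by simp
  qed
  show ?thesis using *[OF assms] *[OF E_sym[OF assms]] by linarith
qed

definition anc :: "nat \<Rightarrow> 'v \<Rightarrow> 'v"
  where "anc k v = (toward ^^ (h v - k)) v"

lemma anc_Suc_height: "h v = Suc (h u) \<Longrightarrow> u = toward v \<Longrightarrow> k \<le> h u \<Longrightarrow> anc k v = anc k u"
  by (simp add: anc_def Suc_diff_le funpow_Suc_right del: funpow.simps)

text \<open>
  The paths from the root to \<open>u\<close> and to \<open>v\<close> share their first \<open>k\<close> edges. The largest such \<open>k\<close> is the
  Gromov product of \<open>u\<close> and \<open>v\<close> with respect to the root, see \<open>meet_height\<close>.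
\<close>

definition agree :: "nat \<Rightarrow> 'v \<Rightarrow> 'v \<Rightarrow> bool"
  where "agree k u v \<longleftrightarrow> k \<le> h u \<and> k \<le> h v \<and> anc k u = anc k v"

lemma iter_toward:
  assumes "v \<in> V" "n \<le> h v"
  shows "(toward ^^ n) v \<in> V" "h ((toward ^^ n) v) = h v - n" "(v, (toward ^^ n) v) \<in> E ^^ n"
proof -
  have "(toward ^^ n) v \<in> V \<and> h ((toward ^^ n) v) = h v - n \<and> (v, (toward ^^ n) v) \<in> E ^^ n"
    using assms(2)
  proof (induction n)
    case 0
    then show ?case using assms(1) by simp
  next
    case (Suc n)
    let ?u = "(toward ^^ n) v"
    have IH: "?u \<in> V" "h ?u = h v - n" "(v, ?u) \<in> E ^^ n" using Suc by auto
    have "?u \<noteq> w" using IH(2) Suc.prems D.zero[OF w w] by auto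
    note t = toward_neighbour[OF IH(1) this]
    have "toward ?u \<in> V" using t(1) E_in_V by blast
    moreover have "h (toward ?u) = h v - Suc n" using t(2) IH(2) by linarith
    moreover have "(v, toward ?u) \<in> E ^^ Suc n" using relpow_Suc_I[OF IH(3) t(1)] .
    ultimately show ?case by (simp only: funpow.simps o_apply simp_thms)
  qed
  then show "(toward ^^ n) v \<in> V" "h ((toward ^^ n) v) = h v - n" "(v, (toward ^^ n) v) \<in> E ^^ n"
    by auto
qed

lemma anc_height:
  assumes "v \<in> V" "k \<le> h v"
  shows "anc k v \<in> V" "h (anc k v) = k" "graph_dist E v (anc k v) \<le> h v - k"
  using iter_toward[OF assms(1), of "h v - k"] assms(2)
    graph_dist_le[of v "(toward ^^ (h v - k)) v" "h v - k" E]
  by (simp_all add: anc_def)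

lemma agree_mono: "agree k u v \<Longrightarrow> j \<le> k \<Longrightarrow> agree j u v"
proof -
  assume k: "agree k u v" "j \<le> k"
  have "anc j x = (toward ^^ (k - j)) (anc k x)" if "k \<le> h x" for x
  proof -
    have "h x - j = (k - j) + (h x - k)" using that k(2) by simp
    then show ?thesis by (simp only: anc_def funpow_add o_def)
  qed
  then show ?thesis using k by (auto simp: agree_def)
qed

text \<open>
  A walk can leave a branch of the rooted tree only by descending to the branching point: each step
  changes the height by one, and only a step towards the root can shorten the common path.
\<close>

lemma walk_agree:
  assumes "(u, v) \<in> E ^^ n" "u \<in> V"
  shows "\<exists>k. agree k u v \<and> h u + h v \<le> n + 2 * k"
  using assms(1)
proof (induction n arbitrary: v)
  case 0
  then show ?case by (auto simp: agree_def)
next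
  case (Suc n)
  then obtain v' where v': "(u, v') \<in> E ^^ n" "(v', v) \<in> E" by auto
  obtain k where k: "agree k u v'" "h u + h v' \<le> n + 2 * k" using Suc.IH[OF v'(1)] by blast
  consider "v' = toward v" "h v = Suc (h v')" | "v = toward v'" "h v' = Suc (h v)"
    using toward_edge[OF v'(2)] by blast
  then show ?case
  proof cases
    case 1
    then have "agree k u v" using k(1) anc_Suc_height[of v v' k] by (auto simp: agree_def)
    then show ?thesis using k(2) 1 by auto
  next
    case 2
    define j where "j = min k (h v)"
    have "agree j u v'" using agree_mono[OF k(1)] by (simp add: j_def)
    then have "agree j u v" using 2 anc_Suc_height[of v' v j] by (auto simp: agree_def j_def)
    moreover have "k \<le> Suc j" using k(1) 2 by (auto simp: agree_def j_def)
    ultimately show ?thesis using k(2) 2 by (auto simp: agree_def j_def)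
  qed
qed

lemma agree_iff:
  assumes "u \<in> V" "v \<in> V"
  shows "(\<exists>k. agree k u v \<and> m \<le> k) \<longleftrightarrow> graph_dist E u v + 2 * m \<le> h u + h v"
proof
  assume "\<exists>k. agree k u v \<and> m \<le> k"
  then have m: "agree m u v" using agree_mono by blast
  let ?p = "anc m u"
  have "?p = anc m v" "m \<le> h u" "m \<le> h v" using m by (auto simp: agree_def)
  then have "?p \<in> V" "graph_dist E u ?p \<le> h u - m" "graph_dist E v ?p \<le> h v - m"
    using anc_height assms by metis+
  moreover have "real (graph_dist E u v) \<le> real (graph_dist E u ?p) + real (graph_dist E v ?p)"
    using D.triangle[of u ?p v] D.commute[of v ?p] assms \<open>?p \<in> V\<close> by simp
  ultimately show "graph_dist E u v + 2 * m \<le> h u + h v" using \<open>m \<le> h u\<close> \<open>m \<le> h v\<close> by linarith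
next
  assume le: "graph_dist E u v + 2 * m \<le> h u + h v"
  have "(u, v) \<in> E ^^ graph_dist E u v"
    using tree assms by (intro graph_dist_walk) (auto simp: graph_tree_def)
  then obtain k where "agree k u v" "h u + h v \<le> graph_dist E u v + 2 * k"
    using walk_agree assms by blast
  then show "\<exists>k. agree k u v \<and> m \<le> k" using le by auto
qed

lemma agree_trans: "agree k u v \<Longrightarrow> agree k v x \<Longrightarrow> agree k u x"
  by (simp add: agree_def)

lemma meet_height:
  assumes "u \<in> V" "v \<in> V"
  shows "\<exists>m. h u + h v = graph_dist E u v + 2 * m \<and> agree m u v"
proof -
  have "(u, v) \<in> E ^^ graph_dist E u v"
    using tree assms by (intro graph_dist_walk) (auto simp: graph_tree_def)
  then obtain k where k: "agree k u v" "h u + h v \<le> graph_dist E u v + 2 * k"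
    using walk_agree assms by blast
  then show ?thesis using agree_iff[OF assms, of k] by (intro exI[of _ k]) auto
qed

text \<open>
  For three branches of a rooted tree, the two smallest of the three branching heights agree.
\<close>

lemma graph_tree_root_four_point:
  assumes "x \<in> V" "y \<in> V" "z \<in> V"
  shows "graph_dist E x y + h z \<le> max (graph_dist E x z + h y) (h x + graph_dist E y z)"
proof -
  obtain m where m: "h x + h z = graph_dist E x z + 2 * m" "agree m x z"
    using meet_height[OF assms(1,3)] by blast
  obtain n where n: "h z + h y = graph_dist E z y + 2 * n" "agree n z y"
    using meet_height[OF assms(3,2)] by blast
  have "agree (min m n) x y"
    by (rule agree_trans[OF agree_mono[OF m(2)] agree_mono[OF n(2)]]) simp_all
  then have "graph_dist E x y + 2 * min m n \<le> h x + h y"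
    using agree_iff[OF assms(1,2), of "min m n"] by blast
  moreover have "graph_dist E z y = graph_dist E y z" using D.commute[of z y] by simp
  ultimately show ?thesis using m(1) n(1) by linarith
qed

end

lemma graph_tree_four_point:
  assumes "graph_tree V E"
  shows "four_point_metric V (\<lambda>x y. real (graph_dist E x y))"
  unfolding four_point_metric_def
proof (intro ballI)
  fix x y z w assume V: "x \<in> V" "y \<in> V" "z \<in> V" "w \<in> V"
  show "real (graph_dist E x y) + real (graph_dist E z w)
      \<le> max (real (graph_dist E x z) + real (graph_dist E y w))
        (real (graph_dist E x w) + real (graph_dist E y z))"
    using graph_tree_root_four_point[OF assms V(4,1,2,3)] by linarith
qed

section \<open>Bounded isometric actions\<close>

lemma group_action_pullback:
  assumes "group_action W V \<phi>" "group K" "t \<in> hom K W"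
  shows "group_action K V (\<lambda>k. \<phi> (t k))"
proof -
  have "\<phi> \<in> hom W (BijGroup V)"
    using assms(1) by (simp add: group_action_def group_hom_def group_hom_axioms_def)
  then have "\<phi> \<circ> t \<in> hom K (BijGroup V)" using assms(3) Group.hom_compose by blast
  then show ?thesis
    using assms(2)
    by (simp add: group_action_def group_hom_def group_hom_axioms_def group_BijGroup o_def)
qed

lemma graph_action_isometric:
  assumes tree: "graph_tree V E" and act: "graph_action W V E \<phi>"
  shows "isometric_action W V (\<lambda>x y. real (graph_dist E x y)) \<phi>"
  unfolding isometric_action_def
proof (intro conjI ballI)
  show A: "group_action W V \<phi>" using act by (simp add: graph_action_def)
  interpret A: group_action W V \<phi> by fact
  interpret W: group W using A.group_hom group_hom.axioms(1) by blast
  have cl: "\<phi> g v \<in> V" if "g \<in> carrier W" "v \<in> V" for g v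
    using that A.element_image by blast
  have EV: "E \<subseteq> V \<times> V" and conn: "\<And>u v. u \<in> V \<Longrightarrow> v \<in> V \<Longrightarrow> (u, v) \<in> E\<^sup>*"
    using tree by (auto simp: graph_tree_def simple_graph_def)
  have walk: "(\<phi> g u, \<phi> g v) \<in> E ^^ n" if "g \<in> carrier W" "(u, v) \<in> E ^^ n" for g u v n
    using that(2)
  proof (induction n arbitrary: v)
    case (Suc n)
    then obtain v' where v': "(u, v') \<in> E ^^ n" "(v', v) \<in> E" by auto
    then have "(\<phi> g v', \<phi> g v) \<in> E" using act EV that(1) by (auto simp: graph_action_def)
    then show ?case using Suc.IH[OF v'(1)] by auto
  qed auto
  have le: "graph_dist E (\<phi> g u) (\<phi> g v) \<le> graph_dist E u v"
    if "g \<in> carrier W" "u \<in> V" "v \<in> V" for g u v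
    using walk[OF that(1) graph_dist_walk[OF conn[OF that(2,3)]]] by (rule graph_dist_le)
  fix g u v assume guv: "g \<in> carrier W" "u \<in> V" "v \<in> V"
  have "\<phi> (inv\<^bsub>W\<^esub> g) (\<phi> g x) = x" if "x \<in> V" for x
    using A.orbit_sym_aux[OF guv(1) that] by simp
  then have "graph_dist E u v \<le> graph_dist E (\<phi> g u) (\<phi> g v)"
    using le[of "inv\<^bsub>W\<^esub> g" "\<phi> g u" "\<phi> g v"] guv cl by simp
  then show "real (graph_dist E (\<phi> g u) (\<phi> g v)) = real (graph_dist E u v)"
    using le[OF guv] by simp
qed

locale pointed_isometric_action = Metric_space M d for M :: "'m set" and d +
  fixes W :: "('a, 'c) monoid_scheme" and \<phi> and b :: 'm
  assumes isometric: "isometric_action W M d \<phi>" and base_point: "b \<in> M"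
begin

sublocale A: group_action W M \<phi>
  using isometric by (simp add: isometric_action_def)

sublocale W: group W
  using A.group_hom group_hom.axioms(1) by blast

definition displacement :: "'a \<Rightarrow> real"
  where "displacement g = d b (\<phi> g b)"

text \<open>
  Displacements of quotients are distances in the orbit, which turns metric statements about the
  orbit into statements about a function on the group.
\<close>

lemma displacement_diff:
  assumes "g \<in> carrier W" "h \<in> carrier W"
  shows "displacement (inv\<^bsub>W\<^esub> g \<otimes>\<^bsub>W\<^esub> h) = d (\<phi> g b) (\<phi> h b)"
proof -
  let ?k = "inv\<^bsub>W\<^esub> g \<otimes>\<^bsub>W\<^esub> h"
  have "g \<otimes>\<^bsub>W\<^esub> ?k = h" using assms by (simp add: W.m_assoc[symmetric])
  then have "\<phi> h b = \<phi> g (\<phi> ?k b)"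
    using A.composition_rule[OF base_point assms(1), of ?k] assms by simp
  moreover have "\<phi> ?k b \<in> M" using A.element_image base_point assms by blast
  ultimately show ?thesis
    using isometric assms(1) base_point by (simp add: isometric_action_def displacement_def)
qed

lemma mbounded_orbit_iff:
  "mbounded (orbit W \<phi> b) \<longleftrightarrow> (\<exists>B. \<forall>g\<in>carrier W. displacement g \<le> B)"
proof
  assume "mbounded (orbit W \<phi> b)"
  then obtain B where "\<And>x y. x \<in> orbit W \<phi> b \<Longrightarrow> y \<in> orbit W \<phi> b \<Longrightarrow> d x y \<le> B"
    unfolding mbounded_alt by blast
  moreover have "b \<in> orbit W \<phi> b" using A.orbit_refl base_point by blast
  ultimately show "\<exists>B. \<forall>g\<in>carrier W. displacement g \<le> B"
    unfolding displacement_def orbit_def by blast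
next
  assume "\<exists>B. \<forall>g\<in>carrier W. displacement g \<le> B"
  then obtain B where B: "\<And>g. g \<in> carrier W \<Longrightarrow> displacement g \<le> B" by blast
  have "d (\<phi> g b) (\<phi> h b) \<le> B" if "g \<in> carrier W" "h \<in> carrier W" for g h
    using that displacement_diff[OF that] B[of "inv\<^bsub>W\<^esub> g \<otimes>\<^bsub>W\<^esub> h"] by simp
  moreover have "orbit W \<phi> b \<subseteq> M"
    using A.element_image base_point by (auto simp: orbit_def)
  ultimately show "mbounded (orbit W \<phi> b)" unfolding mbounded_alt orbit_def by blast
qed

lemma length_function_displacement:
  assumes fp: "four_point_metric M d"
  shows "length_function W displacement"
proof
  have M: "\<phi> g b \<in> M" if "g \<in> carrier W" for g using A.element_image base_point that by blast
  show "displacement \<one>\<^bsub>W\<^esub> = 0"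
    using A.id_eq_one base_point by (simp add: displacement_def) (metis mdist_zero restrict_apply')
  show "displacement (inv\<^bsub>W\<^esub> g) = displacement g" if "g \<in> carrier W" for g
    using displacement_diff[OF that W.one_closed] that commute[of "\<phi> g b" b] A.id_eq_one base_point
    by (simp add: displacement_def) (metis restrict_apply')
  fix g h k l assume "g \<in> carrier W" "h \<in> carrier W" "k \<in> carrier W" "l \<in> carrier W"
  then show "displacement (inv\<^bsub>W\<^esub> g \<otimes>\<^bsub>W\<^esub> h) + displacement (inv\<^bsub>W\<^esub> k \<otimes>\<^bsub>W\<^esub> l)
      \<le> max (displacement (inv\<^bsub>W\<^esub> g \<otimes>\<^bsub>W\<^esub> k) + displacement (inv\<^bsub>W\<^esub> h \<otimes>\<^bsub>W\<^esub> l))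
        (displacement (inv\<^bsub>W\<^esub> g \<otimes>\<^bsub>W\<^esub> l) + displacement (inv\<^bsub>W\<^esub> h \<otimes>\<^bsub>W\<^esub> k))"
    using fp M by (simp add: displacement_diff four_point_metric_def)
qed

end

section \<open>Elements of a wreath product\<close>

locale wreath = G: group G + A: group_action H X \<phi>
  for G :: "('g, 'c) monoid_scheme" and H :: "('h, 'd) monoid_scheme"
    and X :: "'x set" and \<phi> :: "'h \<Rightarrow> 'x \<Rightarrow> 'x"
begin

sublocale H: group H
  using A.group_hom group_hom.axioms(1) by blast

definition W :: "(('x \<Rightarrow> 'g) \<times> 'h) monoid"
  where "W = wreath_product G H X \<phi>"

sublocale W: group W
  unfolding W_def by (rule group_wreath_product) (rule G.is_group A.group_action_axioms)+

abbreviation N :: "('x \<Rightarrow> 'g) set"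
  where "N \<equiv> carrier (sum_group X (\<lambda>_. G))"

lemma N_iff: "f \<in> N \<longleftrightarrow> f \<in> X \<rightarrow>\<^sub>E carrier G \<and> finite {x \<in> X. f x \<noteq> \<one>\<^bsub>G\<^esub>}"
  by (simp add: carrier_sum_group G.is_group)

lemma N_closed: "f \<in> N \<Longrightarrow> x \<in> X \<Longrightarrow> f x \<in> carrier G"
  by (auto simp: N_iff)

lemma act_closed: "h \<in> carrier H \<Longrightarrow> x \<in> X \<Longrightarrow> \<phi> h x \<in> X"
  using A.element_image by blast

lemma act_one: "x \<in> X \<Longrightarrow> \<phi> \<one>\<^bsub>H\<^esub> x = x"
  using A.id_eq_one by (metis restrict_apply')

lemma act_inv:
  assumes "h \<in> carrier H" "x \<in> X"
  shows "\<phi> (inv\<^bsub>H\<^esub> h) (\<phi> h x) = x" "\<phi> h (\<phi> (inv\<^bsub>H\<^esub> h) x) = x"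
  using A.composition_rule[OF assms(2), of "inv\<^bsub>H\<^esub> h" h]
    A.composition_rule[OF assms(2), of h "inv\<^bsub>H\<^esub> h"] assms act_one by auto

lemma W_carrier: "carrier W = N \<times> carrier H"
  by (simp add: W_def wreath_product_def semidirect_product_def)

lemma W_one: "\<one>\<^bsub>W\<^esub> = (\<lambda>x\<in>X. \<one>\<^bsub>G\<^esub>, \<one>\<^bsub>H\<^esub>)"
  by (simp add: W_def wreath_product_def semidirect_product_def)

lemma W_mult:
  "(f, h) \<otimes>\<^bsub>W\<^esub> (f', h') = (\<lambda>x\<in>X. f x \<otimes>\<^bsub>G\<^esub> f' (\<phi> (inv\<^bsub>H\<^esub> h) x), h \<otimes>\<^bsub>H\<^esub> h')"
  by (auto simp: W_def wreath_product_def semidirect_product_def shift_action_def)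

definition of_top :: "'h \<Rightarrow> ('x \<Rightarrow> 'g) \<times> 'h"
  where "of_top h = (\<lambda>x\<in>X. \<one>\<^bsub>G\<^esub>, h)"

definition of_base :: "('x \<Rightarrow> 'g) \<Rightarrow> ('x \<Rightarrow> 'g) \<times> 'h"
  where "of_base f = (f, \<one>\<^bsub>H\<^esub>)"

definition single :: "'x \<Rightarrow> 'g \<Rightarrow> ('x \<Rightarrow> 'g) \<times> 'h"
  where "single x g = of_base (\<lambda>y\<in>X. if y = x then g else \<one>\<^bsub>G\<^esub>)"

lemma of_top_closed: "h \<in> carrier H \<Longrightarrow> of_top h \<in> carrier W"
  by (auto simp: of_top_def W_carrier N_iff)

lemma of_base_closed: "f \<in> N \<Longrightarrow> of_base f \<in> carrier W"
  by (simp add: of_base_def W_carrier)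

lemma of_top_hom: "of_top \<in> hom H W"
proof (rule homI)
  show "of_top (h \<otimes>\<^bsub>H\<^esub> k) = of_top h \<otimes>\<^bsub>W\<^esub> of_top k" if "h \<in> carrier H" "k \<in> carrier H" for h k
    using that by (auto simp: of_top_def W_mult act_closed intro!: restrict_ext)
qed (rule of_top_closed)

lemma single_closed: "g \<in> carrier G \<Longrightarrow> single x g \<in> carrier W"
  unfolding single_def
  by (rule of_base_closed) (auto simp: N_iff intro: finite_subset[of _ "{x}"])

lemma single_hom: "single x \<in> hom G W"
proof (rule homI)
  show "single x (g \<otimes>\<^bsub>G\<^esub> k) = single x g \<otimes>\<^bsub>W\<^esub> single x k"
    if "g \<in> carrier G" "k \<in> carrier G" for g k
    using that by (auto simp: single_def of_base_def W_mult act_one intro!: restrict_ext)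
qed (rule single_closed)

lemma single_commute:
  assumes "x \<noteq> y" "g \<in> carrier G" "k \<in> carrier G"
  shows "single x g \<otimes>\<^bsub>W\<^esub> single y k = single y k \<otimes>\<^bsub>W\<^esub> single x g"
  using assms by (auto simp: single_def of_base_def W_mult act_one intro!: restrict_ext)

lemma of_top_single:
  assumes "h \<in> carrier H" "x \<in> X" "g \<in> carrier G"
  shows "of_top h \<otimes>\<^bsub>W\<^esub> single x g = single (\<phi> h x) g \<otimes>\<^bsub>W\<^esub> of_top h"
proof -
  have "\<phi> (inv\<^bsub>H\<^esub> h) y = x \<longleftrightarrow> y = \<phi> h x" if "y \<in> X" for y
    using act_inv[OF assms(1)] that assms(2) by metis
  then show ?thesis
    using assms act_closed by (auto simp: of_top_def single_def of_base_def W_mult intro!: restrict_ext)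
qed

lemma of_base_split:
  assumes f: "f \<in> N" and x: "x \<in> X"
  shows "f(x := \<one>\<^bsub>G\<^esub>) \<in> N" "of_base f = single x (f x) \<otimes>\<^bsub>W\<^esub> of_base (f(x := \<one>\<^bsub>G\<^esub>))"
proof -
  have fx: "f \<in> X \<rightarrow>\<^sub>E carrier G" "finite {y \<in> X. f y \<noteq> \<one>\<^bsub>G\<^esub>}" using f by (auto simp: N_iff)
  have "{y \<in> X. (f(x := \<one>\<^bsub>G\<^esub>)) y \<noteq> \<one>\<^bsub>G\<^esub>} \<subseteq> {y \<in> X. f y \<noteq> \<one>\<^bsub>G\<^esub>}" by auto
  then have "finite {y \<in> X. (f(x := \<one>\<^bsub>G\<^esub>)) y \<noteq> \<one>\<^bsub>G\<^esub>}" using fx(2) finite_subset by blast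
  moreover have "f(x := \<one>\<^bsub>G\<^esub>) \<in> X \<rightarrow>\<^sub>E carrier G"
    using fx(1) x by (auto simp: PiE_iff extensional_def)
  ultimately show "f(x := \<one>\<^bsub>G\<^esub>) \<in> N" by (simp only: N_iff)
  have "(\<lambda>y\<in>X. (if y = x then f x else \<one>\<^bsub>G\<^esub>) \<otimes>\<^bsub>G\<^esub> (f(x := \<one>\<^bsub>G\<^esub>)) y) = f"
    using fx(1) by (auto simp: PiE_iff extensional_def fun_eq_iff Pi_iff)
  moreover have "single x (f x) \<otimes>\<^bsub>W\<^esub> of_base (f(x := \<one>\<^bsub>G\<^esub>)) =
      of_base (\<lambda>y\<in>X. (if y = x then f x else \<one>\<^bsub>G\<^esub>) \<otimes>\<^bsub>G\<^esub> (f(x := \<one>\<^bsub>G\<^esub>)) y)"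
    by (auto simp: single_def of_base_def W_mult act_one intro!: restrict_ext)
  ultimately show "of_base f = single x (f x) \<otimes>\<^bsub>W\<^esub> of_base (f(x := \<one>\<^bsub>G\<^esub>))" by simp
qed

lemma of_base_top: "f \<in> N \<Longrightarrow> h \<in> carrier H \<Longrightarrow> (f, h) = of_base f \<otimes>\<^bsub>W\<^esub> of_top h"
proof -
  assume f: "f \<in> N" and h: "h \<in> carrier H"
  have "(\<lambda>y\<in>X. f y \<otimes>\<^bsub>G\<^esub> \<one>\<^bsub>G\<^esub>) = f"
    using f by (auto simp: N_iff PiE_iff extensional_def fun_eq_iff)
  moreover have "of_base f \<otimes>\<^bsub>W\<^esub> of_top h = (\<lambda>y\<in>X. f y \<otimes>\<^bsub>G\<^esub> \<one>\<^bsub>G\<^esub>, h)"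
    using h by (auto simp: of_base_def of_top_def W_mult act_one intro!: restrict_ext)
  ultimately show ?thesis by simp
qed

lemma of_base_pow:
  assumes f: "f \<in> N"
  shows "\<exists>f'\<in>N. of_base f [^]\<^bsub>W\<^esub> (n :: nat) = of_base f' \<and> {x \<in> X. f' x \<noteq> \<one>\<^bsub>G\<^esub>} \<subseteq> {x \<in> X. f x \<noteq> \<one>\<^bsub>G\<^esub>}"
proof (induction n)
  case 0
  show ?case
    by (rule bexI[of _ "\<lambda>x\<in>X. \<one>\<^bsub>G\<^esub>"]) (auto simp: of_base_def W_one N_iff)
next
  case (Suc n)
  then obtain f' where f': "f' \<in> N" "of_base f [^]\<^bsub>W\<^esub> n = of_base f'"
    "{x \<in> X. f' x \<noteq> \<one>\<^bsub>G\<^esub>} \<subseteq> {x \<in> X. f x \<noteq> \<one>\<^bsub>G\<^esub>}" by blast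
  let ?k = "\<lambda>x\<in>X. f' x \<otimes>\<^bsub>G\<^esub> f x"
  have k: "of_base f [^]\<^bsub>W\<^esub> Suc n = of_base ?k"
    using f'(2) by (auto simp: of_base_def W_mult act_one intro!: restrict_ext)
  then have "of_base ?k \<in> carrier W" using of_base_closed[OF f] W.nat_pow_closed by metis
  then have "?k \<in> N" by (simp add: of_base_def W_carrier)
  moreover have "{x \<in> X. ?k x \<noteq> \<one>\<^bsub>G\<^esub>} \<subseteq> {x \<in> X. f x \<noteq> \<one>\<^bsub>G\<^esub>}"
    using f'(3) by auto
  ultimately show ?case using k by blast
qed

section \<open>Length functions on a wreath product\<close>

text \<open>
  A translation in a copy of \<open>G\<close> is impossible, because a conjugate copy commutes with it. Ellipticity
  makes \<open>L\<close> ultrametric, first on each copy, which bounds \<open>L\<close> there since \<open>G\<close> has no exhaustion, and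
  then on the direct sum, where the bound carries over from the copies to their products.
\<close>

lemma length_function_bounded:
  assumes L: "length_function W L"
    and H_bounded: "\<And>h. h \<in> carrier H \<Longrightarrow> L (of_top h) \<le> B"
    and orbits: "finite (orbits H X \<phi>)" and nofix: "no_fixed_points H X \<phi>"
    and Z: "\<not> has_quotient_Z G" and U: "\<not> countable_increasing_union G"
  shows "\<exists>R. \<forall>w\<in>carrier W. L w \<le> R"
proof -
  interpret L: length_function W L by fact
  interpret s: group_hom G W "single x" for x
    using single_hom by (simp add: group_hom_def group_hom_axioms_def G.is_group W.is_group)
  have B0: "0 \<le> B"
    using order_trans[OF L.L_nonneg[OF of_top_closed[OF H.one_closed]] H_bounded[OF H.one_closed]] .
  have translate: "L (single (\<phi> h x) g) \<le> L (single x g) + 2 * B"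
    if "h \<in> carrier H" "x \<in> X" "g \<in> carrier G" for h x g
  proof -
    have cl: "of_top h \<in> carrier W" "single x g \<in> carrier W" "single (\<phi> h x) g \<in> carrier W"
      using that of_top_closed single_closed by auto
    have "single (\<phi> h x) g = of_top h \<otimes>\<^bsub>W\<^esub> single x g \<otimes>\<^bsub>W\<^esub> inv\<^bsub>W\<^esub> (of_top h)"
      using cl of_top_single[OF that] by (simp add: W.m_assoc)
    then have "L (single (\<phi> h x) g) \<le> L (of_top h) + L (single x g) + L (of_top h)"
      using L.L_mult_le[of "of_top h \<otimes>\<^bsub>W\<^esub> single x g" "inv\<^bsub>W\<^esub> (of_top h)"]
        L.L_mult_le[of "of_top h" "single x g"] cl by (simp add: L.L_inv)
    then show ?thesis using H_bounded[OF that(1)] by simp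
  qed
  have elliptic: "L.elliptic (single x g)" if x: "x \<in> X" and g: "g \<in> carrier G" for x g
  proof (rule ccontr)
    assume hyp: "\<not> L.elliptic (single x g)"
    let ?b = "single x g"
    have b: "?b \<in> carrier W" using single_closed g by blast
    let ?C = "{w \<in> carrier W. w \<otimes>\<^bsub>W\<^esub> ?b = ?b \<otimes>\<^bsub>W\<^esub> w}"
    obtain \<tau> c where \<tau>: "\<And>v w. v \<in> ?C \<Longrightarrow> w \<in> ?C \<Longrightarrow> \<tau> (v \<otimes>\<^bsub>W\<^esub> w) = \<tau> v + \<tau> w"
      and c: "\<And>w. w \<in> ?C \<Longrightarrow> L w \<le> \<bar>\<tau> w\<bar> + c"
      using L.translation_length_on_centralizer[OF b hyp] by blast
    obtain h where h: "h \<in> carrier H" "\<phi> h x \<noteq> x"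
      using nofix x by (auto simp: no_fixed_points_def)
    let ?y = "\<phi> h x"
    have y: "?y \<in> X" using act_closed h x by blast
    have C: "single ?y k \<in> ?C" if "k \<in> carrier G" for k
      using that single_closed single_commute[OF h(2)] g by blast
    \<comment> \<open>The copy at \<open>?y\<close> commutes with \<open>?b\<close>, so its translation length along \<open>?b\<close> is a
      homomorphism to the reals.\<close>
    have "\<tau> (single ?y (k \<otimes>\<^bsub>G\<^esub> l)) = \<tau> (single ?y k) + \<tau> (single ?y l)"
      if "k \<in> carrier G" "l \<in> carrier G" for k l
      using \<tau>[OF C C] s.hom_mult that by simp
    then have "\<tau> (single ?y k) = 0" if "k \<in> carrier G" for k
      using G.real_hom_trivial[OF Z U, where \<tau> = "\<lambda>k. \<tau> (single ?y k)"] that by blast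
    then have "L (single ?y k) \<le> c" if "k \<in> carrier G" for k
      using c[OF C[OF that]] that by simp
    moreover have "L (single x k) \<le> L (single ?y k) + 2 * B" if "k \<in> carrier G" for k
      using translate[OF H.inv_closed[OF h(1)] y that] unfolding act_inv(1)[OF h(1) x] .
    ultimately have x_bound: "L (single x k) \<le> c + 2 * B" if "k \<in> carrier G" for k
      using that by fastforce
    have "L (?b [^]\<^bsub>W\<^esub> n) \<le> c + 2 * B" for n :: nat
      using x_bound[of "g [^]\<^bsub>G\<^esub> n"] s.hom_nat_pow[OF g, of x n] g by simp
    then show False using L.elliptic_if_bounded_powers[OF b] hyp by blast
  qed
  have "\<exists>R. \<forall>g\<in>carrier G. L (single x g) \<le> R" if x: "x \<in> X" for x
  proof -
    define K where "K n = {g \<in> carrier G. L (single x g) \<le> real n}" for n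
    have "subgroup (K n) G" for n
    proof (rule G.subgroupI)
      have "\<one>\<^bsub>G\<^esub> \<in> K n" using L.L_one by (simp add: K_def)
      then show "K n \<noteq> {}" by blast
      show "inv\<^bsub>G\<^esub> g \<in> K n" if "g \<in> K n" for g
        using that L.L_inv[OF single_closed] by (simp add: K_def)
      show "g \<otimes>\<^bsub>G\<^esub> k \<in> K n" if gk: "g \<in> K n" "k \<in> K n" for g k
      proof -
        have cl: "g \<in> carrier G" "k \<in> carrier G" using gk by (auto simp: K_def)
        have "L.elliptic (single x g \<otimes>\<^bsub>W\<^esub> single x k)"
          using elliptic[OF x G.m_closed[OF cl]] s.hom_mult[OF cl] by simp
        then have "L (single x g \<otimes>\<^bsub>W\<^esub> single x k) \<le> max (L (single x g)) (L (single x k))"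
          by (intro L.L_mult_le_max single_closed cl elliptic x)
        then have "L (single x g \<otimes>\<^bsub>W\<^esub> single x k) \<le> real n"
          using gk by (auto simp: K_def max_def split: if_splits)
        then show ?thesis using cl s.hom_mult[OF cl] by (simp add: K_def)
      qed
    qed (auto simp: K_def)
    moreover have "K n \<subseteq> K (Suc n)" for n by (auto simp: K_def)
    moreover have "carrier G = (\<Union>n. K n)" by (auto simp: K_def real_arch_simple)
    ultimately have "\<exists>n. K n = carrier G"
      using U unfolding countable_increasing_union_def by blast
    then show ?thesis by (auto simp: K_def)
  qed
  then obtain R where R: "\<And>x g. x \<in> X \<Longrightarrow> g \<in> carrier G \<Longrightarrow> L (single x g) \<le> R x" by metis
  \<comment> \<open>One representative of each orbit; the other copies are conjugate to these by elements of
    \<open>H\<close>, which costs at most \<open>2 * B\<close>.\<close>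
  define Y where "Y = (\<lambda>C. SOME x. x \<in> C) ` orbits H X \<phi>"
  have Y: "\<exists>y\<in>Y. y \<in> X \<and> (\<exists>h\<in>carrier H. x = \<phi> h y)" if x: "x \<in> X" for x
  proof -
    let ?y = "SOME y. y \<in> orbit H \<phi> x"
    have y: "?y \<in> orbit H \<phi> x" using A.orbit_refl[OF x] by (rule someI)
    have "?y \<in> X" using y x act_closed by (auto simp: orbit_def)
    moreover have "x \<in> orbit H \<phi> ?y" using A.orbit_sym[OF x calculation y] .
    moreover have "?y \<in> Y" using x by (auto simp: Y_def orbits_def)
    ultimately show ?thesis by (auto simp: orbit_def)
  qed
  have "finite (R ` Y)" using orbits by (simp add: Y_def)
  then obtain R0 where R0: "\<And>y. y \<in> Y \<Longrightarrow> R y \<le> R0"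
    using bdd_above_finite[of "R ` Y"] by (auto simp: bdd_above_def)
  define S where "S = max 0 (R0 + 2 * B)"
  have S0: "0 \<le> S" by (simp add: S_def)
  have S: "L (single x g) \<le> S" if x: "x \<in> X" and g: "g \<in> carrier G" for x g
  proof -
    obtain y h where y: "y \<in> Y" "y \<in> X" "h \<in> carrier H" "x = \<phi> h y" using Y[OF x] by blast
    have "L (single x g) \<le> R y + 2 * B"
      using translate[OF y(3,2) g] R[OF y(2) g] y(4) by simp
    then show ?thesis using R0[OF y(1)] by (simp add: S_def)
  qed
  \<comment> \<open>This bound depends on the support and only serves to see that powers stay bounded.\<close>
  have card: "L (of_base f) \<le> S * card F"
    if "finite F" "f \<in> N" "{x \<in> X. f x \<noteq> \<one>\<^bsub>G\<^esub>} \<subseteq> F" "F \<subseteq> X" for f F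
    using that
  proof (induction F arbitrary: f rule: finite_induct)
    case empty
    then have "of_base f = \<one>\<^bsub>W\<^esub>" by (auto simp: of_base_def W_one N_iff PiE_iff extensional_def fun_eq_iff)
    then show ?case by (simp add: L.L_one)
  next
    case (insert x F)
    have x: "x \<in> X" using insert by blast
    note split = of_base_split[OF insert.prems(1) x]
    have "L (of_base (f(x := \<one>\<^bsub>G\<^esub>))) \<le> S * card F"
      using insert.prems by (intro insert.IH split(1)) auto
    moreover have "L (of_base f) \<le> L (single x (f x)) + L (of_base (f(x := \<one>\<^bsub>G\<^esub>)))"
        unfolding split(2)
      by (rule L.L_mult_le) (use split(1) insert.prems x N_closed in \<open>auto intro: single_closed of_base_closed\<close>)
    moreover have "L (single x (f x)) \<le> S" using S x N_closed insert.prems by blast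
    ultimately show ?case using insert.hyps by (simp add: algebra_simps)
  qed
  have ell_base: "L.elliptic (of_base f)" if f: "f \<in> N" for f
  proof (rule L.elliptic_if_bounded_powers[OF of_base_closed[OF f]])
    fix n :: nat
    let ?F = "{x \<in> X. f x \<noteq> \<one>\<^bsub>G\<^esub>}"
    obtain f' where "f' \<in> N" "of_base f [^]\<^bsub>W\<^esub> n = of_base f'" "{x \<in> X. f' x \<noteq> \<one>\<^bsub>G\<^esub>} \<subseteq> ?F"
      using of_base_pow[OF f] by blast
    moreover have "finite ?F" using f by (simp add: N_iff)
    ultimately show "L (of_base f [^]\<^bsub>W\<^esub> n) \<le> S * card ?F" using card by simp
  qed
  have bound: "L (of_base f) \<le> S"
    if "finite F" "f \<in> N" "{x \<in> X. f x \<noteq> \<one>\<^bsub>G\<^esub>} \<subseteq> F" "F \<subseteq> X" for f F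
    using that
  proof (induction F arbitrary: f rule: finite_induct)
    case empty
    then show ?case using card[of "{}" f] S0 by simp
  next
    case (insert x F)
    have x: "x \<in> X" using insert by blast
    note split = of_base_split[OF insert.prems(1) x]
    have fx: "f x \<in> carrier G" using N_closed insert.prems x by blast
    have "L (of_base (f(x := \<one>\<^bsub>G\<^esub>))) \<le> S"
      using insert.prems by (intro insert.IH split(1)) auto
    moreover have "L (of_base f) \<le> max (L (single x (f x))) (L (of_base (f(x := \<one>\<^bsub>G\<^esub>))))"
      using L.L_mult_le_max[OF single_closed[OF fx] of_base_closed[OF split(1)] elliptic[OF x fx]
          ell_base[OF split(1)]] ell_base[OF insert.prems(1)] split(2) by simp
    moreover have "L (single x (f x)) \<le> S" using S x fx by blast
    ultimately show ?case by simp
  qed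
  have "L w \<le> S + B" if "w \<in> carrier W" for w
  proof -
    obtain f h where w: "w = (f, h)" "f \<in> N" "h \<in> carrier H"
      using \<open>w \<in> carrier W\<close> by (auto simp: W_carrier)
    have "L w \<le> L (of_base f) + L (of_top h)"
      using L.L_mult_le[OF of_base_closed[OF w(2)] of_top_closed[OF w(3)]] of_base_top[OF w(2,3)] w(1) by simp
    moreover have "L (of_base f) \<le> S"
      using w(2) by (intro bound[of "{x \<in> X. f x \<noteq> \<one>\<^bsub>G\<^esub>}"]) (auto simp: N_iff)
    ultimately show ?thesis using H_bounded[OF w(3)] by simp
  qed
  then show ?thesis by blast
qed

end

section \<open>Bounded actions of a wreath product\<close>

context wreath
begin

text \<open>
  Trees enter only through the four point inequality, so that this one statement covers graphs and
  real trees.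
\<close>

lemma mbounded_orbit_if_H_bounded:
  assumes M: "Metric_space M d" and fp: "four_point_metric M d"
    and iso: "isometric_action W M d \<psi>" and b: "b \<in> M"
    and H_bounded: "Metric_space.mbounded M d (orbit H (\<lambda>h. \<psi> (of_top h)) b)"
    and orbits: "finite (orbits H X \<phi>)" and nofix: "no_fixed_points H X \<phi>"
    and Z: "\<not> has_quotient_Z G" and U: "\<not> countable_increasing_union G"
  shows "Metric_space.mbounded M d (orbit W \<psi> b)"
proof -
  interpret P: pointed_isometric_action M d W \<psi> b
    using M iso b by (simp add: pointed_isometric_action_def pointed_isometric_action_axioms_def)
  have "isometric_action H M d (\<lambda>h. \<psi> (of_top h))"
    using iso group_action_pullback[OF P.A.group_action_axioms H.is_group of_top_hom] of_top_closed
    by (simp add: isometric_action_def)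
  then interpret Q: pointed_isometric_action M d H "\<lambda>h. \<psi> (of_top h)" b
    using M b by (simp add: pointed_isometric_action_def pointed_isometric_action_axioms_def)
  obtain B where "\<And>h. h \<in> carrier H \<Longrightarrow> Q.displacement h \<le> B"
    using H_bounded Q.mbounded_orbit_iff by blast
  then have B: "P.displacement (of_top h) \<le> B" if "h \<in> carrier H" for h
    using that by (simp add: P.displacement_def Q.displacement_def)
  show ?thesis
    unfolding P.mbounded_orbit_iff
    using length_function_bounded[OF P.length_function_displacement[OF fp] B orbits nofix Z U] .
qed

lemma property_FA_if:
  assumes FA: "property_FA H"
    and orbits: "finite (orbits H X \<phi>)" and nofix: "no_fixed_points H X \<phi>"
    and Z: "\<not> has_quotient_Z G" and U: "\<not> countable_increasing_union G"
  shows "property_FA W"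
  unfolding property_FA_def
proof (intro allI impI ballI)
  fix V :: "((('x \<Rightarrow> 'g) \<times> 'h) \<times> (('x \<Rightarrow> 'g) \<times> 'h) \<times> nat) set" and E \<psi> v
  assume "graph_tree V E \<and> graph_action W V E \<psi>" and v: "v \<in> V"
  then have tree: "graph_tree V E" and act: "graph_action W V E \<psi>" by auto
  have "graph_action H V E (\<lambda>h. \<psi> (of_top h))"
    using act group_action_pullback[OF _ H.is_group of_top_hom, of V \<psi>] of_top_closed
    by (simp add: graph_action_def)
  from property_FA_all_types[OF FA tree this v]
  show "Metric_space.mbounded V (\<lambda>x y. real (graph_dist E x y)) (orbit W \<psi> v)"
    by (rule mbounded_orbit_if_H_bounded[OF Metric_space_graph_dist[OF tree]
          graph_tree_four_point[OF tree] graph_action_isometric[OF tree act] v _ orbits nofix Z U])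
qed

lemma property_FR_if:
  assumes FR: "property_FR H"
    and orbits: "finite (orbits H X \<phi>)" and nofix: "no_fixed_points H X \<phi>"
    and Z: "\<not> has_quotient_Z G" and U: "\<not> countable_increasing_union G"
  shows "property_FR W"
  unfolding property_FR_def
proof (intro allI impI ballI)
  fix T :: "((('x \<Rightarrow> 'g) \<times> 'h) \<times> (('x \<Rightarrow> 'g) \<times> 'h) \<times> real) set" and d \<psi> v
  assume "real_tree T d \<and> isometric_action W T d \<psi>" and v: "v \<in> T"
  then have tree: "real_tree T d" and act: "isometric_action W T d \<psi>" by auto
  have M: "Metric_space T d" using tree by (simp add: real_tree_def)
  have "isometric_action H T d (\<lambda>h. \<psi> (of_top h))"
    using act group_action_pullback[OF _ H.is_group of_top_hom, of T \<psi>] of_top_closed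
    by (simp add: isometric_action_def)
  from property_FR_all_types[OF FR tree this v]
  show "Metric_space.mbounded T d (orbit W \<psi> v)"
    by (rule mbounded_orbit_if_H_bounded[OF M real_tree_four_point[OF tree] act v _ orbits nofix Z U])
qed

end

section \<open>A criterion for real trees\<close>

context Metric_space
begin

lemma pathin_metric_continuity:
  assumes \<gamma>: "pathin mtopology \<gamma>" and s: "s \<in> {0..1}" and \<epsilon>: "0 < \<epsilon>"
  shows "\<exists>\<delta>>0. \<forall>t\<in>{0..1}. dist t s < \<delta> \<longrightarrow> d (\<gamma> s) (\<gamma> t) < \<epsilon>"
proof -
  have "\<exists>U. openin (subtopology euclideanreal {0..1}) U \<and> s \<in> U \<and> (\<forall>t\<in>U. \<gamma> t \<in> mball (\<gamma> s) \<epsilon>)"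
    using \<gamma> s \<epsilon> by (simp add: pathin_def continuous_map_to_metric)
  then obtain U where "openin (subtopology euclideanreal {0..1}) U" "s \<in> U"
    and U: "\<And>t. t \<in> U \<Longrightarrow> \<gamma> t \<in> mball (\<gamma> s) \<epsilon>" by blast
  then obtain \<delta> where "\<delta> > 0" "\<And>t. t \<in> {0..1} \<Longrightarrow> dist t s < \<delta> \<Longrightarrow> t \<in> U"
    unfolding openin_euclidean_subtopology_iff by blast
  then show ?thesis using U by (intro exI[of _ \<delta>]) auto
qed

text \<open>
  Away from \<open>p\<close>, positivity of the Gromov product with base point \<open>p\<close> is an equivalence relation with
  open classes. The points \<open>\<gamma> a\<close> and \<open>\<gamma> b\<close> lie in different classes, so no path that avoids \<open>p\<close>
  joins them.
\<close>

lemma path_through_between_point: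
  assumes fp: "four_point_metric M d" and \<gamma>: "pathin mtopology \<gamma>"
    and ab: "0 \<le> a" "a \<le> b" "b \<le> 1"
    and p: "p \<in> M" "d (\<gamma> a) p + d p (\<gamma> b) = d (\<gamma> a) (\<gamma> b)"
  shows "\<exists>t\<in>{a..b}. \<gamma> t = p"
proof (rule ccontr)
  assume "\<not> ?thesis"
  then have avoid: "\<gamma> t \<noteq> p" if "t \<in> {a..b}" for t using that by blast
  have \<gamma>M: "\<gamma> t \<in> M" if "t \<in> {a..b}" for t
    using \<gamma> that ab by (auto simp: pathin_def continuous_map_def Pi_iff)
  let ?u = "\<gamma> a"
  define P where "P t \<longleftrightarrow> d (\<gamma> t) ?u < d (\<gamma> t) p + d ?u p" for t
  have uM: "?u \<in> M" using \<gamma>M ab by simp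
  have trans: "P t" if st: "s \<in> {a..b}" "t \<in> {a..b}" and "P s"
    and near: "d (\<gamma> s) (\<gamma> t) < d (\<gamma> s) p + d (\<gamma> t) p" for s t
  proof -
    have "d (\<gamma> t) ?u + d p (\<gamma> s) \<le> max (d (\<gamma> t) p + d ?u (\<gamma> s)) (d (\<gamma> t) (\<gamma> s) + d ?u p)"
      using fp \<gamma>M[OF st(1)] \<gamma>M[OF st(2)] uM p(1) unfolding four_point_metric_def by blast
    then show ?thesis
      using \<open>P s\<close> near commute[of p "\<gamma> s"] commute[of ?u "\<gamma> s"] commute[of "\<gamma> t" "\<gamma> s"]
      unfolding P_def by linarith
  qed
  have "P a = P b"
  proof (rule connected_local_const[of "{a..b}"])
    show "\<forall>s\<in>{a..b}. \<forall>\<^sub>F t in at s within {a..b}. P s = P t"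
    proof
      fix s assume s: "s \<in> {a..b}"
      have "0 < d (\<gamma> s) p" using avoid[OF s] \<gamma>M[OF s] p(1) by simp
      then obtain \<delta> where \<delta>: "\<delta> > 0" "\<And>t. t \<in> {0..1} \<Longrightarrow> dist t s < \<delta> \<Longrightarrow> d (\<gamma> s) (\<gamma> t) < d (\<gamma> s) p"
        using pathin_metric_continuity[OF \<gamma> _ \<open>0 < d (\<gamma> s) p\<close>, of s] s ab by force
      have "P s = P t" if t: "t \<in> {a..b}" "dist t s < \<delta>" for t
      proof -
        have "d (\<gamma> s) (\<gamma> t) < d (\<gamma> s) p" using \<delta>(2) t ab by simp
        then have "d (\<gamma> s) (\<gamma> t) < d (\<gamma> s) p + d (\<gamma> t) p" using nonneg[of "\<gamma> t" p] by linarith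
        then show ?thesis
          using trans[OF s t(1)] trans[OF t(1) s] commute[of "\<gamma> s" "\<gamma> t"] by linarith
      qed
      then show "\<forall>\<^sub>F t in at s within {a..b}. P s = P t"
        unfolding eventually_at using \<delta>(1) by blast
    qed
  qed (use ab in auto)
  moreover have "P a" using avoid[of a] uM p(1) ab by (simp add: P_def)
  moreover have "\<not> P b"
    using p(2) commute[of p "\<gamma> b"] commute[of "\<gamma> a" "\<gamma> b"] by (simp add: P_def)
  ultimately show False by simp
qed

text \<open>
  The four point inequality makes any choice of points at distance \<open>t\<close> from \<open>x\<close> and \<open>d x y - t\<close> from
  \<open>y\<close> a geodesic. An arc contains this geodesic by \<open>path_through_between_point\<close>. It cannot leave it either: the
  projection of a point \<open>q\<close> of the arc to the geodesic lies between \<open>q\<close> and each of the end points, so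
  the arc would visit it both before and after \<open>q\<close>.
\<close>

lemma real_tree_if_four_point:
  assumes ne: "M \<noteq> {}" and fp: "four_point_metric M d"
    and between: "\<And>x y t. x \<in> M \<Longrightarrow> y \<in> M \<Longrightarrow> 0 \<le> t \<Longrightarrow> t \<le> d x y \<Longrightarrow>
      \<exists>p\<in>M. d x p = t \<and> d p y = d x y - t"
  shows "real_tree M d"
  unfolding real_tree_def
proof (intro conjI ballI)
  fix x y assume xy: "x \<in> M" "y \<in> M"
  define D where "D = d x y"
  have D: "0 \<le> D" by (simp add: D_def)
  have "\<forall>t\<in>{0..D}. \<exists>p. p \<in> M \<and> d x p = t \<and> d p y = D - t"
  proof
    fix t assume "t \<in> {0..D}"
    then show "\<exists>p. p \<in> M \<and> d x p = t \<and> d p y = D - t"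
      using between[OF xy, of t] by (auto simp: D_def)
  qed
  then obtain c where c: "\<And>t. t \<in> {0..D} \<Longrightarrow> c t \<in> M \<and> d x (c t) = t \<and> d (c t) y = D - t"
    by metis
  have iso: "d (c s) (c t) = \<bar>s - t\<bar>" if st: "s \<in> {0..D}" "t \<in> {0..D}" for s t
  proof -
    have "d (c s) (c t) + d x y \<le> max (d (c s) x + d (c t) y) (d (c s) y + d (c t) x)"
      using fp c[OF st(1)] c[OF st(2)] xy unfolding four_point_metric_def by blast
    moreover have "d x (c t) \<le> d x (c s) + d (c s) (c t)" "d x (c s) \<le> d x (c t) + d (c t) (c s)"
      using triangle c[OF st(1)] c[OF st(2)] xy(1) by blast+
    ultimately show ?thesis
      using c[OF st(1)] c[OF st(2)] commute[of x "c s"] commute[of x "c t"] commute[of "c s" "c t"]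
      unfolding D_def by linarith
  qed
  have ends: "c 0 = x" "c D = y"
    using c[of 0] c[of D] D xy by auto
  let ?S = "c ` {0..D}"
  show "\<exists>S. geodesic_segment M d x y S \<and>
      (\<forall>\<gamma>. pathin mtopology \<gamma> \<and> inj_on \<gamma> {0..1} \<and> \<gamma> 0 = x \<and> \<gamma> 1 = y \<longrightarrow> \<gamma> ` {0..1} = S)"
  proof (intro exI[of _ ?S] conjI allI impI)
    show "geodesic_segment M d x y ?S"
      unfolding geodesic_segment_def D_def[symmetric]
      using c iso ends by (intro exI[of _ c]) auto
    fix \<gamma> assume "pathin mtopology \<gamma> \<and> inj_on \<gamma> {0..1} \<and> \<gamma> 0 = x \<and> \<gamma> 1 = y"
    then have \<gamma>: "pathin mtopology \<gamma>" "inj_on \<gamma> {0..1}" "\<gamma> 0 = x" "\<gamma> 1 = y" by auto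
    have \<gamma>M: "\<gamma> t \<in> M" if "t \<in> {0..1}" for t
      using \<gamma>(1) that by (auto simp: pathin_def continuous_map_def Pi_iff)
    show "\<gamma> ` {0..1} = ?S"
    proof
      show "?S \<subseteq> \<gamma> ` {0..1}"
      proof (rule image_subsetI)
        fix t assume "t \<in> {0..D}"
        then have "\<exists>s\<in>{0..1}. \<gamma> s = c t"
          using c[of t] by (intro path_through_between_point[OF fp \<gamma>(1)]) (auto simp: \<gamma> D_def)
        then show "c t \<in> \<gamma> ` {0..1}" by force
      qed
      show "\<gamma> ` {0..1} \<subseteq> ?S"
      proof (rule image_subsetI)
        fix t :: real assume t: "t \<in> {0..1}"
        let ?q = "\<gamma> t"
        have q: "?q \<in> M" using \<gamma>M t by simp
        \<comment> \<open>The Gromov product of \<open>?q\<close> and \<open>y\<close> at \<open>x\<close>: the projection of \<open>?q\<close> is at this distance from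
          \<open>x\<close>.\<close>
        define r where "r = (d x ?q + D - d ?q y) / 2"
        have r: "r \<in> {0..D}"
          using triangle[of x ?q y] triangle[of ?q x y] triangle[of x y ?q] q xy
            commute[of ?q x] commute[of y ?q]
          by (auto simp: r_def D_def)
        let ?p = "c r"
        have p: "?p \<in> M" "d x ?p = r" "d ?p y = D - r" using c[OF r] by auto
        have "d ?q ?p + d x y \<le> max (d ?q x + d ?p y) (d ?q y + d ?p x)"
          using fp q p(1) xy unfolding four_point_metric_def by blast
        moreover have "2 * r = d x ?q + D - d ?q y" by (simp add: r_def)
        ultimately have le: "d ?q ?p \<le> d x ?q - r" "d ?q ?p \<le> d ?q y - (D - r)"
          using p commute[of ?q x] commute[of ?p x] by (auto simp: D_def max_def split: if_splits)
        have "d x ?p + d ?p ?q = d x ?q" "d ?q ?p + d ?p y = d ?q y"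
          using le p triangle[of x ?p ?q] triangle[of ?q ?p y] q xy commute[of ?p ?q] by auto
        then obtain t1 t2 where "t1 \<in> {0..t}" "\<gamma> t1 = ?p" "t2 \<in> {t..1}" "\<gamma> t2 = ?p"
          using path_through_between_point[OF fp \<gamma>(1), of 0 t ?p]
            path_through_between_point[OF fp \<gamma>(1), of t 1 ?p] t p(1) \<gamma>(3,4) by auto
        then have "t1 = t2" "t1 \<le> t" "t \<le> t2" using inj_onD[OF \<gamma>(2), of t1 t2] t by auto
        then have "?q = ?p" using \<open>\<gamma> t1 = ?p\<close> by simp
        then show "?q \<in> ?S" using r by simp
      qed
    qed
  qed
qed (use ne Metric_space_axioms in auto)

end

text \<open>
  A tree that grows towards a fixed end: \<open>ht\<close> is the height in the direction of this end, \<open>J a b\<close> the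
  height at which the rays from \<open>a\<close> and \<open>b\<close> to the end meet, and a geodesic climbs to the meeting
  point and then descends. The value 0 off \<open>T\<close> is there because a metric is nonnegative and symmetric
  on the whole type.
\<close>

lemma real_tree_of_ultrametric_join:
  fixes ht :: "'m \<Rightarrow> real" and J :: "'m \<Rightarrow> 'm \<Rightarrow> real"
  assumes ne: "T \<noteq> {}"
    and sym: "\<And>a b. a \<in> T \<Longrightarrow> b \<in> T \<Longrightarrow> J a b = J b a"
    and above: "\<And>a b. a \<in> T \<Longrightarrow> b \<in> T \<Longrightarrow> ht a \<le> J a b"
    and refl: "\<And>a. a \<in> T \<Longrightarrow> J a a = ht a"
    and eq: "\<And>a b. a \<in> T \<Longrightarrow> b \<in> T \<Longrightarrow> J a b = ht a \<Longrightarrow> ht a = ht b \<Longrightarrow> a = b"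
    and ultra: "\<And>a b c. a \<in> T \<Longrightarrow> b \<in> T \<Longrightarrow> c \<in> T \<Longrightarrow> J a c \<le> max (J a b) (J b c)"
    and up: "\<And>a t. a \<in> T \<Longrightarrow> ht a \<le> t \<Longrightarrow> \<exists>p\<in>T. ht p = t \<and> J a p = t"
  shows "real_tree T (\<lambda>a b. if a \<in> T \<and> b \<in> T then 2 * J a b - ht a - ht b else 0)"
proof -
  define d where "d a b = (if a \<in> T \<and> b \<in> T then 2 * J a b - ht a - ht b else 0)" for a b
  have above': "ht b \<le> J a b" if "a \<in> T" "b \<in> T" for a b using that sym above by metis
  interpret Metric_space T d
  proof
    show "0 \<le> d a b" for a b using above[of a b] above'[of a b]
      by (cases "a \<in> T \<and> b \<in> T") (force simp: d_def)+
    show "d a b = d b a" for a b using sym[of a b] by (simp add: d_def)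
    show "d a b = 0 \<longleftrightarrow> a = b" if "a \<in> T" "b \<in> T" for a b
      using above[OF that] above'[OF that] eq[OF that] refl that by (auto simp: d_def)
    show "d a c \<le> d a b + d b c" if "a \<in> T" "b \<in> T" "c \<in> T" for a b c
      using ultra[OF that] above'[of a b] above[of b c] that by (auto simp: d_def max_def split: if_splits)
  qed
  have fp: "four_point_metric T d"
    unfolding four_point_metric_def
  proof (intro ballI)
    fix x y z w assume T: "x \<in> T" "y \<in> T" "z \<in> T" "w \<in> T"
    have "J x y \<le> max (J x z) (J y z)" "J x y \<le> max (J x w) (J y w)"
      "J z w \<le> max (J x z) (J x w)" "J z w \<le> max (J y z) (J y w)"
      using ultra T sym by metis+
    then have "J x y + J z w \<le> max (J x z + J y w) (J x w + J y z)" by linarith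
    then show "d x y + d z w \<le> max (d x z + d y w) (d x w + d y z)"
      using T by (auto simp: d_def max_def split: if_splits)
  qed
  have climb: "\<exists>p\<in>T. d x p = t \<and> d p y = d x y - t"
    if xy: "x \<in> T" "y \<in> T" and t: "0 \<le> t" "ht x + t \<le> J x y" for x y t
  proof -
    obtain p where p: "p \<in> T" "ht p = ht x + t" "J x p = ht x + t"
      using up[of x "ht x + t"] xy t by auto
    have "J p y = J x y"
      using ultra[of x p y] ultra[of p x y] above[of p y] sym[of p x] p t xy by (auto simp: max_def split: if_splits)
    then show ?thesis using p xy by (intro bexI[of _ p]) (auto simp: d_def)
  qed
  have "real_tree T d"
  proof (rule real_tree_if_four_point[OF ne fp])
    fix x y t assume xy: "x \<in> T" "y \<in> T" and t: "0 \<le> t" "t \<le> d x y"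
    show "\<exists>p\<in>T. d x p = t \<and> d p y = d x y - t"
    proof (cases "ht x + t \<le> J x y")
      case True
      then show ?thesis using climb xy t by blast
    next
      case False
      have "ht y + (d x y - t) \<le> J y x" using False xy sym[of x y] by (simp add: d_def)
      then obtain p where "p \<in> T" "d y p = d x y - t" "d p x = d y x - (d x y - t)"
        using climb[of y x "d x y - t"] xy t by auto
      then show ?thesis using commute by (intro bexI[of _ p]) auto
    qed
  qed
  moreover have "d = (\<lambda>a b. if a \<in> T \<and> b \<in> T then 2 * J a b - ht a - ht b else 0)"
    by (simp add: d_def fun_eq_iff)
  ultimately show ?thesis by simp
qed

section \<open>Trees with an end fixed by the group\<close>

lemma group_action_restrictI:
  assumes G: "group G"
    and closed: "\<And>g v. g \<in> carrier G \<Longrightarrow> v \<in> V \<Longrightarrow> a g v \<in> V"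
    and one: "\<And>v. v \<in> V \<Longrightarrow> a \<one>\<^bsub>G\<^esub> v = v"
    and mult: "\<And>g h v. g \<in> carrier G \<Longrightarrow> h \<in> carrier G \<Longrightarrow> v \<in> V \<Longrightarrow> a (g \<otimes>\<^bsub>G\<^esub> h) v = a g (a h v)"
  shows "group_action G V (\<lambda>g. restrict (a g) V)"
proof -
  interpret group G by fact
  have inv: "a (inv\<^bsub>G\<^esub> g) (a g v) = v" "a g (a (inv\<^bsub>G\<^esub> g) v) = v"
    if "g \<in> carrier G" "v \<in> V" for g v
    using that by (simp_all add: mult[symmetric] one)
  have bij: "restrict (a g) V \<in> Bij V" if g: "g \<in> carrier G" for g
  proof -
    have "bij_betw (restrict (a g) V) V V"
      by (rule bij_betw_byWitness[where f' = "a (inv\<^bsub>G\<^esub> g)"]) (use inv[OF g] closed g in auto)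
    then show ?thesis by (simp add: Bij_def)
  qed
  have "(\<lambda>g. restrict (a g) V) \<in> hom G (BijGroup V)"
    using bij closed mult by (intro homI) (auto simp: BijGroup_def compose_def fun_eq_iff)
  then show ?thesis
    by (simp add: group_action_def group_hom_def group_hom_axioms_def group_BijGroup G)
qed

text \<open>
  A discrete tree with a distinguished end: the parent of a vertex is its neighbour in the direction
  of the end, the height increases by one with each parent, and any two ancestral lines merge.
\<close>

locale parent_tree =
  fixes V :: "'v set" and par :: "'v \<Rightarrow> 'v" and ht :: "'v \<Rightarrow> int"
  assumes par_closed: "v \<in> V \<Longrightarrow> par v \<in> V"
    and ht_par: "v \<in> V \<Longrightarrow> ht (par v) = ht v + 1"
    and confluent: "u \<in> V \<Longrightarrow> v \<in> V \<Longrightarrow> \<exists>i j. (par ^^ i) u = (par ^^ j) v"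
begin

lemma iterate: "v \<in> V \<Longrightarrow> (par ^^ i) v \<in> V \<and> ht ((par ^^ i) v) = ht v + int i"
  by (induction i) (auto simp: par_closed ht_par)

definition edges :: "'v rel"
  where "edges = {(u, v). u \<in> V \<and> v \<in> V \<and> (v = par u \<or> u = par v)}"

lemma edges_sym: "sym edges"
  by (auto simp: edges_def sym_def)

lemma edges_up: "v \<in> V \<Longrightarrow> (v, (par ^^ i) v) \<in> edges\<^sup>*"
proof (induction i)
  case (Suc i)
  have "((par ^^ i) v, (par ^^ Suc i) v) \<in> edges"
    using iterate[OF Suc.prems, of i] by (auto simp: edges_def par_closed)
  then show ?case using Suc by (meson rtrancl.rtrancl_into_rtrancl)
qed auto

text \<open>
  On a cycle, the two neighbours of a lowest vertex are distinct, but both would have to be its parent.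
\<close>

lemma no_cycle: "\<not> graph_cycle edges p"
proof
  assume p: "graph_cycle edges p"
  let ?n = "length p"
  have n: "3 \<le> ?n" "distinct p" and E: "\<And>i. i < ?n \<Longrightarrow> (p ! i, p ! (Suc i mod ?n)) \<in> edges"
    using p by (auto simp: graph_cycle_def)
  obtain i where i: "i < ?n" and min: "\<And>j. j < ?n \<Longrightarrow> ht (p ! i) \<le> ht (p ! j)"
  proof -
    let ?S = "(\<lambda>i. ht (p ! i)) ` {..<?n}"
    have "Min ?S \<in> ?S" using n(1) by (intro Min_in) (auto simp: lessThan_empty_iff)
    then obtain i where "i < ?n" "Min ?S = ht (p ! i)" by auto
    moreover have "Min ?S \<le> ht (p ! j)" if "j < ?n" for j using that by (intro Min_le) auto
    ultimately show ?thesis using that by metis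
  qed
  define j where "j = (if i = 0 then ?n - 1 else i - 1)"
  define k where "k = Suc i mod ?n"
  have j: "j < ?n" "Suc j mod ?n = i" using i n(1) by (auto simp: j_def)
  have k: "k < ?n" using n(1) unfolding k_def by (intro mod_less_divisor) linarith
  have "j \<noteq> k" using i n(1) by (auto simp: j_def k_def mod_Suc split: if_splits)
  have up: "q = par (p ! i)" if q: "(p ! i, q) \<in> edges" "ht (p ! i) \<le> ht q" for q
  proof -
    have "p ! i \<in> V" "q \<in> V" "q = par (p ! i) \<or> p ! i = par q" using q(1) by (auto simp: edges_def)
    then show ?thesis using q(2) ht_par[of q] by auto
  qed
  have "p ! k = par (p ! i)" using up E[OF i] min[OF k] by (simp add: k_def)
  moreover have "p ! j = par (p ! i)"
    using up E[OF j(1)] min[OF j(1)] edges_sym by (simp add: j(2) symD)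
  ultimately show False using \<open>j \<noteq> k\<close> j(1) k n(2) by (metis nth_eq_iff_index_eq)
qed

lemma graph_tree_edges:
  assumes "V \<noteq> {}"
  shows "graph_tree V edges"
  unfolding graph_tree_def simple_graph_def
proof (intro conjI ballI)
  show "irrefl edges" using ht_par by (force simp: irrefl_def edges_def)
  show "(u, v) \<in> edges\<^sup>*" if uv: "u \<in> V" "v \<in> V" for u v
  proof -
    obtain i j where "(par ^^ i) u = (par ^^ j) v" using confluent uv by blast
    moreover have "((par ^^ j) v, v) \<in> edges\<^sup>*"
      using edges_up[OF uv(2)] sym_rtrancl[OF edges_sym] by (meson symD)
    ultimately show ?thesis using edges_up[OF uv(1), of i] by (metis rtrancl_trans)
  qed
qed (use assms edges_sym no_cycle in \<open>auto simp: edges_def\<close>)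

lemma walk_common_ancestor:
  assumes "(u, v) \<in> edges ^^ n"
  shows "\<exists>i\<le>n. \<exists>j\<le>n. (par ^^ i) u = (par ^^ j) v"
  using assms
proof (induction n arbitrary: v)
  case (Suc n)
  then obtain v' where v': "(u, v') \<in> edges ^^ n" "(v', v) \<in> edges" by auto
  then obtain i j where ij: "i \<le> n" "j \<le> n" "(par ^^ i) u = (par ^^ j) v'" using Suc.IH by blast
  consider "v = par v'" | "v' = par v" using v'(2) by (auto simp: edges_def)
  then show ?case
  proof cases
    case 1
    have "(par ^^ Suc i) u = (par ^^ j) v"
      by (simp add: ij(3) 1 funpow_swap1)
    then show ?thesis using ij(1,2) by (intro exI[of _ "Suc i"] conjI exI[of _ j]) auto
  next
    case 2
    have "(par ^^ i) u = (par ^^ Suc j) v"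
      by (simp add: ij(3) 2 funpow_swap1)
    then show ?thesis using ij(1,2) by (intro exI[of _ i] conjI exI[of _ "Suc j"]) auto
  qed
qed auto

definition join_steps :: "'v \<Rightarrow> 'v \<Rightarrow> nat"
  where "join_steps u v = (LEAST i. \<exists>j. (par ^^ i) u = (par ^^ j) v)"

text \<open>
  The height of the lowest common ancestor.
\<close>

definition join :: "'v \<Rightarrow> 'v \<Rightarrow> int"
  where "join u v = ht u + int (join_steps u v)"

lemma join_le_iff:
  assumes uv: "u \<in> V" "v \<in> V"
  shows "join u v \<le> h \<longleftrightarrow>
    (\<exists>i j. (par ^^ i) u = (par ^^ j) v \<and> ht u + int i = h \<and> ht v + int j = h)"
proof
  assume le: "join u v \<le> h"
  have "\<exists>j. (par ^^ join_steps u v) u = (par ^^ j) v"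
    unfolding join_steps_def by (rule LeastI_ex[OF confluent[OF uv]])
  then obtain j where j: "(par ^^ join_steps u v) u = (par ^^ j) v" by blast
  define m where "m = nat (h - join u v)"
  have "(par ^^ (m + join_steps u v)) u = (par ^^ (m + j)) v"
    by (simp only: funpow_add o_def j)
  moreover have "ht u + int (m + join_steps u v) = h" using le by (simp add: m_def join_def)
  moreover have "ht v + int (m + j) = h"
    using calculation iterate[OF uv(1)] iterate[OF uv(2)] by metis
  ultimately show "\<exists>i j. (par ^^ i) u = (par ^^ j) v \<and> ht u + int i = h \<and> ht v + int j = h" by blast
next
  assume "\<exists>i j. (par ^^ i) u = (par ^^ j) v \<and> ht u + int i = h \<and> ht v + int j = h"
  then obtain i j where ij: "(par ^^ i) u = (par ^^ j) v" "ht u + int i = h" by blast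
  then have "join_steps u v \<le> i" unfolding join_steps_def by (intro Least_le) blast
  then show "join u v \<le> h" using ij(2) by (simp add: join_def)
qed

lemma join_sym: "u \<in> V \<Longrightarrow> v \<in> V \<Longrightarrow> join u v = join v u"
  by (rule order_antisym) (metis join_le_iff order_refl)+

lemma join_ge: "u \<in> V \<Longrightarrow> v \<in> V \<Longrightarrow> ht u \<le> join u v"
  by (simp add: join_def)

lemma join_iterate: "u \<in> V \<Longrightarrow> join u ((par ^^ i) u) = ht u + int i"
proof (rule order_antisym)
  assume u: "u \<in> V"
  show "join u ((par ^^ i) u) \<le> ht u + int i"
    using u iterate[OF u, of i] by (auto simp: join_le_iff intro!: exI[of _ i] exI[of _ 0])
  show "ht u + int i \<le> join u ((par ^^ i) u)"
    using u iterate[OF u, of i] join_ge[of "(par ^^ i) u" u] join_sym by simp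
qed

lemma join_ultrametric:
  assumes "u \<in> V" "v \<in> V" "w \<in> V"
  shows "join u w \<le> max (join u v) (join v w)"
proof -
  let ?h = "max (join u v) (join v w)"
  obtain i j where "(par ^^ i) u = (par ^^ j) v" "ht u + int i = ?h" "ht v + int j = ?h"
    using join_le_iff[of u v ?h] assms by auto
  moreover obtain i' j' where "(par ^^ i') v = (par ^^ j') w" "ht v + int i' = ?h" "ht w + int j' = ?h"
    using join_le_iff[of v w ?h] assms by auto
  moreover from calculation have "i' = j" by linarith
  ultimately have "(par ^^ i) u = (par ^^ j') w \<and> ht u + int i = ?h \<and> ht w + int j' = ?h" by auto
  then show ?thesis using join_le_iff[of u w ?h] assms by blast
qed

lemma join_eq_ht: "u \<in> V \<Longrightarrow> v \<in> V \<Longrightarrow> join u v \<le> ht u \<Longrightarrow> ht u = ht v \<Longrightarrow> u = v"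
proof -
  assume uv: "u \<in> V" "v \<in> V" and le: "join u v \<le> ht u" and h: "ht u = ht v"
  obtain i j where "(par ^^ i) u = (par ^^ j) v" "ht u + int i = ht u" "ht v + int j = ht u"
    using le unfolding join_le_iff[OF uv] by blast
  moreover from this have "i = 0" "j = 0" using h by auto
  ultimately show "u = v" by simp
qed

text \<open>
  The points of the real tree: \<open>(v, s)\<close> lies on the edge from \<open>v\<close> to its parent, at distance \<open>s\<close>
  from \<open>v\<close>.
\<close>

definition points :: "('v \<times> real) set"
  where "points = V \<times> {0..<1}"

definition point_ht :: "'v \<times> real \<Rightarrow> real"
  where "point_ht a = of_int (ht (fst a)) + snd a"

text \<open>
  The maximum with the heights matters when one point lies on the way from the other one to the end. For
  two points of one edge, the lowest common ancestor of the vertices is not above either point.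
\<close>

definition point_join :: "'v \<times> real \<Rightarrow> 'v \<times> real \<Rightarrow> real"
  where "point_join a b = max (of_int (join (fst a) (fst b))) (max (point_ht a) (point_ht b))"

definition point_dist :: "'v \<times> real \<Rightarrow> 'v \<times> real \<Rightarrow> real"
  where "point_dist a b = (if a \<in> points \<and> b \<in> points
    then 2 * point_join a b - point_ht a - point_ht b else 0)"

lemma real_tree_points:
  assumes "V \<noteq> {}"
  shows "real_tree points point_dist"
  unfolding point_dist_def
proof (rule real_tree_of_ultrametric_join)
  show "points \<noteq> {}" using assms by (auto simp: points_def)
  fix a b assume ab: "a \<in> points" "b \<in> points"
  show "point_join a b = point_join b a"
    using ab join_sym by (auto simp: points_def point_join_def max.commute)
  show "point_ht a \<le> point_join a b" by (simp add: point_join_def)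
  show "a = b" if "point_join a b = point_ht a" "point_ht a = point_ht b"
  proof -
    obtain u s v t where [simp]: "a = (u, s)" "b = (v, t)" by fastforce
    have uv: "u \<in> V" "v \<in> V" and st: "0 \<le> s" "s < 1" "0 \<le> t" "t < 1"
      using ab by (auto simp: points_def)
    have "ht u = \<lfloor>point_ht a\<rfloor>" "ht v = \<lfloor>point_ht b\<rfloor>"
      using st by (auto simp: point_ht_def floor_unique)
    then have h: "ht u = ht v" using that(2) by simp
    then have "s = t" using that(2) by (simp add: point_ht_def)
    have "real_of_int (join u v) < of_int (ht u + 1)"
      using that(1) st by (auto simp: point_join_def point_ht_def)
    then have "join u v \<le> ht u" by linarith
    then show ?thesis using join_eq_ht[OF uv] h \<open>s = t\<close> by simp
  qed
next
  fix a assume "a \<in> points"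
  then show "point_join a a = point_ht a"
    using join_iterate[of "fst a" 0] by (auto simp: points_def point_join_def point_ht_def)
next
  fix a b c assume "a \<in> points" "b \<in> points" "c \<in> points"
  then have "join (fst a) (fst c) \<le> max (join (fst a) (fst b)) (join (fst b) (fst c))"
    by (auto simp: points_def intro: join_ultrametric)
  then show "point_join a c \<le> max (point_join a b) (point_join b c)"
    unfolding point_join_def by linarith
next
  fix a t assume a: "a \<in> points" and t: "point_ht a \<le> t"
  define i where "i = nat (\<lfloor>t\<rfloor> - ht (fst a))"
  let ?p = "((par ^^ i) (fst a), frac t)"
  have V: "fst a \<in> V" and s: "0 \<le> snd a" using a by (auto simp: points_def)
  have "ht (fst a) \<le> \<lfloor>t\<rfloor>" using t s by (simp add: point_ht_def le_floor_iff)
  then have i: "ht (fst a) + int i = \<lfloor>t\<rfloor>" by (simp add: i_def)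
  have p: "?p \<in> points" using iterate[OF V] by (simp add: points_def frac_lt_1)
  have "point_ht ?p = t" using iterate[OF V, of i] i by (simp add: point_ht_def frac_def)
  moreover have "point_join a ?p = t"
    using join_iterate[OF V, of i] i t calculation by (simp add: point_join_def)
  ultimately show "\<exists>p\<in>points. point_ht p = t \<and> point_join a p = t" using p by blast
qed

text \<open>
  A bounded orbit in the graph or in the real tree means that the base vertex and its translates have
  common ancestors within a bounded number of generations.
\<close>

lemma bounded_ancestors:
  fixes W :: "('a, 'c) monoid_scheme"
  assumes W: "property_FA W \<or> property_FR W" and act: "group_action W V \<phi>"
    and par_equiv: "\<And>g v. g \<in> carrier W \<Longrightarrow> v \<in> V \<Longrightarrow> \<phi> g (par v) = par (\<phi> g v)"
    and ht_equiv: "\<And>g u v. g \<in> carrier W \<Longrightarrow> u \<in> V \<Longrightarrow> v \<in> V \<Longrightarrow>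
      ht (\<phi> g u) - ht (\<phi> g v) = ht u - ht v"
    and v0: "v0 \<in> V"
  shows "\<exists>n. \<forall>g\<in>carrier W. \<exists>i\<le>n. \<exists>j\<le>n. (par ^^ i) v0 = (par ^^ j) (\<phi> g v0)"
proof -
  interpret A: group_action W V \<phi> by fact
  interpret W: group W using A.group_hom group_hom.axioms(1) by blast
  have cl: "\<phi> g v \<in> V" if "g \<in> carrier W" "v \<in> V" for g v
    using that A.element_image by blast
  have one: "\<phi> \<one>\<^bsub>W\<^esub> v = v" if "v \<in> V" for v
    using A.id_eq_one that by (metis restrict_apply')
  have inj: "\<phi> g u = \<phi> g v \<longleftrightarrow> u = v" if "g \<in> carrier W" "u \<in> V" "v \<in> V" for g u v
    using A.inj_prop[OF that(1)] that by (auto dest: inj_onD)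
  have V: "V \<noteq> {}" using v0 by blast
  show ?thesis
    using W
  proof
    assume FA: "property_FA W"
    have tree: "graph_tree V edges" using graph_tree_edges[OF V] .
    have "graph_action W V edges \<phi>"
      unfolding graph_action_def
      using act cl par_equiv[symmetric] inj par_closed by (auto simp: edges_def)
    from property_FA_all_types[OF FA tree this v0]
    obtain B where B: "\<And>u v. u \<in> orbit W \<phi> v0 \<Longrightarrow> v \<in> orbit W \<phi> v0 \<Longrightarrow> real (graph_dist edges u v) \<le> B"
      unfolding Metric_space.mbounded_alt[OF Metric_space_graph_dist[OF tree]] by blast
    show ?thesis
    proof (rule exI[of _ "nat \<lfloor>B\<rfloor>"], rule ballI)
      fix g assume g: "g \<in> carrier W"
      have "v0 \<in> orbit W \<phi> v0" "\<phi> g v0 \<in> orbit W \<phi> v0"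
        using A.orbit_refl[OF v0] g by (auto simp: orbit_def)
      then have "graph_dist edges v0 (\<phi> g v0) \<le> nat \<lfloor>B\<rfloor>" using B by (meson le_nat_floor)
      moreover have "(v0, \<phi> g v0) \<in> edges ^^ graph_dist edges v0 (\<phi> g v0)"
        using tree v0 cl[OF g v0] by (intro graph_dist_walk) (simp add: graph_tree_def)
      ultimately show "\<exists>i\<le>nat \<lfloor>B\<rfloor>. \<exists>j\<le>nat \<lfloor>B\<rfloor>. (par ^^ i) v0 = (par ^^ j) (\<phi> g v0)"
        using walk_common_ancestor by (meson order_trans)
    qed
  next
    assume FR: "property_FR W"
    have tree: "real_tree points point_dist" using real_tree_points[OF V] .
    define \<psi> where "\<psi> = (\<lambda>g. restrict (\<lambda>(v, s). (\<phi> g v, s)) points)"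
    have \<psi>: "\<psi> g (v, s) = (\<phi> g v, s)" if "(v, s) \<in> points" for g v s
      using that by (simp add: \<psi>_def)
    have \<psi>_act: "group_action W points \<psi>"
      unfolding \<psi>_def
      by (rule group_action_restrictI) (auto simp: points_def cl one A.composition_rule W.is_group)
    have steps: "(par ^^ i) (\<phi> g v) = \<phi> g ((par ^^ i) v)" if "g \<in> carrier W" "v \<in> V" for g v i
      using that iterate by (induction i) (auto simp: par_equiv)
    have join_equiv: "join (\<phi> g u) (\<phi> g v) = ht (\<phi> g u) - ht u + join u v"
      if "g \<in> carrier W" "u \<in> V" "v \<in> V" for g u v
      using that iterate by (simp add: join_def join_steps_def steps inj)
    have iso: "point_dist (\<psi> g a) (\<psi> g b) = point_dist a b"
      if g: "g \<in> carrier W" and ab: "a \<in> points" "b \<in> points" for g a b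
    proof -
      obtain u s v t where [simp]: "a = (u, s)" "b = (v, t)" by fastforce
      have uv: "u \<in> V" "v \<in> V" using ab by (auto simp: points_def)
      have mem: "\<psi> g a \<in> points" "\<psi> g b \<in> points"
        using ab cl g \<psi> by (auto simp: points_def)
      define c where "c = real_of_int (ht (\<phi> g u) - ht u)"
      have ht: "point_ht (\<psi> g a) = point_ht a + c" "point_ht (\<psi> g b) = point_ht b + c"
        using \<psi> ab ht_equiv[OF g uv] by (auto simp: point_ht_def c_def)
      have "real_of_int (join (\<phi> g u) (\<phi> g v)) = of_int (join u v) + c"
        using join_equiv[OF g uv] by (simp add: c_def)
      then have "point_join (\<psi> g a) (\<psi> g b) = point_join a b + c"
        using \<psi> ab unfolding point_join_def ht by simp
      then show ?thesis using ht mem ab unfolding point_dist_def by simp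
    qed
    have "isometric_action W points point_dist \<psi>"
      unfolding isometric_action_def using \<psi>_act iso by blast
    moreover have o: "(v0, 0) \<in> points" using v0 by (simp add: points_def)
    ultimately have bdd: "Metric_space.mbounded points point_dist (orbit W \<psi> (v0, 0))"
      using property_FR_all_types[OF FR tree] by blast
    have "Metric_space points point_dist" using tree by (simp add: real_tree_def)
    from bdd[unfolded Metric_space.mbounded_alt[OF this]]
    obtain B where B: "\<And>a b. a \<in> orbit W \<psi> (v0, 0) \<Longrightarrow> b \<in> orbit W \<psi> (v0, 0) \<Longrightarrow> point_dist a b \<le> B"
      by blast
    show ?thesis
    proof (rule exI[of _ "nat \<lfloor>B\<rfloor>"], rule ballI)
      fix g assume g: "g \<in> carrier W"
      let ?v = "\<phi> g v0"
      have v: "?v \<in> V" using cl g v0 by simp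
      have "(v0, 0) \<in> orbit W \<psi> (v0, 0)" "(?v, 0) \<in> orbit W \<psi> (v0, 0)"
        using group_action.orbit_refl[OF \<psi>_act o] g \<psi>[OF o] by (force simp: orbit_def)+
      then have "point_dist (v0, 0) (?v, 0) \<le> B" using B by blast
      moreover have "(?v, 0) \<in> points" using v by (simp add: points_def)
      ultimately have le: "2 * of_int (join v0 ?v) - of_int (ht v0) - of_int (ht ?v) \<le> B"
        using o by (auto simp: point_dist_def point_join_def point_ht_def)
      obtain i j where ij: "(par ^^ i) v0 = (par ^^ j) ?v"
          "ht v0 + int i = join v0 ?v" "ht ?v + int j = join v0 ?v"
        using join_le_iff[OF v0 v, of "join v0 ?v"] by auto
      have "real i + real j = 2 * of_int (join v0 ?v) - of_int (ht v0) - of_int (ht ?v)"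
        using arg_cong[OF ij(2), of real_of_int] arg_cong[OF ij(3), of real_of_int] by simp
      then have "real i + real j \<le> B" using le by simp
      then have "i \<le> nat \<lfloor>B\<rfloor>" "j \<le> nat \<lfloor>B\<rfloor>" by (auto intro!: le_nat_floor)
      then show "\<exists>i\<le>nat \<lfloor>B\<rfloor>. \<exists>j\<le>nat \<lfloor>B\<rfloor>. (par ^^ i) v0 = (par ^^ j) ?v"
        using ij(1) by blast
    qed
  qed
qed

end

text \<open>
  The group acts through \<open>t\<close> on the line by translations, with \<open>k + 1\<close> as parent of \<open>k\<close>.
\<close>

lemma FA_or_FR_int_hom_trivial:
  assumes G: "group W" and W: "property_FA W \<or> property_FR W"
    and t: "t \<in> hom W integer_group" and g: "g \<in> carrier W"
  shows "t g = 0"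
proof -
  interpret group W by fact
  interpret t: group_hom W integer_group t
    using t by (simp add: group_hom_def group_hom_axioms_def group_axioms)
  have iter: "((\<lambda>k. k + 1) ^^ i) k = k + int i" for i and k :: int
    by (induction i) auto
  interpret parent_tree UNIV "\<lambda>k. k + 1" "\<lambda>k :: int. k"
  proof
    show "\<exists>i j. ((\<lambda>k. k + 1) ^^ i) u = ((\<lambda>k. k + 1) ^^ j) v" for u v :: int
      by (rule exI[of _ "nat (v - u)"], rule exI[of _ "nat (u - v)"]) (simp add: iter)
  qed auto
  have "group_action W UNIV (\<lambda>x. restrict (\<lambda>k. t x + k) UNIV)"
    using t.hom_mult t.hom_one by (intro group_action_restrictI) (auto simp: G)
  from bounded_ancestors[OF W this, of 0]
  obtain n where n: "\<And>x. x \<in> carrier W \<Longrightarrow> \<exists>i\<le>n. \<exists>j\<le>n. int i = t x + int j"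
    by (auto simp: iter)
  have bound: "\<bar>t x\<bar> \<le> int n" if x: "x \<in> carrier W" for x using n[OF x] by auto
  show ?thesis
  proof (rule ccontr)
    assume "t g \<noteq> 0"
    have "t (g [^]\<^bsub>W\<^esub> Suc n) = int (Suc n) * t g" using t.hom_nat_pow[OF g, of "Suc n"] by (simp add: distrib_right)
    then have "int (Suc n) * \<bar>t g\<bar> \<le> int n" using bound[of "g [^]\<^bsub>W\<^esub> Suc n"] g by (simp add: abs_mult)
    moreover have "int (Suc n) * 1 \<le> int (Suc n) * \<bar>t g\<bar>"
      using \<open>t g \<noteq> 0\<close> by (intro mult_left_mono) auto
    ultimately have "int (Suc n) \<le> int n" by (metis mult.right_neutral order_trans)
    then show False by simp
  qed
qed

text \<open>
  The group acts on the tree of all cosets \<open>g K\<^sub>n\<close>, where \<open>g K\<^sub>n\<^sub>+\<^sub>1\<close> is the parent of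
  \<open>g K\<^sub>n\<close>. As the subgroups exhaust the group, any two ancestral lines merge, and \<open>K\<^sub>0\<close> and \<open>g K\<^sub>0\<close> have a common
  ancestor at height \<open>n\<close> only if \<open>g\<close> lies in \<open>K\<^sub>n\<close>.
\<close>

lemma FA_or_FR_not_countable_union:
  assumes G: "group W" and W: "property_FA W \<or> property_FR W"
  shows "\<not> countable_increasing_union W"
proof
  interpret group W by fact
  assume "countable_increasing_union W"
  then obtain K where "(\<forall>n. subgroup (K n) W \<and> K n \<noteq> carrier W) \<and>
      (\<forall>n. K n \<subseteq> K (Suc n)) \<and> carrier W = (\<Union>n :: nat. K n)"
    unfolding countable_increasing_union_def by (elim exE)
  then have K: "\<And>n. subgroup (K n) W" "\<And>n. K n \<noteq> carrier W"
    and Suc: "\<And>n. K n \<subseteq> K (Suc n)" and all: "carrier W = (\<Union>n. K n)"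
    by blast+
  have mono: "K m \<subseteq> K n" if "m \<le> n" for m n
    using Suc that by (rule lift_Suc_mono_le)
  have Kc: "K n \<subseteq> carrier W" for n using K(1) by (rule subgroup.subset)
  define V where "V = {(g <#\<^bsub>W\<^esub> K n, n) | g n. g \<in> carrier W}"
  define par where "par = (\<lambda>(C, n). (C <#>\<^bsub>W\<^esub> K (Suc n), Suc n))"
  have "K n <#>\<^bsub>W\<^esub> K (Suc n) = K (Suc n)" for n
  proof
    show "K n <#>\<^bsub>W\<^esub> K (Suc n) \<subseteq> K (Suc n)"
      using Suc[of n] subgroup.m_closed[OF K(1)] by (auto simp: set_mult_def)
    show "K (Suc n) \<subseteq> K n <#>\<^bsub>W\<^esub> K (Suc n)"
      using subgroup.one_closed[OF K(1), of n] Kc by (force simp: set_mult_def)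
  qed
  then have par: "par (g <#\<^bsub>W\<^esub> K n, n) = (g <#\<^bsub>W\<^esub> K (Suc n), Suc n)" if "g \<in> carrier W" for g n
    using that Kc set_mult_assoc[of "{g}" "K n" "K (Suc n)"]
    by (simp add: par_def l_coset_eq_set_mult)
  have iter: "(par ^^ i) (g <#\<^bsub>W\<^esub> K n, n) = (g <#\<^bsub>W\<^esub> K (n + i), n + i)" if "g \<in> carrier W" for g n i
    by (induction i) (simp_all add: par that)
  interpret parent_tree V par "\<lambda>v. int (snd v)"
  proof
    fix u v assume "u \<in> V" "v \<in> V"
    then obtain g m h n where g: "g \<in> carrier W" "u = (g <#\<^bsub>W\<^esub> K m, m)"
      and h: "h \<in> carrier W" "v = (h <#\<^bsub>W\<^esub> K n, n)"
      by (auto simp: V_def)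
    obtain k where "inv\<^bsub>W\<^esub> g \<otimes>\<^bsub>W\<^esub> h \<in> K k" using all g h by blast
    define l where "l = m + n + k"
    have "inv\<^bsub>W\<^esub> g \<otimes>\<^bsub>W\<^esub> h \<in> K l"
      using mono[of k l] \<open>inv\<^bsub>W\<^esub> g \<otimes>\<^bsub>W\<^esub> h \<in> K k\<close> by (auto simp: l_def)
    moreover have "h = g \<otimes>\<^bsub>W\<^esub> (inv\<^bsub>W\<^esub> g \<otimes>\<^bsub>W\<^esub> h)" using g h by (simp add: m_assoc[symmetric])
    ultimately have "h \<in> g <#\<^bsub>W\<^esub> K l" unfolding l_coset_def by blast
    then have "g <#\<^bsub>W\<^esub> K l = h <#\<^bsub>W\<^esub> K l" using l_repr_independence g(1) K(1) by blast
    moreover have "m + (l - m) = l" "n + (l - n) = l" by (simp_all add: l_def)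
    ultimately have "(par ^^ (l - m)) u = (par ^^ (l - n)) v"
      using g h by (simp add: iter)
    then show "\<exists>i j. (par ^^ i) u = (par ^^ j) v" by blast
    show "par u \<in> V" using g(1) par[OF g(1), of m] unfolding g(2) V_def by blast
  qed (auto simp: par_def)
  define \<phi> where "\<phi> = (\<lambda>g. restrict (\<lambda>(C, n). (g <#\<^bsub>W\<^esub> C, n)) V)"
  have coset: "g <#\<^bsub>W\<^esub> (h <#\<^bsub>W\<^esub> K n) = (g \<otimes>\<^bsub>W\<^esub> h) <#\<^bsub>W\<^esub> K n"
    if "g \<in> carrier W" "h \<in> carrier W" for g h n
    using lcos_m_assoc that Kc by blast
  have act: "group_action W V \<phi>"
    unfolding \<phi>_def
    by (rule group_action_restrictI[OF G]) (fastforce simp: V_def coset m_assoc)+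
  have \<phi>: "\<phi> g (h <#\<^bsub>W\<^esub> K n, n) = ((g \<otimes>\<^bsub>W\<^esub> h) <#\<^bsub>W\<^esub> K n, n)"
    if "g \<in> carrier W" "h \<in> carrier W" for g h n
    using that coset by (auto simp: \<phi>_def V_def)
  have base: "(\<one>\<^bsub>W\<^esub> <#\<^bsub>W\<^esub> K 0, 0) \<in> V" by (auto simp: V_def)
  have "\<exists>n. \<forall>g\<in>carrier W. \<exists>i\<le>n. \<exists>j\<le>n.
      (par ^^ i) (\<one>\<^bsub>W\<^esub> <#\<^bsub>W\<^esub> K 0, 0) = (par ^^ j) (\<phi> g (\<one>\<^bsub>W\<^esub> <#\<^bsub>W\<^esub> K 0, 0))"
    by (rule bounded_ancestors[OF W act _ _ base]) (auto simp: V_def par \<phi>)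
  then obtain n where n: "\<And>g. g \<in> carrier W \<Longrightarrow> \<exists>i\<le>n. \<exists>j\<le>n.
      (\<one>\<^bsub>W\<^esub> <#\<^bsub>W\<^esub> K i, i) = (g <#\<^bsub>W\<^esub> K j, j)"
    by (auto simp: \<phi> iter)
  have "carrier W \<subseteq> K n"
  proof
    fix g assume g: "g \<in> carrier W"
    then obtain i where i: "i \<le> n" "\<one>\<^bsub>W\<^esub> <#\<^bsub>W\<^esub> K i = g <#\<^bsub>W\<^esub> K i" using n by blast
    have "g \<in> g <#\<^bsub>W\<^esub> K i"
      using g subgroup.one_closed[OF K(1)] unfolding l_coset_def by force
    then have "g \<in> K i" using lcos_mult_one[OF Kc] i(2) by simp
    then show "g \<in> K n" using mono i(1) by blast
  qed
  then show False using K(2) Kc by blast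
qed

section \<open>Quotients and exhaustions of a wreath product\<close>

context wreath
begin

lemma snd_hom: "snd \<in> hom W H"
  by (rule homI) (auto simp: W_carrier W_mult)

lemma orbit_snd: "orbit W (\<lambda>w. \<psi> (snd w)) v = orbit H \<psi> v"
proof -
  have "\<exists>w\<in>carrier W. snd w = h" if "h \<in> carrier H" for h
    using of_top_closed[OF that] by (intro bexI[of _ "of_top h"]) (simp_all add: of_top_def)
  moreover have "snd w \<in> carrier H" if "w \<in> carrier W" for w
    using that by (auto simp: W_carrier)
  ultimately show ?thesis unfolding orbit_def by blast
qed

lemma property_FA_H:
  assumes FA: "property_FA W"
  shows "property_FA H"
  unfolding property_FA_def
proof (intro allI impI ballI)
  fix V :: "('h \<times> 'h \<times> nat) set" and E \<psi> v
  assume "graph_tree V E \<and> graph_action H V E \<psi>" and v: "v \<in> V"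
  then have tree: "graph_tree V E" and act: "graph_action H V E \<psi>" by auto
  have "graph_action W V E (\<lambda>w. \<psi> (snd w))"
    using act group_action_pullback[OF _ W.is_group snd_hom, of V \<psi>]
    by (auto simp: graph_action_def W_carrier)
  from property_FA_all_types[OF FA tree this v]
  show "Metric_space.mbounded V (\<lambda>x y. real (graph_dist E x y)) (orbit H \<psi> v)"
    unfolding orbit_snd .
qed

lemma property_FR_H:
  assumes FR: "property_FR W"
  shows "property_FR H"
  unfolding property_FR_def
proof (intro allI impI ballI)
  fix T :: "('h \<times> 'h \<times> real) set" and d \<psi> v
  assume "real_tree T d \<and> isometric_action H T d \<psi>" and v: "v \<in> T"
  then have tree: "real_tree T d" and act: "isometric_action H T d \<psi>" by auto
  have "isometric_action W T d (\<lambda>w. \<psi> (snd w))"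
    using act group_action_pullback[OF _ W.is_group snd_hom, of T \<psi>]
    by (auto simp: isometric_action_def W_carrier)
  from property_FR_all_types[OF FR tree this v]
  show "Metric_space.mbounded T d (orbit H \<psi> v)"
    unfolding orbit_snd .
qed

lemma W_inv:
  assumes f: "f \<in> N" and h: "h \<in> carrier H"
  shows "inv\<^bsub>W\<^esub> (f, h) = (\<lambda>x\<in>X. inv\<^bsub>G\<^esub> (f (\<phi> h x)), inv\<^bsub>H\<^esub> h)"
proof -
  obtain f' h' where inv: "inv\<^bsub>W\<^esub> (f, h) = (f', h')" by fastforce
  have fh: "(f, h) \<in> carrier W" using assms by (simp add: W_carrier)
  then have f'h': "f' \<in> N" "h' \<in> carrier H"
    using W.inv_closed[OF fh] by (simp_all add: inv W_carrier)
  have "(f', h') \<otimes>\<^bsub>W\<^esub> (f, h) = \<one>\<^bsub>W\<^esub>" using W.l_inv[OF fh] by (simp add: inv)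
  then have eq: "(\<lambda>x\<in>X. f' x \<otimes>\<^bsub>G\<^esub> f (\<phi> (inv\<^bsub>H\<^esub> h') x)) = (\<lambda>x\<in>X. \<one>\<^bsub>G\<^esub>)" "h' \<otimes>\<^bsub>H\<^esub> h = \<one>\<^bsub>H\<^esub>"
    by (simp_all add: W_mult W_one)
  have h': "h' = inv\<^bsub>H\<^esub> h" using H.inv_equality[OF eq(2) h f'h'(2)] by simp
  have "f' x = inv\<^bsub>G\<^esub> (f (\<phi> h x))" if x: "x \<in> X" for x
  proof -
    have "f' x \<otimes>\<^bsub>G\<^esub> f (\<phi> h x) = \<one>\<^bsub>G\<^esub>"
      using fun_cong[OF eq(1), of x] x h by (simp add: h')
    then show ?thesis
      using G.inv_equality N_closed f f'h'(1) act_closed[OF h x] x by metis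
  qed
  then have "f' = (\<lambda>x\<in>X. inv\<^bsub>G\<^esub> (f (\<phi> h x)))"
    using f'h'(1) by (auto simp: N_iff PiE_iff extensional_def fun_eq_iff)
  then show ?thesis by (simp add: inv h')
qed

text \<open>
  The functions whose value at each \<open>x\<close> lies in \<open>K n x\<close> form an \<open>H\<close>-invariant subgroup of the direct
  sum. Finite supports ensure that these subgroups exhaust it. Letting \<open>K\<close> depend on \<open>x\<close> covers both
  an exhaustion of \<open>G\<close> and an exhaustion of \<open>X\<close> by invariant sets.
\<close>

lemma countable_increasing_union_by_fibres:
  fixes K :: "nat \<Rightarrow> 'x \<Rightarrow> 'g set"
  assumes sub: "\<And>n x. x \<in> X \<Longrightarrow> subgroup (K n x) G"
    and mono: "\<And>n x. x \<in> X \<Longrightarrow> K n x \<subseteq> K (Suc n) x"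
    and all: "\<And>x. x \<in> X \<Longrightarrow> carrier G = (\<Union>n. K n x)"
    and inv: "\<And>n h x. h \<in> carrier H \<Longrightarrow> x \<in> X \<Longrightarrow> K n (\<phi> h x) = K n x"
    and proper: "\<And>n. \<exists>x\<in>X. K n x \<noteq> carrier G"
  shows "countable_increasing_union W"
proof -
  define P where "P n = {w \<in> carrier W. \<forall>x\<in>X. fst w x \<in> K n x}" for n
  have "subgroup (P n) W" for n
  proof (rule W.subgroupI)
    have "\<one>\<^bsub>W\<^esub> \<in> P n" using subgroup.one_closed[OF sub] W.one_closed by (auto simp: P_def W_one)
    then show "P n \<noteq> {}" by blast
    show "inv\<^bsub>W\<^esub> w \<in> P n" if w: "w \<in> P n" for w
    proof -
      obtain f h where fh: "w = (f, h)" "f \<in> N" "h \<in> carrier H" "\<And>x. x \<in> X \<Longrightarrow> f x \<in> K n x"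
        using w by (cases w) (auto simp: P_def W_carrier)
      have "inv\<^bsub>G\<^esub> (f (\<phi> h x)) \<in> K n x" if "x \<in> X" for x
        using subgroup.m_inv_closed[OF sub] fh(4) inv[OF fh(3) that] act_closed[OF fh(3) that] by metis
      moreover have "inv\<^bsub>W\<^esub> w \<in> carrier W" using w by (simp add: P_def)
      ultimately show ?thesis by (simp add: P_def fh(1) W_inv[OF fh(2,3)])
    qed
    show "v \<otimes>\<^bsub>W\<^esub> w \<in> P n" if vw: "v \<in> P n" "w \<in> P n" for v w
    proof -
      obtain f h f' h' where fh: "v = (f, h)" "w = (f', h')" "h \<in> carrier H"
        "\<And>x. x \<in> X \<Longrightarrow> f x \<in> K n x" "\<And>x. x \<in> X \<Longrightarrow> f' x \<in> K n x"
        using vw by (cases v; cases w) (auto simp: P_def W_carrier)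
      have "f' (\<phi> (inv\<^bsub>H\<^esub> h) x) \<in> K n x" if "x \<in> X" for x
        using fh(5)[OF act_closed[OF H.inv_closed[OF fh(3)] that]] inv[OF H.inv_closed[OF fh(3)] that]
        by simp
      moreover have "v \<otimes>\<^bsub>W\<^esub> w \<in> carrier W" using vw by (simp add: P_def)
      ultimately show ?thesis
        using fh(4) subgroup.m_closed[OF sub] by (simp add: P_def fh(1,2) W_mult)
    qed
  qed (auto simp: P_def)
  moreover have "P n \<noteq> carrier W" for n
  proof -
    obtain x where x: "x \<in> X" "K n x \<noteq> carrier G" using proper by blast
    then obtain g where g: "g \<in> carrier G" "g \<notin> K n x" using subgroup.subset[OF sub] by blast
    then have "single x g \<in> carrier W" "single x g \<notin> P n"
      using single_closed x(1) by (auto simp: P_def single_def of_base_def)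
    then show ?thesis by blast
  qed
  moreover have "P n \<subseteq> P (Suc n)" for n using mono by (auto simp: P_def)
  moreover have "carrier W = (\<Union>n. P n)"
  proof -
    have mono': "K m x \<subseteq> K n x" if "m \<le> n" "x \<in> X" for m n x
      using mono[OF that(2)] that(1) by (rule lift_Suc_mono_le)
    have "\<exists>n. w \<in> P n" if w: "w \<in> carrier W" for w
    proof -
      obtain f h where fh: "w = (f, h)" "f \<in> N" using w by (cases w) (auto simp: W_carrier)
      let ?F = "{x \<in> X. f x \<noteq> \<one>\<^bsub>G\<^esub>}"
      have "\<exists>n. f x \<in> K n x" if "x \<in> X" for x
        using all[OF that] N_closed[OF fh(2) that] by blast
      then obtain n where n: "\<And>x. x \<in> X \<Longrightarrow> f x \<in> K (n x) x" by metis
      have F: "finite ?F" using fh(2) by (simp add: N_iff)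
      \<comment> \<open>Any upper bound of \<open>n\<close> on the finite support would do.\<close>
      define m where "m = sum n ?F"
      have "f x \<in> K m x" if x: "x \<in> X" for x
      proof (cases "f x = \<one>\<^bsub>G\<^esub>")
        case True
        then show ?thesis using subgroup.one_closed[OF sub[OF x]] by simp
      next
        case False
        then have "n x \<le> m" unfolding m_def using F x by (intro member_le_sum) auto
        then show ?thesis using mono'[OF _ x] n[OF x] by blast
      qed
      then show ?thesis using w by (auto simp: P_def fh(1))
    qed
    then show ?thesis by (auto simp: P_def)
  qed
  ultimately show ?thesis unfolding countable_increasing_union_def by blast
qed

lemma countable_increasing_union_base:
  assumes "X \<noteq> {}" "countable_increasing_union G"
  shows "countable_increasing_union W"
proof -
  obtain K where "(\<forall>n. subgroup (K n) G \<and> K n \<noteq> carrier G) \<and>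
      (\<forall>n. K n \<subseteq> K (Suc n)) \<and> carrier G = (\<Union>n :: nat. K n)"
    using assms(2) unfolding countable_increasing_union_def by (elim exE)
  then show ?thesis
    using assms(1) by (intro countable_increasing_union_by_fibres[of "\<lambda>n x. K n"]) blast+
qed

text \<open>
  Let \<open>e\<close> enumerate infinitely many orbits. The functions that are trivial on the orbits \<open>e k\<close> with
  \<open>k \<ge> n\<close> exhaust the direct sum as \<open>n\<close> grows.
\<close>

lemma countable_increasing_union_orbits:
  assumes inf: "infinite (orbits H X \<phi>)" and nontrivial: "carrier G \<noteq> {\<one>\<^bsub>G\<^esub>}"
  shows "countable_increasing_union W"
proof -
  obtain e :: "nat \<Rightarrow> 'x set" where e: "inj e" "range e \<subseteq> orbits H X \<phi>"
    using infinite_countable_subset[OF inf] by blast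
  have orbit_eq: "orbit H \<phi> (\<phi> h x) = orbit H \<phi> x" if h: "h \<in> carrier H" and x: "x \<in> X" for h x
  proof -
    have y: "\<phi> h x \<in> X" using act_closed h x .
    have sub: "orbit H \<phi> u \<subseteq> X" if "u \<in> X" for u using that act_closed by (auto simp: orbit_def)
    have 1: "\<phi> h x \<in> orbit H \<phi> x" using h by (auto simp: orbit_def)
    then have 2: "x \<in> orbit H \<phi> (\<phi> h x)" using A.orbit_sym x y by blast
    show ?thesis
      using A.orbit_trans[OF x y _ 1] A.orbit_trans[OF y x _ 2] sub[OF x] sub[OF y] by blast
  qed
  define K where "K n x = (if \<exists>k\<ge>n. orbit H \<phi> x = e k then {\<one>\<^bsub>G\<^esub>} else carrier G)" for n x
  show ?thesis
  proof (rule countable_increasing_union_by_fibres[of K])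
    show "subgroup (K n x) G" for n x
      using G.triv_subgroup G.subgroup_self by (simp add: K_def)
    show "K n x \<subseteq> K (Suc n) x" for n x
    proof -
      have "\<exists>k\<ge>n. orbit H \<phi> x = e k" if "\<exists>k\<ge>Suc n. orbit H \<phi> x = e k"
        using that Suc_leD by blast
      then show ?thesis by (simp add: K_def)
    qed
    show "carrier G = (\<Union>n. K n x)" for x
    proof -
      have "\<exists>n. \<forall>k\<ge>n. orbit H \<phi> x \<noteq> e k"
        using e(1) by (metis Suc_n_not_le_n injD)
      then obtain n where "\<forall>k\<ge>n. orbit H \<phi> x \<noteq> e k" by blast
      then have "K n x = carrier G" by (auto simp: K_def)
      moreover have "K n x \<subseteq> carrier G" for n by (auto simp: K_def)
      ultimately show ?thesis by blast
    qed
    show "K n (\<phi> h x) = K n x" if "h \<in> carrier H" "x \<in> X" for n h x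
      using orbit_eq[OF that] by (simp add: K_def)
    show "\<exists>x\<in>X. K n x \<noteq> carrier G" for n
    proof -
      have "e n \<in> orbits H X \<phi>" using e(2) by blast
      then obtain x where "x \<in> X" "orbit H \<phi> x = e n" by (auto simp: orbits_def)
      then show ?thesis using nontrivial by (auto simp: K_def)
    qed
  qed
qed

text \<open>
  The sum over \<open>X\<close> is invariant under the action of \<open>H\<close>, hence a homomorphism on the wreath product.
\<close>

lemma int_hom_of_base:
  assumes t: "t \<in> hom G integer_group"
  shows "(\<lambda>w. \<Sum>x | x \<in> X \<and> fst w x \<noteq> \<one>\<^bsub>G\<^esub>. t (fst w x)) \<in> hom W integer_group"
proof -
  interpret t: group_hom G integer_group t
    using t by (simp add: group_hom_def group_hom_axioms_def G.is_group)
  have t1: "t \<one>\<^bsub>G\<^esub> = 0" using t.hom_one by simp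
  have tm: "t (g \<otimes>\<^bsub>G\<^esub> k) = t g + t k" if "g \<in> carrier G" "k \<in> carrier G" for g k
    using t.hom_mult that by simp
  have sum_eq: "(\<Sum>x | x \<in> X \<and> f x \<noteq> \<one>\<^bsub>G\<^esub>. t (f x)) = (\<Sum>x\<in>S. t (f x))"
    if "finite S" "S \<subseteq> X" "{x \<in> X. f x \<noteq> \<one>\<^bsub>G\<^esub>} \<subseteq> S" for f S
    using that t1 by (intro sum.mono_neutral_left) auto
  show ?thesis
  proof (rule homI)
    fix v w assume vw: "v \<in> carrier W" "w \<in> carrier W"
    obtain f h f' h' where fh: "v = (f, h)" "w = (f', h')" "f \<in> N" "h \<in> carrier H" "f' \<in> N"
      using vw by (cases v; cases w) (auto simp: W_carrier)
    let ?F = "{x \<in> X. f x \<noteq> \<one>\<^bsub>G\<^esub>}" and ?F' = "{x \<in> X. f' x \<noteq> \<one>\<^bsub>G\<^esub>}"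
    let ?i = "inv\<^bsub>H\<^esub> h"
    let ?g = "\<lambda>x\<in>X. f x \<otimes>\<^bsub>G\<^esub> f' (\<phi> ?i x)"
    \<comment> \<open>A finite set that contains the support of the product and that of both factors, the second one
      shifted by \<open>h\<close>.\<close>
    define S where "S = ?F \<union> \<phi> h ` ?F'"
    have i: "?i \<in> carrier H" using fh(4) by simp
    have S: "finite S" "S \<subseteq> X" "?F \<subseteq> S"
      using fh act_closed by (auto simp: S_def N_iff)
    have shifted: "x \<in> \<phi> h ` ?F'" if "x \<in> X" "f' (\<phi> ?i x) \<noteq> \<one>\<^bsub>G\<^esub>" for x
      using that act_closed[OF i] act_inv(2)[OF fh(4) that(1)]
      by (intro image_eqI[of _ _ "\<phi> ?i x"]) auto
    have "{x \<in> X. ?g x \<noteq> \<one>\<^bsub>G\<^esub>} \<subseteq> S"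
      using shifted N_closed[OF fh(5)] act_closed[OF i] by (auto simp: S_def)
    then have "(\<Sum>x | x \<in> X \<and> ?g x \<noteq> \<one>\<^bsub>G\<^esub>. t (?g x)) = (\<Sum>x\<in>S. t (?g x))"
      using S by (intro sum_eq) auto
    also have "\<dots> = (\<Sum>x\<in>S. t (f x) + t (f' (\<phi> ?i x)))"
      using S(2) N_closed[OF fh(3)] N_closed[OF fh(5)] act_closed[OF i]
      by (intro sum.cong) (auto simp: tm subset_iff)
    also have "\<dots> = (\<Sum>x\<in>S. t (f x)) + (\<Sum>x\<in>S. t (f' (\<phi> ?i x)))" by (rule sum.distrib)
    also have "(\<Sum>x\<in>S. t (f x)) = (\<Sum>x\<in>?F. t (f x))" using sum_eq[OF S] by simp
    also have "(\<Sum>x\<in>S. t (f' (\<phi> ?i x))) = (\<Sum>x\<in>\<phi> h ` ?F'. t (f' (\<phi> ?i x)))"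
    proof (intro sum.mono_neutral_right ballI)
      fix x assume "x \<in> S - \<phi> h ` ?F'"
      then have "f' (\<phi> ?i x) = \<one>\<^bsub>G\<^esub>" using shifted[of x] S(2) by blast
      then show "t (f' (\<phi> ?i x)) = 0" using t1 by simp
    qed (use S in \<open>auto simp: S_def\<close>)
    also have "\<dots> = (\<Sum>x\<in>?F'. t (f' (\<phi> ?i (\<phi> h x))))"
      by (intro sum.reindex[unfolded o_def] inj_on_subset[OF A.inj_prop[OF fh(4)]]) auto
    also have "\<dots> = (\<Sum>x\<in>?F'. t (f' x))"
      using act_inv(1)[OF fh(4)] by (intro sum.cong) auto
    finally show "(\<Sum>x | x \<in> X \<and> fst (v \<otimes>\<^bsub>W\<^esub> w) x \<noteq> \<one>\<^bsub>G\<^esub>. t (fst (v \<otimes>\<^bsub>W\<^esub> w) x)) =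
        (\<Sum>x | x \<in> X \<and> fst v x \<noteq> \<one>\<^bsub>G\<^esub>. t (fst v x)) \<otimes>\<^bsub>integer_group\<^esub>
        (\<Sum>x | x \<in> X \<and> fst w x \<noteq> \<one>\<^bsub>G\<^esub>. t (fst w x))"
      by (simp add: fh(1,2) W_mult)
  qed simp
qed

lemma has_quotient_Z_base:
  assumes X: "X \<noteq> {}" and Z: "has_quotient_Z G"
  shows "has_quotient_Z W"
proof -
  obtain t g where t: "t \<in> hom G integer_group" and g: "g \<in> carrier G" "t g \<noteq> 0"
    using Z G.has_quotient_Z_iff_int_hom by blast
  obtain x where x: "x \<in> X" using X by blast
  let ?T = "\<lambda>w :: ('x \<Rightarrow> 'g) \<times> 'h. \<Sum>x | x \<in> X \<and> fst w x \<noteq> \<one>\<^bsub>G\<^esub>. t (fst w x)"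
  interpret t: group_hom G integer_group t
    using t by (simp add: group_hom_def group_hom_axioms_def G.is_group)
  have "g \<noteq> \<one>\<^bsub>G\<^esub>" using g t.hom_one by auto
  then have "{y \<in> X. fst (single x g) y \<noteq> \<one>\<^bsub>G\<^esub>} = {x}"
    using x by (auto simp: single_def of_base_def)
  then have "?T (single x g) = t g" using x by (simp add: single_def of_base_def)
  then show ?thesis
    unfolding W.has_quotient_Z_iff_int_hom
    using int_hom_of_base[OF t] single_closed[OF g(1), of x] g(2)
    by (intro exI[of _ ?T] conjI bexI[of _ "single x g"]) simp_all
qed

lemma necessary:
  assumes W: "property_FA W \<or> property_FR W" and X: "X \<noteq> {}" and G: "carrier G \<noteq> {\<one>\<^bsub>G\<^esub>}"
  shows "finite (orbits H X \<phi>) \<and> \<not> has_quotient_Z G \<and> \<not> countable_increasing_union G"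
proof -
  have U: "\<not> countable_increasing_union W"
    using FA_or_FR_not_countable_union[OF W.is_group W] .
  have "\<not> has_quotient_Z W"
    using FA_or_FR_int_hom_trivial[OF W.is_group W] W.has_quotient_Z_iff_int_hom by blast
  then show ?thesis
    using U has_quotient_Z_base[OF X] countable_increasing_union_base[OF X]
      countable_increasing_union_orbits[OF _ G] by blast
qed

end

theorem theorem3:
  fixes G :: "('g, 'c) monoid_scheme" and H :: "('h, 'd) monoid_scheme"
    and X :: "'x set" and \<phi> :: "'h \<Rightarrow> 'x \<Rightarrow> 'x"
  assumes "group G" and "group H" and "carrier G \<noteq> {\<one>\<^bsub>G\<^esub>}"
    and "group_action H X \<phi>" and "X \<noteq> {}" and "no_fixed_points H X \<phi>"
  shows "(property_FA (wreath_product G H X \<phi>) \<longleftrightarrow>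
            property_FA H \<and> finite (orbits H X \<phi>) \<and>
            \<not> has_quotient_Z G \<and> \<not> countable_increasing_union G) \<and>
         (property_FR (wreath_product G H X \<phi>) \<longleftrightarrow>
            property_FR H \<and> finite (orbits H X \<phi>) \<and>
            \<not> has_quotient_Z G \<and> \<not> countable_increasing_union G)"
proof -
  interpret wreath G H X \<phi>
    using assms(1,4) by (simp add: wreath_def)
  note nec = necessary[OF _ assms(5,3)]
  have "property_FA W \<longleftrightarrow> property_FA H \<and> finite (orbits H X \<phi>) \<and>
      \<not> has_quotient_Z G \<and> \<not> countable_increasing_union G"
    using nec[OF disjI1] property_FA_H property_FA_if[OF _ _ assms(6)] by blast
  moreover have "property_FR W \<longleftrightarrow> property_FR H \<and> finite (orbits H X \<phi>) \<and>
      \<not> has_quotient_Z G \<and> \<not> countable_increasing_union G"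
    using nec[OF disjI2] property_FR_H property_FR_if[OF _ _ assms(6)] by blast
  ultimately show ?thesis unfolding W_def by simp
qed

end
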